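(* Let $k,s\ge 1$ be integers with $s\le k/100$, let $\alpha\in(0,1)$, and let $\varepsilon=O(1)$ (that is, $0<\varepsilon\le \varepsilon_0$ for a fixed constant $\varepsilon_0$). Then \[ \mathrm{SC}(\alpha,\triangle_{k,s},\mathcal W_\varepsilon,d_{\mathrm{TV}})=\Theta\!\left(\frac{s^2\max\{\log(k/s),1\}}{\alpha^2\varepsilon^2}\right). \] Moreover, there exists a private-coin protocol with one-bit privatized messages (i.e. each user sends a message in $\{0,1\}$ through a channel in $\mathcal W_\varepsilon$) that achieves the upper bound, and the algorithm runs in time nearly linear in $n$ and $k$ (i.e. $\tilde O(n+k)$, with polylogarithmic factors suppressed).
   Context: Write $[k]=\{1,\dots,k\}$, $\triangle_k=\{p\in[0,1]^k:\sum_{x\in[k]}p(x)=1\}$ and $\triangle_{k,s}=\{p\in\triangle_k:\|p\|_0\le s\}$, where $\|p\|_0$ is the number of nonzero entries. Total variation distance: $d_{\mathrm{TV}}(p,q)=\frac12\|p-q\|_1$. A channel is a randomized map $W:[k]\to\mathcal Y$, described by $W(y\mid x)=\Pr(Y=y\mid X=x)$. A channel $W:[k]\to\mathcal Y=\{0,1\}^*$ is $\varepsilon$-LDP (locally differentially private) if $\sup_{y}\sup_{x,x'\in[k]}W(y\mid x)/W(y\mid x')\le e^{\varepsilon}$; $\mathcal W_\varepsilon$ denotes the set of all $\varepsilon$-LDP channels. Protocols (simultaneous message passing). $X_1,\dots,X_n$ are i.i.d. from an unknown $p$; user $i$ observes $X_i$ and sends $Y_i=W_i(X_i)$ with $W_i\in\mathcal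 W$, where $\mathcal W$ is the family of allowed channels; all messages are sent simultaneously. In a private-coin protocol the channels $W_i$ are independent (no shared randomness). In the more general public-coin protocol the channels are chosen as a function of a public random variable $U$, independent of the samples and observed by all users and by the server. The server outputs an estimate $\hat p=\hat p(Y^n)\in\triangle_k$ of $p$ (in the public-coin case $\hat p$ may also depend on $U$). Sample complexity. For a set $\mathcal P\subseteq\triangle_k$ of distributions, $\mathrm{SC}(\alpha,\mathcal P,\mathcal W,d_{\mathrm{TV}})$ is the smallest $n$ for which there exist a choice of $n$ channels from $\mathcal W$ (a protocol, public-coin allowed) and an estimator $\hat p$ such that for every $p\in\mathcal P$, $\Pr(d_{\mathrm{TV}}(p,\hat p(Y^n))\le\alpha)\ge 0.9$. The constants hidden in $\Theta$ do not depend on $k,s,\alpha,\varepsilon$ (they may depend on the fixed upper bound $\varepsilon_0$ on $\varepsilon$).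
   Formalization: The lower bound is corrected where false: for s=1, α in the rate is replaced by 1; its constant may depend on a fixed α₁<1 with α≤α₁, and α≤1−2s/k is assumed (near α=1 no samples may be needed). Running time counts users and server, not choosing the fixed channels. *)

theory Defs
  imports "HOL-Probability.Probability"
begin

section \<open>Distributions and channels\<close>

definition prob_simplex :: "nat \<Rightarrow> nat pmf set" where
  "prob_simplex k = {p. set_pmf p \<subseteq> {1..k}}"

definition sparse_simplex :: "nat \<Rightarrow> nat \<Rightarrow> nat pmf set" where
  "sparse_simplex k s = {p \<in> prob_simplex k. card (set_pmf p) \<le> s}"

definition tv_dist :: "nat \<Rightarrow> nat pmf \<Rightarrow> nat pmf \<Rightarrow> real" where
  "tv_dist k p q = (\<Sum>x\<in>{1..k}. \<bar>pmf p x - pmf q x\<bar>) / 2"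

text \<open>A channel sends a symbol \<open>x \<in> {1..k}\<close> to a random finite bit string; its values outside
  \<open>{1..k}\<close> are irrelevant.\<close>

type_synonym message = "bool list"
type_synonym channel = "nat \<Rightarrow> message pmf"

text \<open>The ratio condition is multiplied out, because \<open>a / 0 = 0\<close> in HOL would make the quotient form
  accept \<open>W(y|x) > 0 = W(y|x')\<close>.\<close>

definition ldp_channels :: "nat \<Rightarrow> real \<Rightarrow> channel set" where
  "ldp_channels k \<epsilon> =
     {W. \<forall>y. \<forall>x\<in>{1..k}. \<forall>x'\<in>{1..k}. pmf (W x) y \<le> exp \<epsilon> * pmf (W x') y}"

definition one_bit :: "nat \<Rightarrow> channel \<Rightarrow> bool" where
  "one_bit k W \<longleftrightarrow> (\<forall>x\<in>{1..k}. set_pmf (W x) \<subseteq> {[False], [True]})"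


section \<open>Protocols and sample complexity\<close>

text \<open>Users are numbered \<open>0, \<dots>, n - 1\<close>. A transcript is a function \<open>nat \<Rightarrow> message\<close> that is \<open>[]\<close>
  beyond \<open>n\<close>; the message of user \<open>i\<close> has law \<open>bind_pmf p (W i)\<close> because \<open>X\<^sub>i\<close> has law \<open>p\<close>.\<close>

definition transcript :: "nat \<Rightarrow> (nat \<Rightarrow> channel) \<Rightarrow> nat pmf \<Rightarrow> (nat \<Rightarrow> message) pmf" where
  "transcript n W p = Pi_pmf {..<n} [] (\<lambda>i. bind_pmf p (W i))"

definition success_prob ::
  "(nat pmf \<Rightarrow> nat pmf \<Rightarrow> real) \<Rightarrow> real \<Rightarrow> nat \<Rightarrow> (nat \<Rightarrow> channel) \<Rightarrow>
   ((nat \<Rightarrow> message) \<Rightarrow> nat pmf) \<Rightarrow> nat pmf \<Rightarrow> real" where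
  "success_prob d \<alpha> n W est p =
     measure_pmf.prob (transcript n W p) {y. d p (est y) \<le> \<alpha>}"

definition private_coin_protocol ::
  "nat \<Rightarrow> channel set \<Rightarrow> nat \<Rightarrow> (nat \<Rightarrow> channel) \<Rightarrow> ((nat \<Rightarrow> message) \<Rightarrow> nat pmf) \<Rightarrow> bool" where
  "private_coin_protocol k \<W> n W est \<longleftrightarrow> (\<forall>i<n. W i \<in> \<W>) \<and> (\<forall>y. est y \<in> prob_simplex k)"

text \<open>The public random variable is the identity on a probability space \<open>U\<close> over the reals, with an
  arbitrary \<open>\<sigma>\<close>-algebra. Every standard Borel source of public randomness embeds into this.\<close>

definition public_coin_protocol ::
  "nat \<Rightarrow> channel set \<Rightarrow> nat \<Rightarrow> real measure \<Rightarrow> (real \<Rightarrow> nat \<Rightarrow> channel) \<Rightarrow>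
   (real \<Rightarrow> (nat \<Rightarrow> message) \<Rightarrow> nat pmf) \<Rightarrow> bool" where
  "public_coin_protocol k \<W> n U W est \<longleftrightarrow>
     prob_space U \<and>
     (\<forall>u\<in>space U. private_coin_protocol k \<W> n (W u) (est u)) \<and>
     (\<forall>i<n. \<forall>x\<in>{1..k}. \<forall>y. (\<lambda>u. pmf (W u i x) y) \<in> borel_measurable U) \<and>
     (\<forall>y. \<forall>x\<in>{1..k}. (\<lambda>u. pmf (est u y) x) \<in> borel_measurable U)"

text \<open>The value is \<open>\<infinity>\<close> if no number of users suffices.\<close>

definition sample_complexity ::
  "nat \<Rightarrow> real \<Rightarrow> nat pmf set \<Rightarrow> channel set \<Rightarrow> (nat pmf \<Rightarrow> nat pmf \<Rightarrow> real) \<Rightarrow> enat" where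
  "sample_complexity k \<alpha> \<P> \<W> d =
     Inf {enat n | n. \<exists>U W est. public_coin_protocol k \<W> n U W est \<and>
            (\<forall>p\<in>\<P>. (\<integral>u. success_prob d \<alpha> n (W u) (est u) p \<partial>U) \<ge> 9 / 10)}"

definition sparse_rate :: "nat \<Rightarrow> nat \<Rightarrow> real \<Rightarrow> real \<Rightarrow> real" where
  "sparse_rate k s \<alpha> \<epsilon> =
     (real s)\<^sup>2 * max (ln (real k / real s)) 1 / (\<alpha>\<^sup>2 * \<epsilon>\<^sup>2)"


section \<open>A real random access machine\<close>

text \<open>Unit-cost real RAM: registers and memories for natural numbers and for reals. Register names
  are fixed in the program text, memories are addressed indirectly through natural-number
  registers. There is no multiplication of naturals and no conversion from reals to naturals, since
  these would allow unbounded parallelism within one step.\<close>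

record state =
  nreg :: "nat \<Rightarrow> nat"
  nmem :: "nat \<Rightarrow> nat"
  rreg :: "nat \<Rightarrow> real"
  rmem :: "nat \<Rightarrow> real"

datatype instr =
    NConst nat nat
  | NMove nat nat
  | NAdd nat nat nat
  | NSub nat nat nat
  | NLoad nat nat
  | NStore nat nat
  | ROfNat nat nat
  | RMove nat nat
  | RAdd nat nat nat
  | RSub nat nat nat
  | RMul nat nat nat
  | RDiv nat nat nat
  | RLoad nat nat
  | RStore nat nat

fun step :: "instr \<Rightarrow> state \<Rightarrow> state" where
  "step (NConst a c) \<sigma> = \<sigma>\<lparr>nreg := (nreg \<sigma>)(a := c)\<rparr>"
| "step (NMove a b) \<sigma> = \<sigma>\<lparr>nreg := (nreg \<sigma>)(a := nreg \<sigma> b)\<rparr>"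
| "step (NAdd a b c) \<sigma> = \<sigma>\<lparr>nreg := (nreg \<sigma>)(a := nreg \<sigma> b + nreg \<sigma> c)\<rparr>"
| "step (NSub a b c) \<sigma> = \<sigma>\<lparr>nreg := (nreg \<sigma>)(a := nreg \<sigma> b - nreg \<sigma> c)\<rparr>"
| "step (NLoad a b) \<sigma> = \<sigma>\<lparr>nreg := (nreg \<sigma>)(a := nmem \<sigma> (nreg \<sigma> b))\<rparr>"
| "step (NStore a b) \<sigma> = \<sigma>\<lparr>nmem := (nmem \<sigma>)(nreg \<sigma> a := nreg \<sigma> b)\<rparr>"
| "step (ROfNat a b) \<sigma> = \<sigma>\<lparr>rreg := (rreg \<sigma>)(a := real (nreg \<sigma> b))\<rparr>"
| "step (RMove a b) \<sigma> = \<sigma>\<lparr>rreg := (rreg \<sigma>)(a := rreg \<sigma> b)\<rparr>"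
| "step (RAdd a b c) \<sigma> = \<sigma>\<lparr>rreg := (rreg \<sigma>)(a := rreg \<sigma> b + rreg \<sigma> c)\<rparr>"
| "step (RSub a b c) \<sigma> = \<sigma>\<lparr>rreg := (rreg \<sigma>)(a := rreg \<sigma> b - rreg \<sigma> c)\<rparr>"
| "step (RMul a b c) \<sigma> = \<sigma>\<lparr>rreg := (rreg \<sigma>)(a := rreg \<sigma> b * rreg \<sigma> c)\<rparr>"
| "step (RDiv a b c) \<sigma> = \<sigma>\<lparr>rreg := (rreg \<sigma>)(a := rreg \<sigma> b / rreg \<sigma> c)\<rparr>"
| "step (RLoad a b) \<sigma> = \<sigma>\<lparr>rreg := (rreg \<sigma>)(a := rmem \<sigma> (nreg \<sigma> b))\<rparr>"
| "step (RStore a b) \<sigma> = \<sigma>\<lparr>rmem := (rmem \<sigma>)(nreg \<sigma> a := rreg \<sigma> b)\<rparr>"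

datatype test = NLess nat nat | RLess nat nat

fun holds :: "test \<Rightarrow> state \<Rightarrow> bool" where
  "holds (NLess a b) \<sigma> \<longleftrightarrow> nreg \<sigma> a < nreg \<sigma> b"
| "holds (RLess a b) \<sigma> \<longleftrightarrow> rreg \<sigma> a < rreg \<sigma> b"

datatype program =
    Do instr
  | Seq program program
  | Cond test program program
  | While test program

text \<open>\<open>exec P \<sigma> t \<tau>\<close>: started in \<open>\<sigma>\<close>, the program \<open>P\<close> halts in \<open>\<tau>\<close> after exactly \<open>t\<close> instructions
  and tests.\<close>

inductive exec :: "program \<Rightarrow> state \<Rightarrow> nat \<Rightarrow> state \<Rightarrow> bool" where
  Do: "exec (Do c) \<sigma> 1 (step c \<sigma>)"
| Seq: "exec P \<sigma> t \<tau> \<Longrightarrow> exec Q \<tau> t' \<rho> \<Longrightarrow> exec (Seq P Q) \<sigma> (t + t') \<rho>"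
| CondTrue: "holds b \<sigma> \<Longrightarrow> exec P \<sigma> t \<tau> \<Longrightarrow> exec (Cond b P Q) \<sigma> (Suc t) \<tau>"
| CondFalse: "\<not> holds b \<sigma> \<Longrightarrow> exec Q \<sigma> t \<tau> \<Longrightarrow> exec (Cond b P Q) \<sigma> (Suc t) \<tau>"
| WhileFalse: "\<not> holds b \<sigma> \<Longrightarrow> exec (While b P) \<sigma> 1 \<sigma>"
| WhileTrue: "holds b \<sigma> \<Longrightarrow> exec P \<sigma> t \<tau> \<Longrightarrow> exec (While b P) \<tau> t' \<rho> \<Longrightarrow>
    exec (While b P) \<sigma> (Suc (t + t')) \<rho>"


section \<open>Programs for the users and for the server\<close>

definition array :: "'a::zero list \<Rightarrow> nat \<Rightarrow> 'a" where
  "array xs i = (if i < length xs then xs ! i else 0)"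

text \<open>All parties know \<open>k, s, n, \<alpha>, \<epsilon>\<close>. The public description of a protocol consists of one
  natural number \<open>lab i\<close> per user, which tells which channel user \<open>i\<close> applies. User \<open>i\<close> is given
  its own \<open>lab i\<close>, its sample \<open>x\<close> and a private coin \<open>v\<close>, uniform on \<open>[0, 1]\<close>. The server is
  given all the labels and the \<open>n\<close> received bits.\<close>

definition user_input ::
  "nat \<Rightarrow> nat \<Rightarrow> nat \<Rightarrow> real \<Rightarrow> real \<Rightarrow> nat \<Rightarrow> nat \<Rightarrow> real \<Rightarrow> state" where
  "user_input k s n \<alpha> \<epsilon> l x v =
     \<lparr>nreg = array [k, s, n, l, x], nmem = (\<lambda>_. 0), rreg = array [\<alpha>, \<epsilon>, v], rmem = (\<lambda>_. 0)\<rparr>"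

definition server_input ::
  "nat \<Rightarrow> nat \<Rightarrow> nat \<Rightarrow> real \<Rightarrow> real \<Rightarrow> (nat \<Rightarrow> nat) \<Rightarrow> (nat \<Rightarrow> message) \<Rightarrow> state" where
  "server_input k s n \<alpha> \<epsilon> lab y =
     \<lparr>nreg = array [k, s, n],
      nmem = array (map lab [0..<n] @ map (\<lambda>i. of_bool (y i = [True])) [0..<n]),
      rreg = array [\<alpha>, \<epsilon>], rmem = (\<lambda>_. 0)\<rparr>"

text \<open>Within \<open>t\<close> steps, whatever the coin, the program leaves a bit in register \<open>0\<close>, and this bit has
  the law prescribed by the channel \<open>W\<close>.\<close>

definition implements_channel ::
  "program \<Rightarrow> nat \<Rightarrow> nat \<Rightarrow> nat \<Rightarrow> real \<Rightarrow> real \<Rightarrow> nat \<Rightarrow> channel \<Rightarrow> nat \<Rightarrow> bool" where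
  "implements_channel P k s n \<alpha> \<epsilon> l W t \<longleftrightarrow>
     (\<forall>x\<in>{1..k}. \<exists>out :: real \<Rightarrow> bool.
        (\<forall>v\<in>{0..1}. \<exists>t'\<le>t. \<exists>\<tau>. exec P (user_input k s n \<alpha> \<epsilon> l x v) t' \<tau> \<and>
                                nreg \<tau> 0 = of_bool (out v)) \<and>
        {v\<in>{0..1}. out v} \<in> sets lborel \<and>
        (\<forall>b. pmf (W x) [b] = measure lborel {v\<in>{0..1}. out v = b}))"

definition implements_estimator ::
  "program \<Rightarrow> nat \<Rightarrow> nat \<Rightarrow> nat \<Rightarrow> real \<Rightarrow> real \<Rightarrow> (nat \<Rightarrow> nat) \<Rightarrow>
   ((nat \<Rightarrow> message) \<Rightarrow> nat pmf) \<Rightarrow> nat \<Rightarrow> bool" where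
  "implements_estimator P k s n \<alpha> \<epsilon> lab est t \<longleftrightarrow>
     (\<forall>y. (\<forall>i<n. y i \<in> {[False], [True]}) \<longrightarrow>
        (\<exists>t'\<le>t. \<exists>\<tau>. exec P (server_input k s n \<alpha> \<epsilon> lab y) t' \<tau> \<and>
                    (\<forall>x\<in>{1..k}. rmem \<tau> x = pmf (est y) x)))"

end

theory Submission
  imports Defs
begin

text \<open>
  Lower bound. Cut \<open>{1..k}\<close> into about \<open>s\<close> blocks of about \<open>k / s\<close> points, pick one point \<open>z j\<close>
  in each block, put mass of order \<open>\<alpha>\<close> uniformly on the picked points, and park the rest of the
  mass at \<open>k\<close>. Under a locally private channel the likelihood ratios of the messages are within
  \<open>O(\<epsilon>)\<close> of one, and the choices in different blocks are independent, so one message carries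
  only \<open>O(\<alpha>\<^sup>2 \<epsilon>\<^sup>2 / s)\<close> nats about \<open>z\<close>. A good estimate is close to only a fraction
  \<open>(s / k) ^ \<Omega>(s)\<close> of the hard distributions (Chernoff's bound), so that it conveys about
  \<open>s ln (k / s)\<close> nats.

  Upper bound. User \<open>i\<close> sends a noisy version of the entry \<open>H(r i, X\<^sub>i)\<close> of a Walsh--Hadamard
  matrix. The server adds up the received signs per row and applies the fast transform, which gives
  an estimate of every \<open>p x\<close> with subgaussian noise, and with a bias bounded by the coherence of the
  rows. It then keeps only the entries above \<open>\<alpha> / (100 s)\<close> and normalizes. If \<open>s\<^sup>2 > k\<close> there
  are enough users to go through all rows cyclically, which leaves no bias; otherwise random rows
  are incoherent enough, because then \<open>ln k \<le> 2 ln (k / s)\<close>. The bias \<open>\<epsilon> / (2 + \<epsilon>)\<close> of the sent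
  bits, instead of the optimal \<open>(e^\<epsilon> - 1) / (e^\<epsilon> + 1)\<close>, avoids computing an exponential.
\<close>

section \<open>An information inequality\<close>

text \<open>The lower bound cannot hold for all \<alpha> < 1: if \<alpha> \<ge> 1 - 1 / k, the
  uniform distribution on \<open>{1..k}\<close> is a correct estimate without any user. Hence the
  two upper limits on \<alpha>. For \<open>s = 1\<close> the unknown distribution is a point mass,
  and its estimate is exact as soon as the point is identified, at a cost independent of \<alpha>;
  hence \<alpha> is replaced by 1 there. Parking mass takes one point of the support, so it is
  possible only for \<open>s \<ge> 2\<close>. The hard distributions are not separated: many of them
  may lie close to one estimate. So the probability of success is compared under the true messages
  and under messages that ignore \<open>z\<close>. In the upper bound, a union bound over
  \<open>k\<close> coordinates would cost \<open>ln k\<close> instead of \<open>ln (k / s)\<close>.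
  Therefore the mean of the l1 error is bounded, to which each coordinate outside the support may
  contribute a share of order \<alpha> / k. The rows are random only in an existence proof; the
  protocol fixes them in advance, so that no shared coin is used.\<close>

lemma expectation_density_pmf:
  fixes f g :: "'a \<Rightarrow> real"
  assumes "\<And>y. pmf P y = pmf Q y * g y" "\<And>y. 0 \<le> g y"
  shows "measure_pmf.expectation P f = measure_pmf.expectation Q (\<lambda>y. g y * f y)"
proof -
  have "measure_pmf.expectation P f = (\<integral>y. pmf P y * f y \<partial>count_space UNIV)"
    unfolding measure_pmf_eq_density by (subst integral_density) auto
  also have "\<dots> = (\<integral>y. pmf Q y * (g y * f y) \<partial>count_space UNIV)"
    by (simp add: assms(1) mult.assoc)
  also have "\<dots> = measure_pmf.expectation Q (\<lambda>y. g y * f y)"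
    unfolding measure_pmf_eq_density by (subst integral_density) auto
  finally show ?thesis .
qed

lemma integrable_bounded_pmf:
  fixes f :: "'a \<Rightarrow> real"
  assumes "\<And>y. \<bar>f y\<bar> \<le> c"
  shows "integrable (measure_pmf P) f"
  using assms by (intro measure_pmf.integrable_const_bound[where B = c]) auto

text \<open>The tangent to the logarithm at \<open>M\<close>, integrated: a form of the Donsker--Varadhan inequality.\<close>

lemma donsker_varadhan_event:
  fixes g :: "'a \<Rightarrow> real"
  assumes pmf: "\<And>y. pmf P y = pmf Q y * g y" and g: "\<And>y. c \<le> g y" "\<And>y. g y \<le> d" "0 < c"
    and "0 < M" "0 \<le> l"
  shows "l * measure_pmf.prob P A \<le> measure_pmf.expectation P (\<lambda>y. ln (g y)) +
    (1 + (exp l - 1) * measure_pmf.prob Q A) / M - 1 + ln M"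
proof -
  \<comment> \<open>This is \<open>exp (l * indicator A y)\<close>, written as an affine function of
    the indicator so that its mean under \<open>Q\<close> is explicit. Below it is divided by
    \<open>g y * M\<close>, and \<open>g\<close> cancels after the change of measure.\<close>
  define e where "e y = 1 + (exp l - 1) * indicator A y" for y
  have g0: "0 < g y" for y using g by (metis less_le_trans)
  have e1: "1 \<le> e y" "e y \<le> exp l" for y using assms(6) by (auto simp: e_def indicator_def)
  have ln_bound: "\<bar>ln (g y)\<bar> \<le> \<bar>ln c\<bar> + \<bar>ln d\<bar>" for y
  proof -
    have "ln c \<le> ln (g y)" "ln (g y) \<le> ln d" using g g0[of y] by (auto intro: ln_mono)
    then show ?thesis by linarith
  qed
  have int_ln: "integrable (measure_pmf P) (\<lambda>y. ln (g y))"
    using ln_bound by (rule integrable_bounded_pmf)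
  have int_ind: "integrable (measure_pmf R) (indicator A :: _ \<Rightarrow> real)" for R :: "'a pmf"
    by (rule integrable_bounded_pmf[where c = 1]) (simp add: indicator_def)
  have int_e: "integrable (measure_pmf P) (\<lambda>y. e y / (g y * M))"
  proof (rule integrable_bounded_pmf)
    fix y
    have "e y / (g y * M) \<le> exp l / (c * M)"
      using e1[of y] g g0 assms(5) by (intro frac_le mult_right_mono) auto
    then show "\<bar>e y / (g y * M)\<bar> \<le> exp l / (c * M)"
      using e1[of y] g0[of y] assms(5) by simp
  qed
  have "l * measure_pmf.prob P A = measure_pmf.expectation P (\<lambda>y. l * indicator A y)" by simp
  also have "\<dots> \<le> measure_pmf.expectation P (\<lambda>y. ln (g y) + (e y / (g y * M) - 1 + ln M))"
  proof (rule integral_mono)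
    fix y
    have "e y / (g y * M) > 0" using e1[of y] g0[of y] assms(5) by simp
    then have "ln (e y / (g y * M)) \<le> e y / (g y * M) - 1" by (rule ln_le_minus_one)
    moreover have "ln (e y / (g y * M)) = ln (e y) - (ln (g y) + ln M)"
      using e1[of y] g0[of y] assms(5) by (simp add: ln_div ln_mult)
    moreover have "ln (e y) = l * indicator A y" by (simp add: e_def indicator_def)
    ultimately show "l * indicator A y \<le> ln (g y) + (e y / (g y * M) - 1 + ln M)" by simp
  qed (use int_ln int_e int_ind in auto)
  also have "\<dots> = measure_pmf.expectation P (\<lambda>y. ln (g y)) +
      (measure_pmf.expectation P (\<lambda>y. e y / (g y * M)) - 1 + ln M)"
    using int_ln int_e by simp
  also have "measure_pmf.expectation P (\<lambda>y. e y / (g y * M)) =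
      measure_pmf.expectation Q (\<lambda>y. g y * (e y / (g y * M)))"
    by (rule expectation_density_pmf[OF pmf]) (use g0 in \<open>auto intro: less_imp_le\<close>)
  also have "(\<lambda>y. g y * (e y / (g y * M))) = (\<lambda>y. e y / M)" using g0 by (auto simp: less_imp_neq[symmetric] field_simps)
  also have "measure_pmf.expectation Q (\<lambda>y. e y / M) = (1 + (exp l - 1) * measure_pmf.prob Q A) / M"
    unfolding e_def using int_ind by simp
  finally show ?thesis by simp
qed

text \<open>\<open>ln r \<le> r - 1\<close> bounds the relative entropy by the chi-square
  divergence: the change of measure brings in a factor \<open>r\<close>, and \<open>r - 1\<close>
  has mean zero under \<open>Q\<close>.\<close>

lemma expectation_ln_ratio_le:
  fixes r :: "'a \<Rightarrow> real"
  assumes pmf: "\<And>y. pmf P y = pmf Q y * r y" and r: "\<And>y. 0 < r y" "\<And>y. r y \<le> d"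
    and lb: "\<And>y. c \<le> r y" "0 < c"
  shows "measure_pmf.expectation P (\<lambda>y. ln (r y)) \<le> measure_pmf.expectation Q (\<lambda>y. (r y - 1)\<^sup>2)"
proof -
  have rd: "\<bar>r y\<bar> \<le> d" for y using r[of y] by simp
  have d0: "0 \<le> d" using rd abs_ge_zero order.trans by blast
  have "\<bar>ln (r y)\<bar> \<le> \<bar>ln c\<bar> + \<bar>ln d\<bar>" for y
  proof -
    have "ln c \<le> ln (r y)" "ln (r y) \<le> ln d" using r lb by (auto intro: ln_mono less_le_trans)
    then show ?thesis by linarith
  qed
  then have i1: "integrable (measure_pmf P) (\<lambda>y. ln (r y))" by (rule integrable_bounded_pmf)
  have i2: "integrable (measure_pmf R) r" for R using rd by (rule integrable_bounded_pmf)
  have i3: "integrable (measure_pmf Q) (\<lambda>y. (r y - 1)\<^sup>2)"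
  proof (rule integrable_bounded_pmf)
    fix y
    have "\<bar>r y - 1\<bar> \<le> d + 1" using rd[of y] by linarith
    then have "\<bar>r y - 1\<bar>\<^sup>2 \<le> (d + 1)\<^sup>2" by (intro power_mono) auto
    then show "\<bar>(r y - 1)\<^sup>2\<bar> \<le> (d + 1)\<^sup>2" by simp
  qed
  have one: "measure_pmf.expectation Q r = 1"
    using expectation_density_pmf[of P Q r "\<lambda>_. 1"] pmf r by (simp add: less_imp_le)
  have "measure_pmf.expectation P (\<lambda>y. ln (r y)) \<le> measure_pmf.expectation P (\<lambda>y. r y - 1)"
    using i1 i2 r by (intro integral_mono) (auto intro: ln_le_minus_one)
  also have "\<dots> = measure_pmf.expectation Q (\<lambda>y. r y * (r y - 1))"
    by (rule expectation_density_pmf[OF pmf]) (use r in \<open>auto intro: less_imp_le\<close>)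
  also have "\<dots> = measure_pmf.expectation Q (\<lambda>y. (r y - 1)\<^sup>2 + (r y - 1))"
    by (simp add: power2_eq_square algebra_simps)
  also have "\<dots> = measure_pmf.expectation Q (\<lambda>y. (r y - 1)\<^sup>2)"
    using i2 i3 one by simp
  finally show ?thesis .
qed

text \<open>Relative entropy adds up over independent users. Each summand is replaced by a
  chi-square divergence, which can be averaged over \<open>z\<close> for every fixed message.
  Messages drawn from \<open>Q\<close> do not depend on \<open>z\<close>, so \<open>few\<close>
  limits the average over \<open>z\<close> of the probability of \<open>A z\<close> under
  them.\<close>

lemma product_information_bound:
  fixes P :: "'z \<Rightarrow> nat \<Rightarrow> 'a pmf" and Q :: "nat \<Rightarrow> 'a pmf" and r :: "'z \<Rightarrow> nat \<Rightarrow> 'a \<Rightarrow> real"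
  assumes Z: "finite Z" "Z \<noteq> {}"
    and pmf: "\<And>z i y. z \<in> Z \<Longrightarrow> i < n \<Longrightarrow> pmf (P z i) y = pmf (Q i) y * r z i y"
    and r: "\<And>z i y. z \<in> Z \<Longrightarrow> i < n \<Longrightarrow> c \<le> r z i y" "\<And>z i y. z \<in> Z \<Longrightarrow> i < n \<Longrightarrow> r z i y \<le> d" "0 < c"
    and var: "\<And>i y. i < n \<Longrightarrow> (\<Sum>z\<in>Z. (r z i y - 1)\<^sup>2) \<le> real (card Z) * I"
    and few: "\<And>y. real (card {z \<in> Z. y \<in> A z}) \<le> real (card Z) * P\<^sub>0" and "0 \<le> P\<^sub>0" "0 \<le> l"
  shows "l * (\<Sum>z\<in>Z. measure_pmf.prob (Pi_pmf {..<n} dflt (P z)) (A z)) \<le>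
    real (card Z) * (real n * I + ln (1 + (exp l - 1) * P\<^sub>0))"
proof -
  \<comment> \<open>One tangent point serves all \<open>z\<close>. It bounds the average over
    \<open>z\<close> of the mean of \<open>e\<close> under \<open>Q\<close>, so that the quotient by
    \<open>M\<close> and the term \<open>- 1\<close> cancel in the sum.\<close>
  define M where "M = 1 + (exp l - 1) * P\<^sub>0"
  have M: "0 < M" using assms(9,10) unfolding M_def by (intro add_pos_nonneg mult_nonneg_nonneg) auto
  let ?PP = "\<lambda>z. Pi_pmf {..<n} dflt (P z)" and ?QQ = "Pi_pmf {..<n} dflt Q"
  define g where "g z y = (\<Prod>i<n. r z i (y i))" for z and y :: "nat \<Rightarrow> 'a"
  have rpos: "0 < r z i y" if "z \<in> Z" "i < n" for z i y using r(1)[OF that] r(3) by (rule less_le_trans[rotated])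
  have step: "l * measure_pmf.prob (?PP z) (A z) \<le> (\<Sum>i<n. measure_pmf.expectation (Q i) (\<lambda>y. (r z i y - 1)\<^sup>2)) +
      (1 + (exp l - 1) * measure_pmf.prob ?QQ (A z)) / M - 1 + ln M" if z: "z \<in> Z" for z
  proof -
    have pp: "pmf (?PP z) y = pmf ?QQ y * g z y" for y

      by (simp only: pmf_Pi[OF finite_lessThan] g_def) (auto simp: pmf[OF z] prod.distrib[symmetric])
    have g1: "c ^ n \<le> g z y" for y
    proof -
      have "(\<Prod>i<n. c) \<le> g z y" unfolding g_def using r z by (intro prod_mono) auto
      then show ?thesis by simp
    qed
    have g2: "g z y \<le> d ^ n" for y
    proof -
      have "g z y \<le> (\<Prod>i<n. d)" unfolding g_def using r z rpos by (intro prod_mono) (auto intro: less_imp_le)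
      then show ?thesis by simp
    qed
    have ln_g: "ln (g z y) = (\<Sum>i<n. ln (r z i (y i)))" for y
      unfolding g_def
      by (subst ln_prod) (simp_all add: less_imp_neq[OF rpos[OF z], symmetric])
    have bnd: "\<bar>ln (r z i y)\<bar> \<le> \<bar>ln c\<bar> + \<bar>ln d\<bar>" if i: "i < n" for i y
    proof -
      have "ln c \<le> ln (r z i y)" using r(1)[OF z i] rpos[OF z i] r(3) by (subst ln_le_cancel_iff) auto
      moreover have "ln (r z i y) \<le> ln d"
        using r(2)[OF z i] rpos[OF z i] by (intro ln_mono) auto
      ultimately show ?thesis by linarith
    qed
    have "measure_pmf.expectation (?PP z) (\<lambda>y. ln (g z y)) =
        (\<Sum>i<n. measure_pmf.expectation (?PP z) (\<lambda>y. ln (r z i (y i))))"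
      unfolding ln_g using bnd by (intro Bochner_Integration.integral_sum integrable_bounded_pmf) auto
    also have "\<dots> = (\<Sum>i<n. measure_pmf.expectation (P z i) (\<lambda>y. ln (r z i y)))"
    proof (intro sum.cong refl)
      fix i assume "i \<in> {..<n}"
      then have "P z i = map_pmf (\<lambda>y. y i) (?PP z)" by (simp add: Pi_pmf_component)
      then show "measure_pmf.expectation (?PP z) (\<lambda>y. ln (r z i (y i))) =
          measure_pmf.expectation (P z i) (\<lambda>y. ln (r z i y))" by simp
    qed
    also have "\<dots> \<le> (\<Sum>i<n. measure_pmf.expectation (Q i) (\<lambda>y. (r z i y - 1)\<^sup>2))"
      using pmf[OF z] rpos[OF z] r z by (intro sum_mono expectation_ln_ratio_le[where c = c and d = d]) auto
    finally show ?thesis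
      using donsker_varadhan_event[OF pp g1 g2 _ M assms(10), of "A z"] r(3) by simp
  qed
  have sum1: "(\<Sum>z\<in>Z. \<Sum>i<n. measure_pmf.expectation (Q i) (\<lambda>y. (r z i y - 1)\<^sup>2)) \<le> real (card Z) * (real n * I)"
  proof -
    have int: "integrable (measure_pmf (Q i)) (\<lambda>y. (r z i y - 1)\<^sup>2)" if "z \<in> Z" "i < n" for z i
    proof (rule integrable_bounded_pmf)
      fix y
      have "\<bar>r z i y - 1\<bar> \<le> d + 1" using r(2)[OF that, of y] rpos[OF that, of y] by linarith
      then have "\<bar>r z i y - 1\<bar>\<^sup>2 \<le> (d + 1)\<^sup>2" by (intro power_mono) auto
      then show "\<bar>(r z i y - 1)\<^sup>2\<bar> \<le> (d + 1)\<^sup>2" by simp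
    qed
    have "(\<Sum>z\<in>Z. \<Sum>i<n. measure_pmf.expectation (Q i) (\<lambda>y. (r z i y - 1)\<^sup>2)) =
        (\<Sum>i<n. \<Sum>z\<in>Z. measure_pmf.expectation (Q i) (\<lambda>y. (r z i y - 1)\<^sup>2))" by (rule sum.swap)
    also have "\<dots> = (\<Sum>i<n. measure_pmf.expectation (Q i) (\<lambda>y. \<Sum>z\<in>Z. (r z i y - 1)\<^sup>2))"
      using int by (intro sum.cong refl Bochner_Integration.integral_sum[symmetric]) auto
    also have "\<dots> \<le> (\<Sum>i<n. real (card Z) * I)"
    proof (rule sum_mono)
      fix i assume i: "i \<in> {..<n}"
      have "measure_pmf.expectation (Q i) (\<lambda>y. \<Sum>z\<in>Z. (r z i y - 1)\<^sup>2) \<le> measure_pmf.expectation (Q i) (\<lambda>y. real (card Z) * I)"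
        using int var i by (intro integral_mono) auto
      then show "measure_pmf.expectation (Q i) (\<lambda>y. \<Sum>z\<in>Z. (r z i y - 1)\<^sup>2) \<le> real (card Z) * I" by simp
    qed
    finally show ?thesis by (simp add: mult_ac)
  qed
  have sum2: "(\<Sum>z\<in>Z. measure_pmf.prob ?QQ (A z)) \<le> real (card Z) * P\<^sub>0"
  proof -
    have int: "integrable (measure_pmf R) (indicator (A z) :: _ \<Rightarrow> real)" for R z
      by (rule integrable_bounded_pmf[where c = 1]) (simp add: indicator_def)
    have "(\<Sum>z\<in>Z. measure_pmf.prob ?QQ (A z)) = measure_pmf.expectation ?QQ (\<lambda>y. \<Sum>z\<in>Z. indicator (A z) y)"
      using int by (subst Bochner_Integration.integral_sum) auto
    also have "(\<lambda>y. \<Sum>z\<in>Z. indicator (A z) y :: real) = (\<lambda>y. real (card {z \<in> Z. y \<in> A z}))"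
      using Z by (simp add: indicator_def sum.If_cases Int_def)
    also have "measure_pmf.expectation ?QQ \<dots> \<le> measure_pmf.expectation ?QQ (\<lambda>y. real (card Z) * P\<^sub>0)"
    proof (intro integral_mono integrable_bounded_pmf)
      fix y
      show "\<bar>real (card {z \<in> Z. y \<in> A z})\<bar> \<le> real (card Z) * P\<^sub>0" using few by simp
      show "\<bar>real (card Z) * P\<^sub>0\<bar> \<le> \<bar>real (card Z) * P\<^sub>0\<bar>" by simp
    qed (rule few)
    finally show ?thesis by simp
  qed
  have "l * (\<Sum>z\<in>Z. measure_pmf.prob (?PP z) (A z)) \<le> (\<Sum>z\<in>Z. (\<Sum>i<n. measure_pmf.expectation (Q i) (\<lambda>y. (r z i y - 1)\<^sup>2)) +
      (1 + (exp l - 1) * measure_pmf.prob ?QQ (A z)) / M - 1 + ln M)"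
    unfolding sum_distrib_left by (intro sum_mono step)
  also have "\<dots> = (\<Sum>z\<in>Z. \<Sum>i<n. measure_pmf.expectation (Q i) (\<lambda>y. (r z i y - 1)\<^sup>2)) +
      (real (card Z) + (exp l - 1) * (\<Sum>z\<in>Z. measure_pmf.prob ?QQ (A z))) / M - real (card Z) + real (card Z) * ln M"
    by (simp add: sum.distrib sum_subtractf sum_divide_distrib[symmetric] sum_distrib_left[symmetric])
  also have "\<dots> \<le> real (card Z) * (real n * I) +
      (real (card Z) + (exp l - 1) * (real (card Z) * P\<^sub>0)) / M - real (card Z) + real (card Z) * ln M"
    using sum1 sum2 M assms(10) by (intro add_mono diff_mono divide_right_mono mult_left_mono) auto
  also have "real (card Z) + (exp l - 1) * (real (card Z) * P\<^sub>0) = real (card Z) * M"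
    by (simp add: M_def algebra_simps)
  finally show ?thesis using M unfolding M_def[symmetric] by (simp add: algebra_simps)
qed


section \<open>Independent uniform choices in blocks\<close>

definition selections :: "nat \<Rightarrow> nat \<Rightarrow> (nat \<Rightarrow> nat) set" where
  "selections m b = (\<Pi>\<^sub>E j\<in>{..<m}. {..<b})"

lemma card_selections: "card (selections m b) = b ^ m"
  by (simp add: selections_def card_PiE)

lemma finite_selections: "finite (selections m b)"
  by (simp add: selections_def finite_PiE)

lemma selections_nonempty: "0 < b \<Longrightarrow> selections m b \<noteq> {}"
  by (auto simp: selections_def PiE_eq_empty_iff)

lemma selection_less: "z \<in> selections m b \<Longrightarrow> j < m \<Longrightarrow> z j < b"
  by (auto simp: selections_def PiE_iff)

text \<open>Independence of the coordinates of a uniform selection, in counting form. The second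
  moment and both tail bounds below rest on it.\<close>

lemma sum_selections_prod:
  "(\<Sum>z\<in>selections m b. \<Prod>j<m. f j (z j)) = (\<Prod>j<m. \<Sum>i<b. f j i)" for f :: "nat \<Rightarrow> nat \<Rightarrow> real"
  unfolding selections_def by (rule prod_sum_PiE[symmetric]) auto

text \<open>Centred weights in different blocks are uncorrelated, so only the \<open>m\<close>
  diagonal terms of the square survive instead of \<open>m * m\<close>. This saving is the factor
  \<open>1 / m\<close> in the information per message.\<close>

lemma sum_selections_square_le:
  fixes w :: "nat \<Rightarrow> nat \<Rightarrow> real"
  assumes mean: "\<And>j. j < m \<Longrightarrow> (\<Sum>i<b. w j i) = 0"
    and bound: "\<And>j i. j < m \<Longrightarrow> i < b \<Longrightarrow> \<bar>w j i\<bar> \<le> c"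
  shows "(\<Sum>z\<in>selections m b. (\<Sum>j<m. w j (z j))\<^sup>2) \<le> real (card (selections m b)) * (real m * c\<^sup>2)"
proof -
  have cross: "(\<Sum>z\<in>selections m b. w j (z j) * w j' (z j')) = 0" if j: "j < m" "j' < m" "j \<noteq> j'" for j j'
  proof -
    define f where "f l i = (if l = j then w j i else 1) * (if l = j' then w j' i else 1)" for l i
    have "(\<Prod>l<m. f l (z l)) = w j (z j) * w j' (z j')" for z
      using j by (simp add: f_def prod.distrib prod.delta)
    then have "(\<Sum>z\<in>selections m b. w j (z j) * w j' (z j')) = (\<Prod>l<m. \<Sum>i<b. f l i)"
      using sum_selections_prod[of f m b] by simp
    also have "\<dots> = 0"
    proof (rule prod_zero)
      have "(\<Sum>i<b. f j i) = 0" using mean[OF j(1)] j(3) by (simp add: f_def)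
      then show "\<exists>l\<in>{..<m}. (\<Sum>i<b. f l i) = 0" using j by auto
    qed simp
    finally show ?thesis .
  qed
  have "(\<Sum>z\<in>selections m b. (\<Sum>j<m. w j (z j))\<^sup>2) =
      (\<Sum>z\<in>selections m b. \<Sum>j<m. \<Sum>j'<m. w j (z j) * w j' (z j'))"
    by (simp add: power2_eq_square sum_product)
  also have "\<dots> = (\<Sum>j<m. \<Sum>j'<m. \<Sum>z\<in>selections m b. w j (z j) * w j' (z j'))"
    by (subst sum.swap, rule sum.cong[OF refl], rule sum.swap)
  also have "\<dots> = (\<Sum>j<m. \<Sum>j'<m. if j' = j then (\<Sum>z\<in>selections m b. (w j (z j))\<^sup>2) else 0)"
    using cross by (intro sum.cong refl) (auto simp: power2_eq_square)
  also have "\<dots> = (\<Sum>j<m. \<Sum>z\<in>selections m b. (w j (z j))\<^sup>2)" by simp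
  also have "\<dots> \<le> (\<Sum>j<m. \<Sum>z\<in>selections m b. c\<^sup>2)"
  proof (intro sum_mono)
    fix j z assume "j \<in> {..<m}" "z \<in> selections m b"
    then have "\<bar>w j (z j)\<bar> \<le> c" using bound selection_less by simp
    then have "\<bar>w j (z j)\<bar>\<^sup>2 \<le> c\<^sup>2" by (intro power_mono) auto
    then show "(w j (z j))\<^sup>2 \<le> c\<^sup>2" by simp
  qed
  finally show ?thesis by (simp add: mult_ac)
qed

lemma exp_le_chord:
  fixes t x :: real
  assumes "0 \<le> x" "x \<le> 1"
  shows "exp (t * x) \<le> 1 + (exp t - 1) * x"
proof -
  have "exp ((1 - x) *\<^sub>R 0 + x *\<^sub>R t) \<le> (1 - x) * exp 0 + x * exp t"
    using convex_onD[OF exp_convex, of x 0 t] assms by simp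
  then show ?thesis by (simp add: algebra_simps)
qed

lemma card_selections_tail_markov:
  fixes g :: "nat \<Rightarrow> nat \<Rightarrow> real"
  assumes g: "\<And>j i. j < m \<Longrightarrow> i < b \<Longrightarrow> 0 \<le> g j i"
    and mass: "(\<Sum>j<m. \<Sum>i<b. g j i) \<le> real b * (real m * \<mu>)" and "0 < b" "0 < m" "0 < \<theta>"
  shows "real (card {z \<in> selections m b. real m * \<theta> \<le> (\<Sum>j<m. g j (z j))}) \<le>
    real (card (selections m b)) * (\<mu> / \<theta>)" (is "real (card ?T) \<le> _")
proof -
  have one: "(\<Sum>z\<in>selections m b. g j (z j)) = real (card (selections m b)) * ((\<Sum>i<b. g j i) / real b)"
    if j: "j < m" for j
  proof -
    define f where "f l i = (if l = j then g j i else 1)" for l i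
    have "(\<Prod>l<m. f l (z l)) = g j (z j)" for z using j by (simp add: f_def prod.delta)
    then have "(\<Sum>z\<in>selections m b. g j (z j)) = (\<Prod>l<m. \<Sum>i<b. f l i)"
      using sum_selections_prod[of f m b] by simp
    also have "\<dots> = (\<Sum>i<b. f j i) * (\<Prod>l\<in>{..<m} - {j}. \<Sum>i<b. f l i)"
      using j by (intro prod.remove) auto
    also have "(\<Prod>l\<in>{..<m} - {j}. \<Sum>i<b. f l i) = (\<Prod>l\<in>{..<m} - {j}. real b)"
      by (intro prod.cong refl) (simp add: f_def)
    also have "\<dots> = real b ^ (m - 1)" using j by simp
    also have "(\<Sum>i<b. f j i) = (\<Sum>i<b. g j i)" by (simp add: f_def)
    finally have "(\<Sum>z\<in>selections m b. g j (z j)) = (\<Sum>i<b. g j i) * real b ^ (m - 1)" .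
    moreover have "real b ^ m = real b ^ (m - 1) * real b" using j by (simp add: power_eq_if)
    ultimately show ?thesis using assms(3) by (simp add: card_selections)
  qed
  have "real (card ?T) * (real m * \<theta>) = (\<Sum>z\<in>?T. real m * \<theta>)"
    by (simp only: sum_constant)
  also have "\<dots> \<le> (\<Sum>z\<in>?T. \<Sum>j<m. g j (z j))" by (rule sum_mono) blast
  also have "\<dots> \<le> (\<Sum>z\<in>selections m b. \<Sum>j<m. g j (z j))"
  proof (rule sum_mono2[OF finite_selections])
    fix z assume "z \<in> selections m b - ?T"
    then show "0 \<le> (\<Sum>j<m. g j (z j))" by (intro sum_nonneg g) (auto simp: selection_less)
  qed blast
  also have "\<dots> = (\<Sum>j<m. \<Sum>z\<in>selections m b. g j (z j))" by (rule sum.swap)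
  also have "\<dots> = real (card (selections m b)) * ((\<Sum>j<m. \<Sum>i<b. g j i) / real b)"
    by (simp add: one sum_divide_distrib sum_distrib_left)
  also have "\<dots> \<le> real (card (selections m b)) * (real m * \<mu>)"
    using mass assms(3) by (intro mult_left_mono) (auto simp: field_simps)
  finally have "real (card ?T) \<le> real (card (selections m b)) * (real m * \<mu>) / (real m * \<theta>)"
    using assms(4,5) by (simp only: pos_le_divide_eq mult_pos_pos of_nat_0_less_iff)
  then show ?thesis using assms(4) by simp
qed

text \<open>Exponential moments with the parameter \<open>ln (\<theta> / \<mu>)\<close>, which is
  optimal for a Poisson variable of mean \<open>m * \<mu>\<close>. Bounding each block by
  \<open>1 + x \<le> exp x\<close> makes the product depend on the total mass only, so the blocks
  may carry unequal masses.\<close>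

lemma card_selections_tail_chernoff:
  fixes g :: "nat \<Rightarrow> nat \<Rightarrow> real"
  assumes g: "\<And>j i. j < m \<Longrightarrow> i < b \<Longrightarrow> 0 \<le> g j i" "\<And>j i. j < m \<Longrightarrow> i < b \<Longrightarrow> g j i \<le> 1"
    and mass: "(\<Sum>j<m. \<Sum>i<b. g j i) \<le> real b * (real m * \<mu>)" and "0 < b" "0 < \<mu>" "\<mu> \<le> \<theta>"
  shows "real (card {z \<in> selections m b. real m * \<theta> \<le> (\<Sum>j<m. g j (z j))}) \<le>
    real (card (selections m b)) * exp (- (real m * (\<theta> * ln (\<theta> / \<mu>) - \<theta> + \<mu>)))" (is "real (card ?T) \<le> _")
proof -
  define t where "t = ln (\<theta> / \<mu>)"
  have t: "0 \<le> t" "exp t = \<theta> / \<mu>" using assms(5,6) by (simp_all add: t_def)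
  have "real (card ?T) * exp (t * (real m * \<theta>)) = (\<Sum>z\<in>?T. exp (t * (real m * \<theta>)))" by simp
  also have "\<dots> \<le> (\<Sum>z\<in>?T. exp (t * (\<Sum>j<m. g j (z j))))"
    using t by (intro sum_mono) (auto intro: mult_left_mono)
  also have "\<dots> \<le> (\<Sum>z\<in>selections m b. exp (t * (\<Sum>j<m. g j (z j))))"
    by (intro sum_mono2 finite_selections) auto
  also have "\<dots> = (\<Sum>z\<in>selections m b. \<Prod>j<m. exp (t * g j (z j)))"
    by (simp add: exp_sum[symmetric] sum_distrib_left)
  also have "\<dots> = (\<Prod>j<m. \<Sum>i<b. exp (t * g j i))"
    using sum_selections_prod[of "\<lambda>j i. exp (t * g j i)" m b] by simp
  also have "\<dots> \<le> (\<Prod>j<m. real b * exp ((exp t - 1) * ((\<Sum>i<b. g j i) / real b)))"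
  proof (intro prod_mono conjI)
    fix j assume j: "j \<in> {..<m}"
    have "(\<Sum>i<b. exp (t * g j i)) \<le> (\<Sum>i<b. 1 + (exp t - 1) * g j i)"
      using g j by (intro sum_mono exp_le_chord) auto
    also have "\<dots> = real b * (1 + (exp t - 1) * ((\<Sum>i<b. g j i) / real b))"
      using assms(4) by (simp only: sum.distrib sum_distrib_left[symmetric]) (simp add: field_simps)
    also have "\<dots> \<le> real b * exp ((exp t - 1) * ((\<Sum>i<b. g j i) / real b))"
      by (intro mult_left_mono exp_ge_add_one_self) auto
    finally show "(\<Sum>i<b. exp (t * g j i)) \<le> real b * exp ((exp t - 1) * ((\<Sum>i<b. g j i) / real b))" .
  qed (simp add: sum_nonneg)
  also have "\<dots> = real b ^ m * exp ((exp t - 1) * ((\<Sum>j<m. \<Sum>i<b. g j i) / real b))"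
    by (simp add: prod.distrib exp_sum[symmetric] sum_distrib_left sum_divide_distrib)
  also have "\<dots> \<le> real b ^ m * exp ((exp t - 1) * (real m * \<mu>))"
  proof -
    have "(\<Sum>j<m. \<Sum>i<b. g j i) / real b \<le> real m * \<mu>"
      using mass assms(4) by (simp add: pos_divide_le_eq mult.commute)
    then have "(exp t - 1) * ((\<Sum>j<m. \<Sum>i<b. g j i) / real b) \<le> (exp t - 1) * (real m * \<mu>)"
      using t(1) by (intro mult_left_mono) auto
    then show ?thesis by (simp add: mult_left_mono)
  qed
  also have "(exp t - 1) * (real m * \<mu>) = real m * (\<theta> - \<mu>)"
    using assms(5) by (simp add: t field_simps)
  finally have "real (card ?T) * exp (t * (real m * \<theta>)) \<le> real (card (selections m b)) * exp (real m * (\<theta> - \<mu>))"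
    by (simp add: card_selections)
  then have "real (card ?T) \<le> real (card (selections m b)) * exp (real m * (\<theta> - \<mu>)) / exp (t * (real m * \<theta>))"
    by (simp add: field_simps)
  also have "\<dots> = real (card (selections m b)) * exp (real m * (\<theta> - \<mu>) - t * (real m * \<theta>))"
    by (simp add: exp_diff)
  also have "real m * (\<theta> - \<mu>) - t * (real m * \<theta>) = - (real m * (\<theta> * ln (\<theta> / \<mu>) - \<theta> + \<mu>))"
    by (simp add: t_def algebra_simps)
  finally show ?thesis .
qed


section \<open>The hard distributions\<close>

text \<open>Block \<open>j < m\<close> consists of the points \<open>block_point b j i\<close>, \<open>i < b\<close>; the mass \<open>1 - \<beta>\<close> is parked
  at \<open>k\<close>.\<close>

definition block_point :: "nat \<Rightarrow> nat \<Rightarrow> nat \<Rightarrow> nat" where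
  "block_point b j i = j * b + i + 1"

definition hard :: "nat \<Rightarrow> nat \<Rightarrow> nat \<Rightarrow> real \<Rightarrow> (nat \<Rightarrow> nat) \<Rightarrow> nat pmf" where
  "hard k m b \<beta> z = bind_pmf (bernoulli_pmf \<beta>) (\<lambda>c. if c
     then map_pmf (\<lambda>j. block_point b j (z j)) (pmf_of_set {..<m}) else return_pmf k)"

text \<open>The average of the laws \<open>hard k m b \<beta> z\<close> over all selections
  \<open>z\<close>: the reference law that knows nothing of the selection.\<close>

definition hard_center :: "nat \<Rightarrow> nat \<Rightarrow> nat \<Rightarrow> real \<Rightarrow> nat pmf" where
  "hard_center k m b \<beta> = bind_pmf (bernoulli_pmf \<beta>) (\<lambda>c. if c
     then map_pmf (\<lambda>(j, i). block_point b j i) (pmf_of_set ({..<m} \<times> {..<b})) else return_pmf k)"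

lemma block_point_range:
  assumes "j < m" "i < b"
  shows "block_point b j i \<in> {1..m * b}"
proof -
  have "Suc j * b \<le> m * b" using assms(1) by (intro mult_right_mono) auto
  then show ?thesis using assms(2) by (simp add: block_point_def)
qed

lemma inj_on_block_point: "inj_on (\<lambda>(j, i). block_point b j i) ({..<m} \<times> {..<b})"
proof (rule inj_onI, clarsimp)
  fix j i j' i' assume "i < b" "i' < b" "block_point b j i = block_point b j' i'"
  then have eq: "j * b + i = j' * b + i'" and i: "i < b" "i' < b" by (simp_all add: block_point_def)
  have "j = (j * b + i) div b" "j' = (j' * b + i') div b" using i by simp_all
  then have "j = j'" using eq by simp
  then show "j = j' \<and> i = i'" using eq by simp
qed

lemma pmf_bind_hard:
  assumes "0 < m" "0 \<le> \<beta>" "\<beta> \<le> 1"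
  shows "pmf (bind_pmf (hard k m b \<beta> z) W) y =
    (1 - \<beta>) * pmf (W k) y + \<beta> / real m * (\<Sum>j<m. pmf (W (block_point b j (z j))) y)"
proof -
  have ne: "{..<m} \<noteq> {}" using assms(1) by auto
  have "bind_pmf (hard k m b \<beta> z) W = bind_pmf (bernoulli_pmf \<beta>) (\<lambda>c. if c
     then bind_pmf (pmf_of_set {..<m}) (\<lambda>j. W (block_point b j (z j))) else W k)"
    unfolding hard_def bind_assoc_pmf
    by (intro bind_pmf_cong refl) (simp add: bind_map_pmf bind_return_pmf)
  also have "pmf \<dots> y = \<beta> * pmf (bind_pmf (pmf_of_set {..<m}) (\<lambda>j. W (block_point b j (z j)))) y
      + (1 - \<beta>) * pmf (W k) y"
    using assms(2,3) by (simp add: pmf_bind[of "bernoulli_pmf \<beta>"])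
  also have "pmf (bind_pmf (pmf_of_set {..<m}) (\<lambda>j. W (block_point b j (z j)))) y =
      (\<Sum>j<m. pmf (W (block_point b j (z j))) y) / real m"
    unfolding pmf_bind by (subst integral_pmf_of_set[OF ne]) auto
  finally show ?thesis by simp
qed

lemma pmf_bind_hard_center:
  assumes "0 < m" "0 < b" "0 \<le> \<beta>" "\<beta> \<le> 1"
  shows "pmf (bind_pmf (hard_center k m b \<beta>) W) y =
    (1 - \<beta>) * pmf (W k) y + \<beta> / real m * (\<Sum>j<m. (\<Sum>i<b. pmf (W (block_point b j i)) y) / real b)"
proof -
  let ?A = "{..<m} \<times> {..<b}"
  have ne: "?A \<noteq> {}" "finite ?A" using assms(1,2) by auto
  have "bind_pmf (hard_center k m b \<beta>) W = bind_pmf (bernoulli_pmf \<beta>) (\<lambda>c. if c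
     then bind_pmf (pmf_of_set ?A) (\<lambda>x. W (block_point b (fst x) (snd x))) else W k)"
    unfolding hard_center_def bind_assoc_pmf
    by (intro bind_pmf_cong refl) (simp add: bind_map_pmf bind_return_pmf case_prod_unfold)
  also have "pmf \<dots> y = \<beta> * pmf (bind_pmf (pmf_of_set ?A) (\<lambda>x. W (block_point b (fst x) (snd x)))) y
      + (1 - \<beta>) * pmf (W k) y"
    using assms(3,4) by (simp add: pmf_bind[of "bernoulli_pmf \<beta>"])
  also have "pmf (bind_pmf (pmf_of_set ?A) (\<lambda>x. W (block_point b (fst x) (snd x)))) y =
      (\<Sum>x\<in>?A. pmf (W (block_point b (fst x) (snd x))) y) / real (m * b)"
    unfolding pmf_bind by (subst integral_pmf_of_set[OF ne]) auto
  also have "(\<Sum>x\<in>?A. pmf (W (block_point b (fst x) (snd x))) y) =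
      (\<Sum>j<m. \<Sum>i<b. pmf (W (block_point b j i)) y)"
    by (simp add: sum.cartesian_product case_prod_unfold)
  finally show ?thesis by (simp add: sum_divide_distrib[symmetric])
qed

lemma pmf_hard:
  assumes "0 < m" "0 \<le> \<beta>" "\<beta> \<le> 1"
  shows "pmf (hard k m b \<beta> z) x =
    (1 - \<beta>) * of_bool (x = k) + \<beta> / real m * (\<Sum>j<m. of_bool (x = block_point b j (z j)))"
  using pmf_bind_hard[OF assms, of k b z return_pmf x]
  by (simp add: bind_return_pmf' pmf_return of_bool_def indicator_def eq_commute)

text \<open>For \<beta> = 1 nothing is parked at \<open>k\<close>. The point thus saved lets
  \<open>s\<close> blocks be used with sparsity \<open>s\<close>, in particular for
  \<open>s = 1\<close>.\<close>

lemma set_pmf_hard: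
  assumes "0 < m"
  shows "set_pmf (hard k m b \<beta> z) \<subseteq> insert k ((\<lambda>j. block_point b j (z j)) ` {..<m})"
    and "set_pmf (hard k m b 1 z) \<subseteq> (\<lambda>j. block_point b j (z j)) ` {..<m}"
proof -
  have ne: "{..<m} \<noteq> {}" using assms by auto
  show "set_pmf (hard k m b \<beta> z) \<subseteq> insert k ((\<lambda>j. block_point b j (z j)) ` {..<m})"
    unfolding hard_def using set_pmf_of_set[OF ne] by (auto split: if_splits)
  show "set_pmf (hard k m b 1 z) \<subseteq> (\<lambda>j. block_point b j (z j)) ` {..<m}"
  proof -
    have "False \<notin> set_pmf (bernoulli_pmf 1)" by (simp add: set_pmf_iff)
    then show ?thesis unfolding hard_def using set_pmf_of_set[OF ne] by (auto split: if_splits)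
  qed
qed

lemma hard_sparse:
  assumes "0 < m" "m * b \<le> k" "1 \<le> k" "z \<in> selections m b"
    and "(\<beta> = 1 \<and> m \<le> s) \<or> m + 1 \<le> s"
  shows "hard k m b \<beta> z \<in> sparse_simplex k s"
proof -
  let ?B = "(\<lambda>j. block_point b j (z j)) ` {..<m}"
  have B: "?B \<subseteq> {1..k}"
    using block_point_range[of _ m "z _" b] selection_less[OF assms(4)] assms(2) by fastforce
  have card: "card ?B \<le> m" "finite ?B" using card_image_le[of "{..<m}"] by (simp_all, force)
  have sub: "set_pmf (hard k m b \<beta> z) \<subseteq> {1..k}"
    using B assms(3) by (intro order.trans[OF set_pmf_hard(1)[OF assms(1)]]) simp
  moreover have "card (set_pmf (hard k m b \<beta> z)) \<le> s"
  proof (cases "\<beta> = 1 \<and> m \<le> s")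
    case True
    then have "card (set_pmf (hard k m b \<beta> z)) \<le> card ?B"
      using set_pmf_hard(2)[OF assms(1), of k b z] card by (intro card_mono) auto
    then show ?thesis using card True by simp
  next
    case False
    have "card (set_pmf (hard k m b \<beta> z)) \<le> card (insert k ?B)"
      using set_pmf_hard(1)[OF assms(1), of k b \<beta> z] card by (intro card_mono) auto
    also have "\<dots> \<le> m + 1" using card card_insert_le_m1[of "m + 1" ?B k] by simp
    finally show ?thesis using assms(5) False by auto
  qed
  ultimately show ?thesis by (simp add: sparse_simplex_def prob_simplex_def)
qed


section \<open>Contraction of information under local privacy\<close>

text \<open>Privacy puts both message laws within a factor \<open>exp \<epsilon>\<close> of the law
  of the message for the symbol \<open>k\<close>, hence within \<open>exp (2 * \<epsilon>)\<close>
  of each other. Moreover, \<open>r - 1\<close> is \<open>\<beta> / m\<close> times a sum of one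
  term per block, each centred within its block and of size \<open>O(\<epsilon>)\<close> for bounded
  \<epsilon>, so its mean square over \<open>z\<close> is of order
  \<open>\<beta>\<^sup>2 * \<epsilon>\<^sup>2 / m\<close>.\<close>

lemma ldp_likelihood_ratio:
  fixes k m b :: nat and \<beta> \<epsilon> :: real
  assumes W: "W \<in> ldp_channels k \<epsilon>" and \<epsilon>: "0 < \<epsilon>" and m: "0 < m" "0 < b" "m * b \<le> k" "1 \<le> k"
    and \<beta>: "0 < \<beta>" "\<beta> \<le> 1"
  defines "P \<equiv> \<lambda>z. bind_pmf (hard k m b \<beta> z) W" and "Q \<equiv> bind_pmf (hard_center k m b \<beta>) W"
  shows "\<exists>r. (\<forall>z\<in>selections m b. \<forall>y. pmf (P z) y = pmf Q y * r z y \<and> exp (- 2 * \<epsilon>) \<le> r z y \<and> r z y \<le> exp (2 * \<epsilon>)) \<and>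
     (\<forall>y. (\<Sum>z\<in>selections m b. (r z y - 1)\<^sup>2) \<le>
        real (card (selections m b)) * (\<beta>\<^sup>2 * (exp (2 * \<epsilon>) * (exp \<epsilon> - 1))\<^sup>2 / real m))"
proof -
  define a where "a y j i = pmf (W (block_point b j i)) y" for y j i
  define w where "w y = pmf (W k) y" for y
  \<comment> \<open>A message of probability zero under the centre has probability zero for every
    \<open>z\<close>, so any positive default would do; 1 makes it contribute nothing to the
    variance.\<close>
  define r where "r z y = (if pmf Q y = 0 then 1 else pmf (P z) y / pmf Q y)" for z y
  have w0: "0 \<le> w y" for y by (simp add: w_def)
  have ldp: "pmf (W x) y \<le> exp \<epsilon> * pmf (W x') y" if "x \<in> {1..k}" "x' \<in> {1..k}" for x x' y
    using W that by (simp add: ldp_channels_def)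
  have pt: "block_point b j i \<in> {1..k}" if "j < m" "i < b" for j i
    using block_point_range[OF that] m(3) by auto
  have kk: "k \<in> {1..k}" using m(4) by simp
  have au: "a y j i \<le> exp \<epsilon> * w y" and al: "exp (- \<epsilon>) * w y \<le> a y j i" if "j < m" "i < b" for y j i
    using ldp[OF pt[OF that] kk, of y] ldp[OF kk pt[OF that], of y]
    by (simp_all add: a_def w_def exp_minus field_simps)
  have wu: "w y \<le> exp \<epsilon> * w y" and wl: "exp (- \<epsilon>) * w y \<le> w y" for y
    using w0[of y] \<epsilon> by (simp_all add: mult_le_cancel_right1 mult_left_le_one_le)
  have Pz: "pmf (P z) y = (1 - \<beta>) * w y + \<beta> / real m * (\<Sum>j<m. a y j (z j))" for z y
    unfolding P_def a_def w_def using m(1) \<beta> by (intro pmf_bind_hard) auto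
  have Qy: "pmf Q y = (1 - \<beta>) * w y + \<beta> / real m * (\<Sum>j<m. (\<Sum>i<b. a y j i) / real b)" for y
    unfolding Q_def a_def w_def using m \<beta> by (intro pmf_bind_hard_center) auto
  have mix: "(1 - \<beta>) * w y + \<beta> / real m * (\<Sum>j<m. f j) \<le> exp \<epsilon> * w y \<and>
      exp (- \<epsilon>) * w y \<le> (1 - \<beta>) * w y + \<beta> / real m * (\<Sum>j<m. f j)"
    if f: "\<And>j. j < m \<Longrightarrow> f j \<le> exp \<epsilon> * w y" "\<And>j. j < m \<Longrightarrow> exp (- \<epsilon>) * w y \<le> f j" for f y
  proof
    have "(\<Sum>j<m. f j) \<le> real m * (exp \<epsilon> * w y)" using sum_mono[of "{..<m}" f "\<lambda>_. exp \<epsilon> * w y"] f by simp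
    then have "\<beta> / real m * (\<Sum>j<m. f j) \<le> \<beta> / real m * (real m * (exp \<epsilon> * w y))"
      using \<beta> by (intro mult_left_mono) auto
    moreover have "(1 - \<beta>) * w y \<le> (1 - \<beta>) * (exp \<epsilon> * w y)" using \<beta> wu by (intro mult_left_mono) auto
    ultimately show "(1 - \<beta>) * w y + \<beta> / real m * (\<Sum>j<m. f j) \<le> exp \<epsilon> * w y"
      using m(1) by (simp add: algebra_simps)
    have "real m * (exp (- \<epsilon>) * w y) \<le> (\<Sum>j<m. f j)" using sum_mono[of "{..<m}" "\<lambda>_. exp (- \<epsilon>) * w y" f] f by simp
    then have "\<beta> / real m * (real m * (exp (- \<epsilon>) * w y)) \<le> \<beta> / real m * (\<Sum>j<m. f j)"
      using \<beta> by (intro mult_left_mono) auto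
    moreover have "(1 - \<beta>) * (exp (- \<epsilon>) * w y) \<le> (1 - \<beta>) * w y" using \<beta> wl by (intro mult_left_mono) auto
    ultimately show "exp (- \<epsilon>) * w y \<le> (1 - \<beta>) * w y + \<beta> / real m * (\<Sum>j<m. f j)"
      using m(1) by (simp add: algebra_simps)
  qed
  have Pb: "pmf (P z) y \<le> exp \<epsilon> * w y" "exp (- \<epsilon>) * w y \<le> pmf (P z) y" if "z \<in> selections m b" for z y
    unfolding Pz using mix[of "\<lambda>j. a y j (z j)" y] au al selection_less[OF that] by auto
  have avg: "(\<Sum>i<b. a y j i) / real b \<le> exp \<epsilon> * w y" "exp (- \<epsilon>) * w y \<le> (\<Sum>i<b. a y j i) / real b"
    if "j < m" for j y
    using sum_mono[of "{..<b}" "a y j" "\<lambda>_. exp \<epsilon> * w y"] sum_mono[of "{..<b}" "\<lambda>_. exp (- \<epsilon>) * w y" "a y j"]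
      au al that m(2) by (simp_all add: field_simps)
  have Qb: "pmf Q y \<le> exp \<epsilon> * w y" "exp (- \<epsilon>) * w y \<le> pmf Q y" for y
    unfolding Qy using mix[of "\<lambda>j. (\<Sum>i<b. a y j i) / real b" y] avg by auto
  have Q_w: "w y \<le> exp \<epsilon> * pmf Q y" for y using Qb(2)[of y] by (simp add: exp_minus field_simps)
  have r_bounds: "pmf (P z) y = pmf Q y * r z y \<and> exp (- 2 * \<epsilon>) \<le> r z y \<and> r z y \<le> exp (2 * \<epsilon>)"
    if z: "z \<in> selections m b" for z y
  proof (cases "pmf Q y = 0")
    case True
    then have "w y = 0" using Q_w[of y] w0[of y] by simp
    then have "pmf (P z) y = 0" using Pb(1)[OF z, of y] by simp
    then show ?thesis using True \<epsilon> by (simp add: r_def)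
  next
    case False
    then have q: "0 < pmf Q y" by (simp add: less_le)
    have "pmf (P z) y \<le> exp \<epsilon> * w y" by (rule Pb(1)[OF z])
    also have "\<dots> \<le> exp \<epsilon> * (exp \<epsilon> * pmf Q y)" using Q_w by (intro mult_left_mono) auto
    also have "\<dots> = exp (2 * \<epsilon>) * pmf Q y" by (simp add: exp_add[symmetric] mult.assoc[symmetric])
    finally have u: "pmf (P z) y \<le> exp (2 * \<epsilon>) * pmf Q y" .
    have "exp (- 2 * \<epsilon>) * pmf Q y \<le> exp (- 2 * \<epsilon>) * (exp \<epsilon> * w y)" using Qb(1) by (intro mult_left_mono) auto
    also have "\<dots> = exp (- \<epsilon>) * w y" by (simp add: exp_add[symmetric] mult.assoc[symmetric])
    also have "\<dots> \<le> pmf (P z) y" by (rule Pb(2)[OF z])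
    finally have "exp (- 2 * \<epsilon>) * pmf Q y \<le> pmf (P z) y" .
    then show ?thesis using u q by (simp add: r_def pos_divide_le_eq pos_le_divide_eq)
  qed
  have var: "(\<Sum>z\<in>selections m b. (r z y - 1)\<^sup>2) \<le>
        real (card (selections m b)) * (\<beta>\<^sup>2 * (exp (2 * \<epsilon>) * (exp \<epsilon> - 1))\<^sup>2 / real m)" for y
  proof (cases "pmf Q y = 0")
    case True
    then show ?thesis by (simp add: r_def)
  next
    case False
    then have q: "0 < pmf Q y" by (simp add: less_le)
    define v where "v j i = (a y j i - (\<Sum>i'<b. a y j i') / real b) / pmf Q y" for j i
    have r_v: "r z y - 1 = \<beta> / real m * (\<Sum>j<m. v j (z j))" for z
    proof -
      have "r z y - 1 = (pmf (P z) y - pmf Q y) / pmf Q y" using q by (simp add: r_def diff_divide_distrib)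
      also have "pmf (P z) y - pmf Q y = \<beta> / real m * (\<Sum>j<m. a y j (z j) - (\<Sum>i'<b. a y j i') / real b)"
        unfolding Pz Qy by (simp add: sum_subtractf right_diff_distrib)
      finally show ?thesis by (simp add: v_def sum_divide_distrib[symmetric])
    qed
    have v_mean: "(\<Sum>i<b. v j i) = 0" for j
      unfolding v_def using m(2) by (simp add: sum_divide_distrib[symmetric] sum_subtractf)
    \<comment> \<open>Privacy compares two entries of a block directly. Averaging over the second
      one compares an entry with the mean of its block.\<close>
    have v_bound: "\<bar>v j i\<bar> \<le> exp (2 * \<epsilon>) * (exp \<epsilon> - 1)" if j: "j < m" and i: "i < b" for j i
    proof -
      have e: "exp \<epsilon> - 1 \<ge> 0" using \<epsilon> by simp
      have d: "a y j i - a y j i' \<le> exp (2 * \<epsilon>) * (exp \<epsilon> - 1) * pmf Q y" if "i < b" "i' < b" for i i'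
      proof -
        have "a y j i \<le> exp \<epsilon> * a y j i'" using ldp[OF pt pt] j that by (simp add: a_def)
        then have "a y j i - a y j i' \<le> (exp \<epsilon> - 1) * a y j i'" by (simp add: algebra_simps)
        also have "\<dots> \<le> (exp \<epsilon> - 1) * (exp \<epsilon> * (exp \<epsilon> * pmf Q y))"
        proof (intro mult_left_mono e)
          have "a y j i' \<le> exp \<epsilon> * w y" using au j that by simp
          also have "\<dots> \<le> exp \<epsilon> * (exp \<epsilon> * pmf Q y)" using Q_w by (intro mult_left_mono) auto
          finally show "a y j i' \<le> exp \<epsilon> * (exp \<epsilon> * pmf Q y)" .
        qed
        also have "\<dots> = exp (2 * \<epsilon>) * (exp \<epsilon> - 1) * pmf Q y"
          using exp_add[of \<epsilon> \<epsilon>] by (simp add: mult_ac)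
        finally show ?thesis .
      qed
      define B where "B = exp (2 * \<epsilon>) * (exp \<epsilon> - 1) * pmf Q y"
      have "(\<Sum>i'<b. a y j i - a y j i') \<le> (\<Sum>i'<b. B)" "(\<Sum>i'<b. a y j i' - a y j i) \<le> (\<Sum>i'<b. B)"
        using d i unfolding B_def by (intro sum_mono; simp)+
      then have "real b * a y j i - (\<Sum>i'<b. a y j i') \<le> real b * B"
        "(\<Sum>i'<b. a y j i') - real b * a y j i \<le> real b * B" by (simp_all add: sum_subtractf)
      then have "\<bar>real b * (a y j i - (\<Sum>i'<b. a y j i') / real b)\<bar> \<le> real b * B"
        using m(2) by (simp add: right_diff_distrib abs_le_iff)
      then have "\<bar>a y j i - (\<Sum>i'<b. a y j i') / real b\<bar> \<le> B" using m(2) by (simp add: abs_mult)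
      then show ?thesis using q by (simp add: v_def B_def pos_divide_le_eq)
    qed
    have "(\<Sum>z\<in>selections m b. (r z y - 1)\<^sup>2) = (\<beta> / real m)\<^sup>2 * (\<Sum>z\<in>selections m b. (\<Sum>j<m. v j (z j))\<^sup>2)"
      unfolding r_v power_mult_distrib sum_distrib_left[symmetric] by (rule refl)
    also have "\<dots> \<le> (\<beta> / real m)\<^sup>2 * (real (card (selections m b)) * (real m * (exp (2 * \<epsilon>) * (exp \<epsilon> - 1))\<^sup>2))"
      by (intro mult_left_mono sum_selections_square_le v_mean v_bound) auto
    also have "\<dots> = real (card (selections m b)) * (\<beta>\<^sup>2 * (exp (2 * \<epsilon>) * (exp \<epsilon> - 1))\<^sup>2 / real m)"
      using m(1) by (simp add: power2_eq_square)
    finally show ?thesis .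
  qed
  show ?thesis using r_bounds var by blast
qed


section \<open>Few hard distributions are close to a given estimate\<close>

lemma tv_dist_overlap:
  assumes "p \<in> prob_simplex k" "q \<in> prob_simplex k"
  shows "(\<Sum>x=1..k. min (pmf p x) (pmf q x)) = 1 - tv_dist k p q"
proof -
  have s: "(\<Sum>x=1..k. pmf r x) = 1" if "r \<in> prob_simplex k" for r
    using that by (intro sum_pmf_eq_1) (auto simp: prob_simplex_def)
  have "(\<Sum>x=1..k. min (pmf p x) (pmf q x)) = (\<Sum>x=1..k. (pmf p x + pmf q x - \<bar>pmf p x - pmf q x\<bar>) / 2)"
    by (intro sum.cong refl) (simp add: min_def abs_if)
  also have "\<dots> = (1 + 1 - (\<Sum>x=1..k. \<bar>pmf p x - pmf q x\<bar>)) / 2"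
    using s[OF assms(1)] s[OF assms(2)] by (simp only: sum_divide_distrib[symmetric] sum_subtractf sum.distrib)
  finally show ?thesis by (simp add: tv_dist_def diff_divide_distrib)
qed

lemma min_sum_le:
  fixes f :: "'a \<Rightarrow> real"
  assumes "finite A" "0 \<le> a" "0 \<le> q" "\<And>j. j \<in> A \<Longrightarrow> 0 \<le> f j"
  shows "min (a + (\<Sum>j\<in>A. f j)) q \<le> a + (\<Sum>j\<in>A. min (f j) q)"
  using assms(1,4)
proof (induction A rule: finite_induct)
  case empty
  then show ?case using assms by simp
next
  case (insert j A)
  then have IH: "min (a + (\<Sum>j\<in>A. f j)) q \<le> a + (\<Sum>j\<in>A. min (f j) q)" and "0 \<le> f j" by auto
  moreover have "0 \<le> (\<Sum>j\<in>A. f j)" using insert.prems by (intro sum_nonneg) auto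
  ultimately have "min (f j + (a + (\<Sum>j\<in>A. f j))) q \<le> min (f j) q + (a + (\<Sum>j\<in>A. min (f j) q))"
    using assms(2,3) by (auto simp: min_def split: if_splits)
  then show ?case using insert.hyps by (simp add: add.left_commute)
qed

text \<open>Distance \<alpha> means an overlap of at least \<open>1 - \<alpha>\<close>. The parked
  mass accounts for at most \<open>1 - \<beta>\<close> of it, so the chosen points must supply
  \<open>\<beta> - \<alpha>\<close> out of their \<beta>. Rescaled by \<open>m / \<beta>\<close>,
  the summands lie between 0 and 1, as Chernoff's bound requires.\<close>

lemma hard_overlap:
  assumes m: "0 < m" "m * b \<le> k" "1 \<le> k" and \<beta>: "0 < \<beta>" "\<beta> \<le> 1" and z: "z \<in> selections m b"
    and q: "q \<in> prob_simplex k" and tv: "tv_dist k (hard k m b \<beta> z) q \<le> \<alpha>"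
  shows "real m * (1 - \<alpha> / \<beta>) \<le> (\<Sum>j<m. min 1 (real m * pmf q (block_point b j (z j)) / \<beta>))"
proof -
  let ?x = "\<lambda>j. block_point b j (z j)"
  have hs: "hard k m b \<beta> z \<in> prob_simplex k"
    using hard_sparse[OF m z, of \<beta> "m + 1"] by (simp add: sparse_simplex_def)
  have c: "0 \<le> \<beta> / real m" using \<beta> by simp
  have xk: "?x j \<in> {1..k}" if "j < m" for j
    using block_point_range[OF that selection_less[OF z that]] m(2) by auto
  have "1 - \<alpha> \<le> (\<Sum>x=1..k. min (pmf (hard k m b \<beta> z) x) (pmf q x))"
    unfolding tv_dist_overlap[OF hs q] using tv by simp
  also have "\<dots> \<le> (\<Sum>x=1..k. (1 - \<beta>) * of_bool (x = k) + (\<Sum>j<m. min (\<beta> / real m * of_bool (x = ?x j)) (pmf q x)))"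
  proof (rule sum_mono)
    fix x
    show "min (pmf (hard k m b \<beta> z) x) (pmf q x) \<le>
      (1 - \<beta>) * of_bool (x = k) + (\<Sum>j<m. min (\<beta> / real m * of_bool (x = ?x j)) (pmf q x))"
      unfolding pmf_hard[OF m(1) less_imp_le[OF \<beta>(1)] \<beta>(2)] sum_distrib_left
      using \<beta> c by (intro min_sum_le) auto
  qed
  also have "\<dots> = (1 - \<beta>) + (\<Sum>j<m. \<Sum>x=1..k. min (\<beta> / real m * of_bool (x = ?x j)) (pmf q x))"
  proof -
    have "(\<Sum>x=1..k. (1 - \<beta>) * of_bool (x = k)) = 1 - \<beta>"
      using m(3) by (simp add: of_bool_def if_distrib[of "\<lambda>v. _ * v"] cong: if_cong)
    then show ?thesis by (simp only: sum.distrib) (simp, rule sum.swap)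
  qed
  also have "(\<Sum>j<m. \<Sum>x=1..k. min (\<beta> / real m * of_bool (x = ?x j)) (pmf q x)) =
      (\<Sum>j<m. min (\<beta> / real m) (pmf q (?x j)))"
  proof (rule sum.cong[OF refl])
    fix j assume j: "j \<in> {..<m}"
    have "(\<Sum>x=1..k. min (\<beta> / real m * of_bool (x = ?x j)) (pmf q x)) =
        (\<Sum>x=1..k. if x = ?x j then min (\<beta> / real m) (pmf q (?x j)) else 0)"
      by (intro sum.cong refl) auto
    then show "(\<Sum>x=1..k. min (\<beta> / real m * of_bool (x = ?x j)) (pmf q x)) = min (\<beta> / real m) (pmf q (?x j))"
      using xk[of j] j by simp
  qed
  finally have "\<beta> - \<alpha> \<le> (\<Sum>j<m. min (\<beta> / real m) (pmf q (?x j)))" by simp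
  then have "real m / \<beta> * (\<beta> - \<alpha>) \<le> real m / \<beta> * (\<Sum>j<m. min (\<beta> / real m) (pmf q (?x j)))"
    using \<beta> by (intro mult_left_mono) auto
  also have "\<dots> = (\<Sum>j<m. min 1 (real m * pmf q (?x j) / \<beta>))"
    unfolding sum_distrib_left using \<beta> m(1)
    by (intro sum.cong refl) (simp add: min_def field_simps)
  also have "real m / \<beta> * (\<beta> - \<alpha>) = real m * (1 - \<alpha> / \<beta>)" using \<beta> by (simp add: field_simps)
  finally show ?thesis .
qed

text \<open>All of the hard mass outside \<open>k\<close> is \<beta>, so an estimate with overlap
  \<open>1 - \<alpha>\<close> must meet most of the parked mass. This leaves at most
  \<open>\<beta> + \<alpha>\<close> for the blocks; the trivial bound 1 would be far too large for
  small \<beta>.\<close>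

lemma hard_outside_mass:
  assumes m: "0 < m" "m * b < k" and \<beta>: "0 < \<beta>" "\<beta> \<le> 1" and z: "z \<in> selections m b"
    and q: "q \<in> prob_simplex k" and tv: "tv_dist k (hard k m b \<beta> z) q \<le> \<alpha>"
  shows "1 - \<beta> - \<alpha> \<le> pmf q k"
proof -
  have k: "m * b \<le> k" "1 \<le> k" using m by auto
  let ?p = "hard k m b \<beta> z"
  have hs: "?p \<in> prob_simplex k"
    using hard_sparse[OF m(1) k z, of \<beta> "m + 1"] by (simp add: sparse_simplex_def)
  have s: "(\<Sum>x=1..k. pmf ?p x) = 1"
    using hs by (intro sum_pmf_eq_1) (auto simp: prob_simplex_def)
  have "block_point b j (z j) \<noteq> k" if "j < m" for j
    using block_point_range[OF that selection_less[OF z that]] m(2) by auto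
  then have "pmf ?p k = 1 - \<beta>"
    unfolding pmf_hard[OF m(1) less_imp_le[OF \<beta>(1)] \<beta>(2)] by (simp add: eq_commute)
  moreover have kk: "k \<in> {1..k}" using k by simp
  ultimately have rest: "(\<Sum>x\<in>{1..k} - {k}. pmf ?p x) = \<beta>"
    using s sum.remove[OF finite_atLeastAtMost kk, of "pmf ?p"] by simp
  have "1 - \<alpha> \<le> (\<Sum>x=1..k. min (pmf ?p x) (pmf q x))"
    unfolding tv_dist_overlap[OF hs q] using tv by simp
  also have "\<dots> = min (pmf ?p k) (pmf q k) + (\<Sum>x\<in>{1..k} - {k}. min (pmf ?p x) (pmf q x))"
    by (rule sum.remove[OF _ kk]) simp
  also have "\<dots> \<le> pmf q k + (\<Sum>x\<in>{1..k} - {k}. pmf ?p x)"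
    by (intro add_mono sum_mono) auto
  finally show ?thesis using rest by simp
qed

lemma block_mass:
  assumes "m * b \<le> k"
  shows "(\<Sum>j<m. \<Sum>i<b. pmf q (block_point b j i)) \<le> 1"
    and "m * b < k \<Longrightarrow> (\<Sum>j<m. \<Sum>i<b. pmf q (block_point b j i)) + pmf q k \<le> 1"
proof -
  let ?B = "(\<lambda>(j, i). block_point b j i) ` ({..<m} \<times> {..<b})"
  have "(\<Sum>j<m. \<Sum>i<b. pmf q (block_point b j i)) = (\<Sum>x\<in>{..<m} \<times> {..<b}. pmf q (case x of (j, i) \<Rightarrow> block_point b j i))"
    by (simp add: sum.cartesian_product case_prod_unfold)
  also have "\<dots> = (\<Sum>x\<in>?B. pmf q x)" by (simp add: sum.reindex[OF inj_on_block_point])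
  finally have eq: "(\<Sum>j<m. \<Sum>i<b. pmf q (block_point b j i)) = (\<Sum>x\<in>?B. pmf q x)" .
  also have "\<dots> = measure_pmf.prob q ?B" by (simp add: measure_measure_pmf_finite)
  finally show "(\<Sum>j<m. \<Sum>i<b. pmf q (block_point b j i)) \<le> 1" by simp
  assume "m * b < k"
  then have "k \<notin> ?B" using block_point_range[of _ m _ b] by fastforce
  then have "(\<Sum>x\<in>?B. pmf q x) + pmf q k = (\<Sum>x\<in>insert k ?B. pmf q x)" by simp
  also have "\<dots> = measure_pmf.prob q (insert k ?B)" by (simp add: measure_measure_pmf_finite)
  finally show "(\<Sum>j<m. \<Sum>i<b. pmf q (block_point b j i)) + pmf q k \<le> 1" unfolding eq by simp
qed

text \<open>The better of Markov's and Chernoff's bounds. Chernoff's exponent grows with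
  \<open>m\<close> and gives the rate; for few blocks or small \<theta> it is too weak to bring the
  fraction down to about one half, and Markov's bound does that.\<close>

definition close_fraction :: "nat \<Rightarrow> real \<Rightarrow> real \<Rightarrow> real" where
  "close_fraction m \<theta> \<mu> = min (\<mu> / \<theta>) (exp (- (real m * (\<theta> * ln (\<theta> / \<mu>) - \<theta> + \<mu>))))"

text \<open>If some hard distribution is close to \<open>q\<close> at all, that single one already
  limits the mass which \<open>q\<close> gives to the blocks, through the parked mass. With this
  limit, the tail bounds count the selections that reach the overlap forced by closeness. The factor
  \<kappa> is the limit divided by \<beta>.\<close>

lemma card_close_selections:
  assumes m: "0 < m" "0 < b" "m * b \<le> k" "1 \<le> k" and \<beta>: "0 < \<beta>" "\<beta> \<le> 1" and q: "q \<in> prob_simplex k"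
    and \<kappa>: "\<beta> = 1 \<and> \<kappa> = 1 \<or> m * b < k \<and> \<kappa> = 1 + \<alpha> / \<beta>"
    and \<mu>: "\<mu> = \<kappa> / real b" "0 < \<mu>" "\<mu> \<le> 1 - \<alpha> / \<beta>"
  shows "real (card {z \<in> selections m b. tv_dist k (hard k m b \<beta> z) q \<le> \<alpha>}) \<le>
    real (card (selections m b)) * close_fraction m (1 - \<alpha> / \<beta>) \<mu>" (is "real (card ?C) \<le> _")
proof (cases "?C = {}")
  case True
  have "0 < 1 - \<alpha> / \<beta>" using \<mu>(2,3) by linarith
  then have "0 \<le> close_fraction m (1 - \<alpha> / \<beta>) \<mu>" using \<mu>(2) by (simp add: close_fraction_def)
  then show ?thesis unfolding True by simp
next
  case False
  then obtain z\<^sub>0 where z\<^sub>0: "z\<^sub>0 \<in> selections m b" "tv_dist k (hard k m b \<beta> z\<^sub>0) q \<le> \<alpha>" by auto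
  define g where "g j i = min 1 (real m * pmf q (block_point b j i) / \<beta>)" for j i
  define T where "T = {z \<in> selections m b. real m * (1 - \<alpha> / \<beta>) \<le> (\<Sum>j<m. g j (z j))}"
  have "?C \<subseteq> T" unfolding T_def g_def using hard_overlap[OF m(1,3,4) \<beta> _ q] by auto
  then have CT: "real (card ?C) \<le> real (card T)"
    using finite_selections by (simp add: T_def card_mono)
  have g: "0 \<le> g j i" "g j i \<le> 1" for j i using \<beta> by (simp_all add: g_def)
  have "(\<Sum>j<m. \<Sum>i<b. g j i) \<le> (\<Sum>j<m. \<Sum>i<b. real m / \<beta> * pmf q (block_point b j i))"
    by (intro sum_mono) (simp add: g_def)
  also have "\<dots> = real m / \<beta> * (\<Sum>j<m. \<Sum>i<b. pmf q (block_point b j i))"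
    by (simp only: sum_distrib_left)
  also have "\<dots> \<le> real m / \<beta> * (\<kappa> * \<beta>)"
  proof (rule mult_left_mono)
    show "(\<Sum>j<m. \<Sum>i<b. pmf q (block_point b j i)) \<le> \<kappa> * \<beta>"
      using \<kappa>
    proof
      assume "\<beta> = 1 \<and> \<kappa> = 1"
      then show ?thesis using block_mass(1)[OF m(3)] by simp
    next
      assume k: "m * b < k \<and> \<kappa> = 1 + \<alpha> / \<beta>"
      then have "1 - \<beta> - \<alpha> \<le> pmf q k" using hard_outside_mass[OF m(1) _ \<beta> z\<^sub>0(1) q z\<^sub>0(2)] by simp
      moreover have "(\<Sum>j<m. \<Sum>i<b. pmf q (block_point b j i)) + pmf q k \<le> 1" using block_mass(2)[OF m(3)] k by simp
      moreover have "\<kappa> * \<beta> = \<beta> + \<alpha>" using k \<beta> by (simp add: field_simps)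
      ultimately show ?thesis by linarith
    qed
  qed (use \<beta> in simp)
  also have "\<dots> = real b * (real m * \<mu>)" using \<beta> m(2) by (simp add: \<mu>(1))
  finally have mass: "(\<Sum>j<m. \<Sum>i<b. g j i) \<le> real b * (real m * \<mu>)" .
  have "0 < 1 - \<alpha> / \<beta>" using \<mu> by linarith
  then have "real (card T) \<le> real (card (selections m b)) * (\<mu> / (1 - \<alpha> / \<beta>))"
    unfolding T_def using g mass m by (intro card_selections_tail_markov) auto
  moreover have "real (card T) \<le> real (card (selections m b)) *
      exp (- (real m * ((1 - \<alpha> / \<beta>) * ln ((1 - \<alpha> / \<beta>) / \<mu>) - (1 - \<alpha> / \<beta>) + \<mu>)))"
    unfolding T_def using g mass m \<mu> by (intro card_selections_tail_chernoff) auto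
  ultimately show ?thesis using CT unfolding close_fraction_def
    by (simp add: min_mult_distrib_left min_def)
qed

section \<open>The lower bound\<close>

text \<open>With \<open>l = ln (3 / P)\<close> the logarithmic term becomes
  \<open>ln (4 - P) \<le> ln 4\<close>, and what remains is
  \<open>6 * ln P + 10 * ln 4 \<le> 9 * ln 3\<close>. The worst case is the largest
  \<open>P\<close>, where \<open>(51 / 100) ^ 6 * 4 ^ 10\<close> is only slightly below
  \<open>3 ^ 9\<close>.\<close>

lemma information_numeric:
  fixes P :: real
  assumes "0 < P" "P \<le> 51 / 100"
  shows "3 / 10 * (- ln P) \<le> 9 / 10 * ln (3 / P) - ln (1 + (exp (ln (3 / P)) - 1) * P)"
proof -
  have "exp (ln (3 / P)) = 3 / P" using assms by simp
  then have e1: "1 + (exp (ln (3 / P)) - 1) * P = 4 - P" using assms by (simp add: field_simps)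
  have e3: "ln (4 - P) \<le> ln 4" using assms by simp
  have e2: "ln (3 / P) = ln 3 - ln P" using assms by (simp add: ln_div)
  moreover have "ln P \<le> ln (51 / 100)" using assms by simp
  moreover have "6 * ln (51 / 100) + 10 * ln 4 \<le> 9 * ln (3 :: real)"
  proof -
    have "ln ((51 / 100) ^ 6 * 4 ^ 10) \<le> ln (3 ^ 9 :: real)"
      by (subst ln_le_cancel_iff) (simp_all add: power_divide)
    moreover have "ln (x ^ 6 * y ^ 10) = 6 * ln x + 10 * ln y" "ln (x ^ 9) = 9 * ln x"
      if "0 < x" "0 < y" for x y :: real using that by (simp_all add: ln_mult ln_realpow)
    from this(1)[of "51 / 100" 4] this(2)[of 3 1]
    have "ln ((51 / 100) ^ 6 * 4 ^ 10) = 6 * ln (51 / 100) + 10 * ln (4 :: real)"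
      "ln (3 ^ 9) = 9 * ln (3 :: real)" by (simp_all only: zero_less_divide_iff zero_less_numeral simp_thms zero_less_one)
    ultimately show ?thesis by (simp only:)
  qed
  ultimately show ?thesis using e3 unfolding e1 unfolding e2 by argo
qed

text \<open>The information bound is applied to each value \<open>u\<close> of the public coin
  separately. Its right-hand side does not depend on \<open>u\<close>, so it survives averaging, and
  shared randomness brings no gain.\<close>

lemma protocol_information:
  assumes prot: "public_coin_protocol k (ldp_channels k \<epsilon>) n U W est"
    and succ: "\<And>p. p \<in> sparse_simplex k s \<Longrightarrow> 9 / 10 \<le> (\<integral>u. success_prob (tv_dist k) \<alpha> n (W u) (est u) p \<partial>U)"
    and \<epsilon>: "0 < \<epsilon>" and m: "0 < m" "0 < b" "m * b \<le> k" "1 \<le> k" and \<beta>: "0 < \<beta>" "\<beta> \<le> 1"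
    and s: "\<beta> = 1 \<and> m \<le> s \<or> m + 1 \<le> s"
    and \<kappa>: "\<beta> = 1 \<and> \<kappa> = 1 \<or> m * b < k \<and> \<kappa> = 1 + \<alpha> / \<beta>"
    and \<mu>: "\<mu> = \<kappa> / real b" "0 < \<mu>" "\<mu> \<le> 1 - \<alpha> / \<beta>"
    and small: "close_fraction m (1 - \<alpha> / \<beta>) \<mu> \<le> 51 / 100"
  shows "3 / 10 * (- ln (close_fraction m (1 - \<alpha> / \<beta>) \<mu>)) \<le>
    real n * (\<beta>\<^sup>2 * (exp (2 * \<epsilon>) * (exp \<epsilon> - 1))\<^sup>2 / real m)"
proof -
  define P\<^sub>0 where "P\<^sub>0 = close_fraction m (1 - \<alpha> / \<beta>) \<mu>"
  define I where "I = \<beta>\<^sup>2 * (exp (2 * \<epsilon>) * (exp \<epsilon> - 1))\<^sup>2 / real m"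
  define l where "l = ln (3 / P\<^sub>0)"
  let ?Z = "selections m b"
  let ?N = "real (card ?Z)"
  have "0 < 1 - \<alpha> / \<beta>" using \<mu> by linarith
  then have P0: "0 < P\<^sub>0" "P\<^sub>0 \<le> 51 / 100"
    using \<mu>(2) small by (simp_all add: P\<^sub>0_def close_fraction_def)
  have l0: "0 \<le> l" using P0 by (simp add: l_def)
  have N: "0 < ?N" using finite_selections[of m b] selections_nonempty[OF m(2), of m] by (simp add: card_gt_0_iff)
  interpret U: prob_space U using prot by (simp add: public_coin_protocol_def)
  define S where "S u z = success_prob (tv_dist k) \<alpha> n (W u) (est u) (hard k m b \<beta> z)" for u z
  have Sz: "9 / 10 \<le> (\<integral>u. S u z \<partial>U)" if "z \<in> ?Z" for z
    unfolding S_def using hard_sparse[OF m(1,3,4) that s] by (rule succ)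
  \<comment> \<open>The integral of a non-integrable function is 0 by convention, so being at least
    9 / 10 it certifies integrability.\<close>
  then have int: "integrable U (\<lambda>u. S u z)" if "z \<in> ?Z" for z
    using that not_integrable_integral_eq[of U "\<lambda>u. S u z"] by fastforce
  have pointwise: "l * (\<Sum>z\<in>?Z. S u z) \<le> ?N * (real n * I + ln (1 + (exp l - 1) * P\<^sub>0))" if u: "u \<in> space U" for u
  proof -
    have pc: "\<And>i. i < n \<Longrightarrow> W u i \<in> ldp_channels k \<epsilon>" "\<And>y. est u y \<in> prob_simplex k"
      using prot u by (auto simp: public_coin_protocol_def private_coin_protocol_def)
    have "\<forall>i. \<exists>r. i < n \<longrightarrow> (\<forall>z\<in>?Z. \<forall>y. pmf (bind_pmf (hard k m b \<beta> z) (W u i)) y =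
          pmf (bind_pmf (hard_center k m b \<beta>) (W u i)) y * r z y \<and> exp (- 2 * \<epsilon>) \<le> r z y \<and> r z y \<le> exp (2 * \<epsilon>)) \<and>
        (\<forall>y. (\<Sum>z\<in>?Z. (r z y - 1)\<^sup>2) \<le> ?N * I)"
      using ldp_likelihood_ratio[OF pc(1) \<epsilon> m \<beta>] unfolding I_def by blast
    then obtain r where r: "\<And>i z y. i < n \<Longrightarrow> z \<in> ?Z \<Longrightarrow> pmf (bind_pmf (hard k m b \<beta> z) (W u i)) y =
          pmf (bind_pmf (hard_center k m b \<beta>) (W u i)) y * r i z y \<and> exp (- 2 * \<epsilon>) \<le> r i z y \<and> r i z y \<le> exp (2 * \<epsilon>)"
      "\<And>i y. i < n \<Longrightarrow> (\<Sum>z\<in>?Z. (r i z y - 1)\<^sup>2) \<le> ?N * I"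
      by metis
    have "l * (\<Sum>z\<in>?Z. measure_pmf.prob (Pi_pmf {..<n} [] (\<lambda>i. bind_pmf (hard k m b \<beta> z) (W u i)))
            {y. tv_dist k (hard k m b \<beta> z) (est u y) \<le> \<alpha>})
        \<le> ?N * (real n * I + ln (1 + (exp l - 1) * P\<^sub>0))"
    proof (rule product_information_bound[where r = "\<lambda>z i. r i z" and c = "exp (- 2 * \<epsilon>)" and d = "exp (2 * \<epsilon>)"
          and Q = "\<lambda>i. bind_pmf (hard_center k m b \<beta>) (W u i)"])
      show "real (card {z \<in> ?Z. y \<in> {y. tv_dist k (hard k m b \<beta> z) (est u y) \<le> \<alpha>}}) \<le> ?N * P\<^sub>0" for y
        using card_close_selections[OF m \<beta> pc(2) \<kappa> \<mu>] by (simp add: P\<^sub>0_def)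
    qed (use r P0 l0 finite_selections selections_nonempty[OF m(2)] in auto)
    then show ?thesis by (simp add: S_def success_prob_def transcript_def)
  qed
  have "?N * (9 / 10) \<le> (\<Sum>z\<in>?Z. \<integral>u. S u z \<partial>U)"
    using sum_mono[of ?Z "\<lambda>_. 9 / 10" "\<lambda>z. \<integral>u. S u z \<partial>U"] Sz by simp
  also have "\<dots> = (\<integral>u. (\<Sum>z\<in>?Z. S u z) \<partial>U)"
    using int by (intro Bochner_Integration.integral_sum[symmetric]) auto
  finally have "l * (?N * (9 / 10)) \<le> l * (\<integral>u. (\<Sum>z\<in>?Z. S u z) \<partial>U)"
    using l0 by (intro mult_left_mono)
  also have "\<dots> = (\<integral>u. l * (\<Sum>z\<in>?Z. S u z) \<partial>U)" by simp
  also have "\<dots> \<le> (\<integral>u. ?N * (real n * I + ln (1 + (exp l - 1) * P\<^sub>0)) \<partial>U)"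
    using int pointwise by (intro integral_mono) auto
  also have "\<dots> = ?N * (real n * I + ln (1 + (exp l - 1) * P\<^sub>0))" by (simp add: U.prob_space)
  finally have "?N * (9 / 10 * l) \<le> ?N * (real n * I + ln (1 + (exp l - 1) * P\<^sub>0))" by (simp add: mult_ac)
  then have "9 / 10 * l \<le> real n * I + ln (1 + (exp l - 1) * P\<^sub>0)" using N by simp
  then have "3 / 10 * (- ln P\<^sub>0) \<le> real n * I" using information_numeric[OF P0] unfolding l_def by linarith
  then show ?thesis by (simp only: P\<^sub>0_def I_def)
qed

text \<open>With \<rho> = \<theta> / \<mu>, Chernoff's exponent per block is \<theta> times
  \<open>ln \<rho> - 1 + 1 / \<rho>\<close>, which vanishes at 1; away from 1 it keeps a fixed share
  of the logarithm. The limit \<open>200 / 101\<close> is what blocks of 100 points guarantee. The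
  proof takes the tangent to the logarithm there.\<close>

lemma ln_minus_one_ge:
  fixes \<rho> :: real
  assumes "200 / 101 \<le> \<rho>"
  shows "ln \<rho> / 5 \<le> ln \<rho> - 1 + 1 / \<rho>" "3 / 5 \<le> ln \<rho>"
proof -
  have \<rho>: "0 < \<rho>" using assms by linarith
  have "ln (101 / 100) \<le> (101 / 100 - 1 :: real)" by (rule ln_le_minus_one) simp
  moreover have "ln (200 / 101) = ln 2 - ln (101 / 100 :: real)"
    using ln_div[of 2 "101 / 100 :: real"] by simp
  ultimately have a: "2 / 3 - 1 / 100 \<le> ln (200 / 101 :: real)" using ln2_ge_two_thirds by simp
  have "ln (200 / 101) \<le> ln \<rho>" using assms by simp
  then show "3 / 5 \<le> ln \<rho>" using a by simp
  have "ln (200 / 101 / \<rho>) \<le> 200 / 101 / \<rho> - 1" using \<rho> by (intro ln_le_minus_one) simp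
  moreover have "ln (200 / 101 / \<rho>) = ln (200 / 101) - ln \<rho>" using \<rho> by (subst ln_div) auto
  ultimately have "2 / 3 - 1 / 100 + 1 - 200 / 101 * (1 / \<rho>) \<le> ln \<rho>" using a by simp
  moreover have "1 / \<rho> \<le> 101 / 200" using assms \<rho> by (simp add: field_simps)
  ultimately show "ln \<rho> / 5 \<le> ln \<rho> - 1 + 1 / \<rho>" by linarith
qed

lemma close_fraction_bounds:
  assumes "0 < \<mu>" "0 < m" "0 < \<theta>" "200 / 101 \<le> \<theta> / \<mu>"
  shows "close_fraction m \<theta> \<mu> \<le> 51 / 100"
    and "real m * \<theta> * ln (\<theta> / \<mu>) / 5 \<le> - ln (close_fraction m \<theta> \<mu>)"
proof -
  have "\<mu> / \<theta> \<le> 101 / 200" using assms by (simp add: field_simps)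
  moreover have "close_fraction m \<theta> \<mu> \<le> \<mu> / \<theta>" by (simp add: close_fraction_def)
  ultimately show "close_fraction m \<theta> \<mu> \<le> 51 / 100" by linarith
  have pos: "0 < close_fraction m \<theta> \<mu>" using assms by (simp add: close_fraction_def)
  have "ln (close_fraction m \<theta> \<mu>) \<le> ln (exp (- (real m * (\<theta> * ln (\<theta> / \<mu>) - \<theta> + \<mu>))))"
    using pos by (subst ln_le_cancel_iff) (auto simp: close_fraction_def)
  then have "real m * (\<theta> * ln (\<theta> / \<mu>) - \<theta> + \<mu>) \<le> - ln (close_fraction m \<theta> \<mu>)" by simp
  moreover have "real m * \<theta> * (ln (\<theta> / \<mu>) / 5) \<le> real m * \<theta> * (ln (\<theta> / \<mu>) - 1 + 1 / (\<theta> / \<mu>))"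
    using ln_minus_one_ge(1)[OF assms(4)] assms by (intro mult_left_mono) auto
  moreover have "real m * \<theta> * (ln (\<theta> / \<mu>) - 1 + 1 / (\<theta> / \<mu>)) = real m * (\<theta> * ln (\<theta> / \<mu>) - \<theta> + \<mu>)"
    using assms by (simp add: field_simps)
  ultimately have "real m * \<theta> * (ln (\<theta> / \<mu>) / 5) \<le> - ln (close_fraction m \<theta> \<mu>)" by linarith
  then show "real m * \<theta> * ln (\<theta> / \<mu>) / 5 \<le> - ln (close_fraction m \<theta> \<mu>)" by simp
qed


lemma sample_complexity_ge:
  assumes "\<And>n U W est. public_coin_protocol k \<W> n U W est \<Longrightarrow>
      (\<And>p. p \<in> \<P> \<Longrightarrow> 9 / 10 \<le> (\<integral>u. success_prob d \<alpha> n (W u) (est u) p \<partial>U)) \<Longrightarrow> c \<le> real n"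
  shows "ereal c \<le> ereal_of_enat (sample_complexity k \<alpha> \<P> \<W> d)"
proof -
  define N where "N = {enat n | n. \<exists>U W est. public_coin_protocol k \<W> n U W est \<and>
    (\<forall>p\<in>\<P>. (\<integral>u. success_prob d \<alpha> n (W u) (est u) p \<partial>U) \<ge> 9 / 10)}"
  show ?thesis
  proof (cases "N = {}")
    case True
    then have "sample_complexity k \<alpha> \<P> \<W> d = \<infinity>"
      unfolding sample_complexity_def N_def[symmetric] by (simp add: Inf_enat_def)
    then show ?thesis by simp
  next
    case False
    then have "Inf N \<in> N" unfolding Inf_enat_def by (auto intro: LeastI)
    then obtain n where n: "Inf N = enat n" and "\<exists>U W est. public_coin_protocol k \<W> n U W est \<and>
        (\<forall>p\<in>\<P>. (\<integral>u. success_prob d \<alpha> n (W u) (est u) p \<partial>U) \<ge> 9 / 10)"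
      unfolding N_def by blast
    then have "c \<le> real n" using assms by blast
    then show ?thesis unfolding sample_complexity_def N_def[symmetric] n by simp
  qed
qed

lemma privacy_factor_le:
  fixes \<epsilon> \<epsilon>\<^sub>0 :: real
  assumes "0 < \<epsilon>" "\<epsilon> \<le> \<epsilon>\<^sub>0"
  shows "(exp (2 * \<epsilon>) * (exp \<epsilon> - 1))\<^sup>2 \<le> exp (6 * \<epsilon>\<^sub>0) * \<epsilon>\<^sup>2"
proof -
  have "1 - \<epsilon> \<le> exp (- \<epsilon>)" using exp_ge_add_one_self[of "- \<epsilon>"] by simp
  then have "(1 - \<epsilon>) * exp \<epsilon> \<le> exp (- \<epsilon>) * exp \<epsilon>" by (intro mult_right_mono) auto
  then have "exp \<epsilon> - 1 \<le> \<epsilon> * exp \<epsilon>" by (simp add: exp_minus algebra_simps)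
  then have "exp (2 * \<epsilon>) * (exp \<epsilon> - 1) \<le> exp (2 * \<epsilon>) * (\<epsilon> * exp \<epsilon>)" by (intro mult_left_mono) auto
  also have "\<dots> = exp (3 * \<epsilon>) * \<epsilon>" using exp_add[of "2 * \<epsilon>" \<epsilon>] by simp
  also have "\<dots> \<le> exp (3 * \<epsilon>\<^sub>0) * \<epsilon>" using assms by (intro mult_right_mono) auto
  finally have "exp (2 * \<epsilon>) * (exp \<epsilon> - 1) \<le> exp (3 * \<epsilon>\<^sub>0) * \<epsilon>" .
  then have "(exp (2 * \<epsilon>) * (exp \<epsilon> - 1))\<^sup>2 \<le> (exp (3 * \<epsilon>\<^sub>0) * \<epsilon>)\<^sup>2"
    using assms by (intro power_mono) auto
  also have "\<dots> = exp (6 * \<epsilon>\<^sub>0) * \<epsilon>\<^sup>2"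
    using exp_double[of "3 * \<epsilon>\<^sub>0"] by (simp add: power_mult_distrib)
  finally show ?thesis .
qed

text \<open>Common to both hard families: all mass on the blocks (\<beta> = \<kappa> = 1), or part
  of it parked (\<kappa> = 1 + \<alpha> / \<beta>). The factor \<open>3 / 50\<close> is
  \<open>3 / 10\<close> from the information inequality times \<open>1 / 5\<close> from Chernoff's
  exponent.\<close>

lemma protocol_size:
  fixes k s :: nat and \<alpha> \<beta> \<epsilon> \<epsilon>\<^sub>0 \<kappa> :: real
  assumes prot: "public_coin_protocol k (ldp_channels k \<epsilon>) n U W est"
    and succ: "\<And>p. p \<in> sparse_simplex k s \<Longrightarrow> 9 / 10 \<le> (\<integral>u. success_prob (tv_dist k) \<alpha> n (W u) (est u) p \<partial>U)"
    and \<epsilon>: "0 < \<epsilon>" "\<epsilon> \<le> \<epsilon>\<^sub>0" and m: "0 < m" "0 < b" "m * b \<le> k" "1 \<le> k" and \<beta>: "0 < \<beta>" "\<beta> \<le> 1"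
    and s: "\<beta> = 1 \<and> m \<le> s \<or> m + 1 \<le> s"
    and \<kappa>: "\<beta> = 1 \<and> \<kappa> = 1 \<or> m * b < k \<and> \<kappa> = 1 + \<alpha> / \<beta>" "0 < \<kappa>"
    and \<theta>: "\<theta> = 1 - \<alpha> / \<beta>" "0 < \<theta>" and \<rho>: "\<rho> = \<theta> * real b / \<kappa>" "200 / 101 \<le> \<rho>"
  shows "3 / 50 * exp (- 6 * \<epsilon>\<^sub>0) * ((real m)\<^sup>2 * \<theta> * ln \<rho> / (\<beta>\<^sup>2 * \<epsilon>\<^sup>2)) \<le> real n"
proof -
  define \<mu> where "\<mu> = \<kappa> / real b"
  have \<mu>: "0 < \<mu>" using \<kappa>(2) m(2) by (simp add: \<mu>_def)
  have \<theta>\<mu>: "\<theta> / \<mu> = \<rho>" by (simp add: \<mu>_def \<rho>(1))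
  have "1 \<le> \<theta> / \<mu>" using \<rho>(2) \<theta>\<mu> by simp
  then have \<mu>\<theta>: "\<mu> \<le> 1 - \<alpha> / \<beta>" using \<mu> \<theta> by (simp add: field_simps)
  have "200 / 101 \<le> \<theta> / \<mu>" using \<rho>(2) \<theta>\<mu> by simp
  note cf = close_fraction_bounds[OF \<mu> m(1) \<theta>(2) this]
  have "3 / 10 * (real m * \<theta> * ln \<rho> / 5) \<le> 3 / 10 * (- ln (close_fraction m \<theta> \<mu>))"
    using cf(2) unfolding \<theta>\<mu> by (rule mult_left_mono) simp
  also have "\<dots> \<le> real n * (\<beta>\<^sup>2 * (exp (2 * \<epsilon>) * (exp \<epsilon> - 1))\<^sup>2 / real m)"
    using protocol_information[OF prot succ \<epsilon>(1) m \<beta> s \<kappa>(1) \<mu>_def \<mu> \<mu>\<theta>] cf(1) \<theta>(1) by simp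
  also have "\<dots> \<le> real n * (\<beta>\<^sup>2 * (exp (6 * \<epsilon>\<^sub>0) * \<epsilon>\<^sup>2) / real m)"
    using privacy_factor_le[OF \<epsilon>] by (intro mult_left_mono divide_right_mono) auto
  finally have main: "3 / 10 * (real m * \<theta> * ln \<rho> / 5) \<le> real n * (\<beta>\<^sup>2 * (exp (6 * \<epsilon>\<^sub>0) * \<epsilon>\<^sup>2) / real m)" .
  define E where "E = exp (6 * \<epsilon>\<^sub>0)"
  define X where "X = real m * \<theta> * ln \<rho>"
  define F where "F = \<beta>\<^sup>2 * (E * \<epsilon>\<^sup>2)"
  have F: "0 < F" using \<beta>(1) \<epsilon>(1) by (simp add: F_def E_def)
  have "3 / 50 * X \<le> real n * (F / real m)" using main by (simp add: E_def X_def F_def)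
  then have "3 / 50 * X * real m \<le> real n * F" using m(1) by (simp add: pos_le_divide_eq)
  then have "3 / 50 * X * real m / F \<le> real n" using F by (simp only: pos_divide_le_eq)
  moreover have "exp (- 6 * \<epsilon>\<^sub>0) = 1 / E" by (simp add: E_def exp_minus inverse_eq_divide)
  moreover have "3 / 50 * (1 / E) * ((real m)\<^sup>2 * \<theta> * ln \<rho> / (\<beta>\<^sup>2 * \<epsilon>\<^sup>2)) = 3 / 50 * X * real m / F"
    unfolding X_def F_def power2_eq_square by (simp add: mult_ac)
  ultimately show ?thesis by (simp only:)
qed

text \<open>The number \<open>k'\<close> of points to cut up is \<open>k\<close>, or
  \<open>k - 1\<close> when \<open>k\<close> is reserved for the parked mass. The rounding of
  \<open>k' div m\<close> and the reserved point together cost one unit, whence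
  \<open>b + 1\<close>.\<close>

lemma block_size:
  fixes k s :: nat
  assumes "0 < m" "m \<le> s" "100 * m \<le> k'" "k \<le> k' + 1"
  defines "b \<equiv> k' div m"
  shows "m * b \<le> k'" "100 \<le> b" "real k / real s \<le> real b + 1"
proof -
  show "m * b \<le> k'" by (simp add: b_def)
  show "100 \<le> b" using assms(1,3) by (simp add: b_def less_eq_div_iff_mult_less_eq)
  have "k' < (b + 1) * m"
    using assms(1) by (simp add: b_def dividend_less_div_times)
  then have "k \<le> (b + 1) * m" using assms(4) by linarith
  also have "\<dots> \<le> (b + 1) * s" using assms(2) by (rule mult_left_mono) simp
  finally have "real k \<le> real ((b + 1) * s)" by (simp only: of_nat_le_iff)
  then have "real k \<le> (real b + 1) * real s" by (simp add: algebra_simps)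
  then show "real k / real s \<le> real b + 1" using assms(1,2) by (simp add: pos_divide_le_eq)
qed

text \<open>The information contains \<open>ln \<rho>\<close>, the rate \<open>ln r\<close>, and
  \<rho> may be smaller than \<open>r\<close> by a factor of order \<open>\<theta>\<^sub>0\<close>.
  If \<open>b\<close> is at least \<open>4 / \<theta>\<^sub>0\<^sup>2\<close>, the loss is at most a
  square root: \<open>r \<le> \<rho>\<^sup>2\<close>. Otherwise \<open>r\<close> is at most
  \<open>8 / \<theta>\<^sub>0\<^sup>2\<close>, and the constant lower bound on
  \<open>ln \<rho>\<close> suffices.\<close>

lemma log_signal_ratio:
  fixes b r \<rho> \<theta>\<^sub>0 :: real
  assumes b: "100 \<le> b" and r: "1 \<le> r" "r \<le> b + 1" and \<theta>\<^sub>0: "0 < \<theta>\<^sub>0" "\<theta>\<^sub>0 \<le> 1"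
    and \<rho>: "200 / 101 \<le> \<rho>" "\<theta>\<^sub>0 * b \<le> \<rho>"
  shows "3 / 5 / ln (8 / \<theta>\<^sub>0\<^sup>2) * ln r \<le> 2 * ln \<rho>"
proof -
  have H: "1 \<le> ln (8 / \<theta>\<^sub>0\<^sup>2)"
  proof -
    have "exp 1 \<le> (8 :: real)" using exp_le by linarith
    also have "\<dots> \<le> 8 / \<theta>\<^sub>0\<^sup>2" using \<theta>\<^sub>0 power_le_one[of \<theta>\<^sub>0 2] by (simp add: pos_le_divide_eq)
    finally show ?thesis using \<theta>\<^sub>0 by (subst ln_ge_iff) auto
  qed
  have ln\<rho>: "3 / 5 \<le> ln \<rho>" by (rule ln_minus_one_ge(2)[OF \<rho>(1)])
  have lr: "0 \<le> ln r" using r by simp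
  have \<rho>0: "0 < \<rho>" using \<rho>(1) by linarith
  show ?thesis
  proof (cases "4 / \<theta>\<^sub>0\<^sup>2 \<le> b")
    case True
    have "r \<le> 4 * b" using r b by linarith
    also have "\<dots> \<le> \<theta>\<^sub>0\<^sup>2 * b * b"
      using True \<theta>\<^sub>0 b by (intro mult_right_mono) (simp_all add: pos_divide_le_eq mult.commute)
    also have "\<dots> = (\<theta>\<^sub>0 * b)\<^sup>2" by (simp add: power2_eq_square)
    also have "\<dots> \<le> \<rho>\<^sup>2" using \<rho> \<theta>\<^sub>0 b by (intro power_mono) auto
    finally have "ln r \<le> ln (\<rho>\<^sup>2)" using r \<rho>0 by (subst ln_le_cancel_iff) auto
    then have "ln r \<le> 2 * ln \<rho>" using \<rho>0 by (simp add: ln_realpow)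
    moreover have "3 / 5 / ln (8 / \<theta>\<^sub>0\<^sup>2) * ln r \<le> 1 * ln r"
      using H lr by (intro mult_right_mono) (simp_all add: pos_divide_le_eq)
    ultimately show ?thesis by simp
  next
    case False
    then have "r \<le> 8 / \<theta>\<^sub>0\<^sup>2" using r b by simp
    then have "ln r \<le> ln (8 / \<theta>\<^sub>0\<^sup>2)" using r by (intro ln_mono) auto
    then have "3 / 5 / ln (8 / \<theta>\<^sub>0\<^sup>2) * ln r \<le> 3 / 5 / ln (8 / \<theta>\<^sub>0\<^sup>2) * ln (8 / \<theta>\<^sub>0\<^sup>2)"
      using H by (intro mult_left_mono) auto
    also have "\<dots> = 3 / 5" using H by simp
    finally show ?thesis using ln\<rho> by linarith
  qed
qed


text \<open>If \<open>s = 1\<close> or \<alpha> > 1 / 2, the \<alpha> in the rate is a constant up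
  to a factor 2, and \<open>s\<close> blocks carry all the mass. Otherwise \<open>s \<ge> 2\<close>,
  and \<open>s - 1\<close> blocks carry mass \<open>2 * \<alpha>\<close>, one point of the support
  being spent on the parked mass.\<close>

lemma lower_bound:
  fixes \<epsilon>\<^sub>0 \<alpha>\<^sub>1 :: real
  assumes "\<alpha>\<^sub>1 < 1"
  shows "\<exists>c>0. \<forall>(k :: nat) (s :: nat) (\<alpha> :: real) (\<epsilon> :: real).
        1 \<le> k \<and> 1 \<le> s \<and> real s \<le> real k / 100 \<and> 0 < \<alpha> \<and> \<alpha> < 1 \<and> 0 < \<epsilon> \<and> \<epsilon> \<le> \<epsilon>\<^sub>0 \<and>
        \<alpha> \<le> \<alpha>\<^sub>1 \<and> \<alpha> \<le> 1 - 2 * real s / real k \<longrightarrow>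
          ereal (c * sparse_rate k s (if s = 1 then 1 else \<alpha>) \<epsilon>)
            \<le> ereal_of_enat (sample_complexity k \<alpha> (sparse_simplex k s) (ldp_channels k \<epsilon>) (tv_dist k))"
proof -
  \<comment> \<open>The second argument bounds \<theta> from below when nothing is parked; the first
    ensures \<open>\<theta>\<^sub>0 * b \<le> b / 3\<close> for parked mass.\<close>
  define \<theta>\<^sub>0 where "\<theta>\<^sub>0 = min (1 / 4) (1 - \<alpha>\<^sub>1)"
  have \<theta>\<^sub>0: "0 < \<theta>\<^sub>0" "\<theta>\<^sub>0 \<le> 1 / 4" "\<theta>\<^sub>0 \<le> 1 - \<alpha>\<^sub>1" using assms unfolding \<theta>\<^sub>0_def by linarith+
  define h where "h = 3 / 5 / ln (8 / \<theta>\<^sub>0\<^sup>2)"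
  have h: "0 < h"
  proof -
    have "\<theta>\<^sub>0\<^sup>2 \<le> 1" using \<theta>\<^sub>0 by (intro power_le_one) auto
    then have "1 < 8 / \<theta>\<^sub>0\<^sup>2" using \<theta>\<^sub>0 by (simp add: pos_less_divide_eq)
    then have "0 < ln (8 / \<theta>\<^sub>0\<^sup>2)" by (rule ln_gt_zero)
    then show ?thesis by (simp add: h_def)
  qed
  define c where "c = 3 / 50 * exp (- 6 * \<epsilon>\<^sub>0) * \<theta>\<^sub>0 * h / 32"
  have c: "0 < c" using \<theta>\<^sub>0 h by (simp add: c_def)
  show ?thesis
  proof (intro exI[of _ c] conjI allI impI c)
    fix k s :: nat and \<alpha> \<epsilon> :: real
    assume "1 \<le> k \<and> 1 \<le> s \<and> real s \<le> real k / 100 \<and> 0 < \<alpha> \<and> \<alpha> < 1 \<and> 0 < \<epsilon> \<and> \<epsilon> \<le> \<epsilon>\<^sub>0 \<and>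
        \<alpha> \<le> \<alpha>\<^sub>1 \<and> \<alpha> \<le> 1 - 2 * real s / real k"
    then have k: "1 \<le> k" "1 \<le> s" and ks: "real s \<le> real k / 100" and \<alpha>: "0 < \<alpha>" "\<alpha> < 1" "\<alpha> \<le> \<alpha>\<^sub>1"
      "\<alpha> \<le> 1 - 2 * real s / real k" and \<epsilon>: "0 < \<epsilon>" "\<epsilon> \<le> \<epsilon>\<^sub>0" by simp_all
    have k100: "100 * s \<le> k" using ks by linarith
    define r where "r = real k / real s"
    have r100: "100 \<le> r" using ks k by (simp add: r_def field_simps)
    have "exp 1 \<le> r" using exp_le r100 by linarith
    then have L: "1 \<le> ln r" using r100 by (subst ln_ge_iff) auto
    have rate: "sparse_rate k s a \<epsilon> = (real s)\<^sup>2 * ln r / (a\<^sup>2 * \<epsilon>\<^sup>2)" for a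
      using L by (simp add: sparse_rate_def r_def)
    show "ereal (c * sparse_rate k s (if s = 1 then 1 else \<alpha>) \<epsilon>)
            \<le> ereal_of_enat (sample_complexity k \<alpha> (sparse_simplex k s) (ldp_channels k \<epsilon>) (tv_dist k))"
    proof (rule sample_complexity_ge)
      fix n U W est
      assume prot: "public_coin_protocol k (ldp_channels k \<epsilon>) n U W est"
        and succ: "\<And>p. p \<in> sparse_simplex k s \<Longrightarrow> 9 / 10 \<le> (\<integral>u. success_prob (tv_dist k) \<alpha> n (W u) (est u) p \<partial>U)"
      show "c * sparse_rate k s (if s = 1 then 1 else \<alpha>) \<epsilon> \<le> real n"
      proof (cases "s = 1 \<or> 1 / 2 < \<alpha>")
        case True
        define b where "b = k div s"
        have b: "s * b \<le> k" "100 \<le> b" "r \<le> real b + 1"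
          unfolding b_def r_def using k k100 by (intro block_size[of s s k k]; simp)+
        define \<theta> where "\<theta> = 1 - \<alpha> / 1"
        have \<theta>: "\<theta>\<^sub>0 \<le> \<theta>" "2 / r \<le> \<theta>" using \<alpha> \<theta>\<^sub>0 by (simp_all add: \<theta>_def r_def)
        define \<rho> where "\<rho> = \<theta> * real b / 1"
        \<comment> \<open>The hypothesis \<open>\<alpha> \<le> 1 - 2 * s / k\<close> enters as
          \<open>2 / r \<le> \<theta>\<close>. Together with \<open>r \<le> b + 1\<close> it gives
          the ratio \<open>2 * b / (b + 1)\<close>, which is \<open>200 / 101\<close> at the
          smallest admissible \<open>b\<close>.\<close>
        have \<rho>1: "200 / 101 \<le> \<rho>"
        proof -
          have "200 / 101 * (real b + 1) \<le> 2 * real b" using b(2) by simp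
          then have "200 / 101 \<le> 2 / (real b + 1) * real b" by (simp add: pos_le_divide_eq)
          also have "\<dots> \<le> 2 / r * real b" using b(3) r100 by (intro mult_right_mono divide_left_mono) auto
          also have "\<dots> \<le> \<rho>" unfolding \<rho>_def div_by_1 using \<theta>(2) by (rule mult_right_mono) simp
          finally show ?thesis .
        qed
        have lr: "h * ln r \<le> 2 * ln \<rho>" unfolding h_def
          using b r100 \<theta>\<^sub>0 \<theta> \<rho>1 by (intro log_signal_ratio[where b = "real b"]) (auto simp: \<rho>_def mult_right_mono)
        have n: "3 / 50 * exp (- 6 * \<epsilon>\<^sub>0) * ((real s)\<^sup>2 * \<theta> * ln \<rho> / (1\<^sup>2 * \<epsilon>\<^sup>2)) \<le> real n"
          using k b \<theta> \<theta>\<^sub>0 by (intro protocol_size[OF prot succ \<epsilon> _ _ b(1) k(1) _ _ _ _ _ \<theta>_def _ \<rho>_def \<rho>1]) auto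
        define a where "a = (if s = 1 then 1 else \<alpha>)"
        have a: "1 / 2 \<le> a" using True by (auto simp: a_def)
        have "(1 / 2)\<^sup>2 \<le> a\<^sup>2" using a by (intro power_mono) auto
        then have a2: "1 / a\<^sup>2 \<le> 4" using a by (simp add: divide_le_eq power2_eq_square)
        have "c * sparse_rate k s a \<epsilon> = 3 / 50 * exp (- 6 * \<epsilon>\<^sub>0) * ((real s)\<^sup>2 * \<theta>\<^sub>0 * (h * ln r) / \<epsilon>\<^sup>2) / 32 * (1 / a\<^sup>2)"
          by (simp add: rate c_def mult_ac)
        also have "\<dots> \<le> 3 / 50 * exp (- 6 * \<epsilon>\<^sub>0) * ((real s)\<^sup>2 * \<theta> * (2 * ln \<rho>) / \<epsilon>\<^sup>2) / 32 * 4"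
        proof (rule mult_mono[OF _ a2])
          have "0 \<le> h * ln r" using h L by simp
          then have "(real s)\<^sup>2 * \<theta>\<^sub>0 * (h * ln r) \<le> (real s)\<^sup>2 * \<theta> * (2 * ln \<rho>)"
            using \<theta>(1) \<theta>\<^sub>0(1) by (intro mult_mono[OF mult_left_mono lr]) auto
          then show "3 / 50 * exp (- 6 * \<epsilon>\<^sub>0) * ((real s)\<^sup>2 * \<theta>\<^sub>0 * (h * ln r) / \<epsilon>\<^sup>2) / 32
              \<le> 3 / 50 * exp (- 6 * \<epsilon>\<^sub>0) * ((real s)\<^sup>2 * \<theta> * (2 * ln \<rho>) / \<epsilon>\<^sup>2) / 32"
            by (intro divide_right_mono mult_left_mono) auto
          show "0 \<le> 3 / 50 * exp (- 6 * \<epsilon>\<^sub>0) * ((real s)\<^sup>2 * \<theta> * (2 * ln \<rho>) / \<epsilon>\<^sup>2) / 32"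
            using \<theta>(1) \<theta>\<^sub>0(1) ln_minus_one_ge(2)[OF \<rho>1] by simp
        qed simp
        also have "\<dots> = 3 / 50 * exp (- 6 * \<epsilon>\<^sub>0) * ((real s)\<^sup>2 * \<theta> * ln \<rho> / (1\<^sup>2 * \<epsilon>\<^sup>2)) / 4" by simp
        also have "\<dots> \<le> real n / 4" using n by (rule divide_right_mono) simp
        also have "\<dots> \<le> real n" by simp
        finally show ?thesis by (simp add: a_def)
      next
        case False
        define m where "m = s - 1"
        have m: "0 < m" "m + 1 = s" using False k by (simp_all add: m_def)
        define b where "b = (k - 1) div m"
        have b: "m * b \<le> k - 1" "100 \<le> b" "r \<le> real b + 1"
          unfolding b_def r_def using k k100 m by (intro block_size[of m s "k - 1" k]; linarith)+
        have mbk: "m * b < k" "m * b \<le> k" using b(1) k by linarith+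
        \<comment> \<open>An estimate within \<alpha> must then still recover half of the block
          mass, while the information per message is proportional to
          \<open>\<alpha>\<^sup>2\<close>. The value \<open>3 / 2\<close> of \<kappa> is 1 +
          \<alpha> / \<beta>.\<close>
        define \<beta> where "\<beta> = 2 * \<alpha>"
        have \<beta>: "0 < \<beta>" "\<beta> \<le> 1" "\<alpha> / \<beta> = 1 / 2" using False \<alpha> by (simp_all add: \<beta>_def)
        define \<theta> where "\<theta> = 1 - \<alpha> / \<beta>"
        define \<rho> where "\<rho> = \<theta> * real b / (3 / 2)"
        have \<theta>: "\<theta> = 1 / 2" using \<beta> by (simp add: \<theta>_def)
        have \<rho>: "\<rho> = real b / 3" by (simp add: \<rho>_def \<theta>)
        have \<rho>1: "200 / 101 \<le> \<rho>" using b(2) by (simp add: \<rho>)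
        have "\<theta>\<^sub>0 * real b \<le> 1 / 4 * real b" using \<theta>\<^sub>0 by (intro mult_right_mono) auto
        then have \<rho>2: "\<theta>\<^sub>0 * real b \<le> \<rho>" by (simp add: \<rho>)
        have lr: "h * ln r \<le> 2 * ln \<rho>" unfolding h_def
          using b r100 \<theta>\<^sub>0 \<rho>1 \<rho>2 by (intro log_signal_ratio[where b = "real b"]) auto
        have n: "3 / 50 * exp (- 6 * \<epsilon>\<^sub>0) * ((real m)\<^sup>2 * \<theta> * ln \<rho> / (\<beta>\<^sup>2 * \<epsilon>\<^sup>2)) \<le> real n"
          using m b mbk \<beta> \<theta> by (intro protocol_size[OF prot succ \<epsilon> m(1) _ mbk(2) k(1) \<beta>(1,2) _ _ _ \<theta>_def _ \<rho>_def \<rho>1]) auto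
        have "real s \<le> 2 * real m" using m by linarith
        then have "(real s)\<^sup>2 \<le> (2 * real m)\<^sup>2" by (intro power_mono) auto
        then have sm: "(real s)\<^sup>2 \<le> 4 * (real m)\<^sup>2" by (simp add: power2_eq_square)
        have "c * sparse_rate k s \<alpha> \<epsilon> = 3 / 50 * exp (- 6 * \<epsilon>\<^sub>0) * ((real s)\<^sup>2 * \<theta>\<^sub>0 * (h * ln r) / (\<alpha>\<^sup>2 * \<epsilon>\<^sup>2)) / 32"
          by (simp add: rate c_def mult_ac)
        also have "\<dots> \<le> 3 / 50 * exp (- 6 * \<epsilon>\<^sub>0) * (4 * (real m)\<^sup>2 * (1 / 4) * (2 * ln \<rho>) / (\<alpha>\<^sup>2 * \<epsilon>\<^sup>2)) / 32"
        proof -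
          have "0 \<le> h * ln r" using h L by simp
          then have "(real s)\<^sup>2 * \<theta>\<^sub>0 * (h * ln r) \<le> 4 * (real m)\<^sup>2 * (1 / 4) * (2 * ln \<rho>)"
            using \<theta>\<^sub>0(1,2) by (intro mult_mono[OF mult_mono[OF sm] lr]) auto
          then show ?thesis by (intro divide_right_mono mult_left_mono) auto
        qed
        also have "\<dots> = 3 / 50 * exp (- 6 * \<epsilon>\<^sub>0) * ((real m)\<^sup>2 * \<theta> * ln \<rho> / (\<beta>\<^sup>2 * \<epsilon>\<^sup>2)) / 2"
          by (simp add: \<beta>_def \<theta> power2_eq_square)
        also have "\<dots> \<le> real n / 2" using n by (rule divide_right_mono) simp
        also have "\<dots> \<le> real n" by simp
        finally show ?thesis using False by simp
      qed
    qed
  qed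
qed


section \<open>Reasoning about programs\<close>

definition runs :: "program \<Rightarrow> nat \<Rightarrow> state \<Rightarrow> (state \<Rightarrow> bool) \<Rightarrow> bool" where
  "runs P T \<sigma> Q \<longleftrightarrow> (\<exists>t\<le>T. \<exists>\<tau>. exec P \<sigma> t \<tau> \<and> Q \<tau>)"

primrec loop_free :: "program \<Rightarrow> bool" where
  "loop_free (Do c) \<longleftrightarrow> True"
| "loop_free (Seq P Q) \<longleftrightarrow> loop_free P \<and> loop_free Q"
| "loop_free (Cond b P Q) \<longleftrightarrow> loop_free P \<and> loop_free Q"
| "loop_free (While b P) \<longleftrightarrow> False"

text \<open>A functional simulator, so that code without loops is verified by rewriting. The value
  on \<open>While\<close> is a dummy, which \<open>loop_free\<close> excludes; the same holds for
  \<open>cost\<close>.\<close>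

primrec run :: "program \<Rightarrow> state \<Rightarrow> state" where
  "run (Do c) \<sigma> = step c \<sigma>"
| "run (Seq P Q) \<sigma> = run Q (run P \<sigma>)"
| "run (Cond b P Q) \<sigma> = (if holds b \<sigma> then run P \<sigma> else run Q \<sigma>)"
| "run (While b P) \<sigma> = \<sigma>"

primrec cost :: "program \<Rightarrow> nat" where
  "cost (Do c) = 1"
| "cost (Seq P Q) = cost P + cost Q"
| "cost (Cond b P Q) = Suc (max (cost P) (cost Q))"
| "cost (While b P) = 0"

fun seqs :: "program list \<Rightarrow> program" where
  "seqs [] = Do (NMove 0 0)"
| "seqs [P] = P"
| "seqs (P # Q # Ps) = Seq P (seqs (Q # Ps))"

abbreviation skip :: program where
  "skip \<equiv> Do (NMove 0 0)"

lemma runs_mono: "runs P T \<sigma> Q \<Longrightarrow> T \<le> T' \<Longrightarrow> (\<And>\<tau>. Q \<tau> \<Longrightarrow> Q' \<tau>) \<Longrightarrow> runs P T' \<sigma> Q'"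
  unfolding runs_def by (meson le_trans)

lemma runs_loop_free:
  assumes "loop_free P" "cost P \<le> T" "Q (run P \<sigma>)"
  shows "runs P T \<sigma> Q"
proof -
  have "\<exists>t\<le>cost P. exec P \<sigma> t (run P \<sigma>)" using assms(1)
  proof (induction P arbitrary: \<sigma>)
    case (Do c)
    have "exec (Do c) \<sigma> 1 (run (Do c) \<sigma>)" using exec.Do[of c \<sigma>] by simp
    then show ?case by (intro exI[of _ 1]) simp
  next
    case (Seq P Q)
    then obtain t t' where "t \<le> cost P" "exec P \<sigma> t (run P \<sigma>)"
      "t' \<le> cost Q" "exec Q (run P \<sigma>) t' (run Q (run P \<sigma>))" by fastforce
    then show ?case by (auto intro!: exI[of _ "t + t'"] exec.Seq)
  next
    case (Cond b P Q)
    obtain t where t: "t \<le> cost P" "exec P \<sigma> t (run P \<sigma>)" using Cond by fastforce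
    obtain t' where t': "t' \<le> cost Q" "exec Q \<sigma> t' (run Q \<sigma>)" using Cond by fastforce
    show ?case
    proof (cases "holds b \<sigma>")
      case True
      then show ?thesis using t exec.CondTrue[OF True t(2)]
        by (auto intro!: exI[of _ "Suc t"])
    next
      case False
      then show ?thesis using t' exec.CondFalse[OF False t'(2)]
        by (auto intro!: exI[of _ "Suc t'"])
    qed
  qed auto
  then show ?thesis using assms(2,3) unfolding runs_def by (meson le_trans)
qed

lemma runs_Seq:
  assumes "runs P T \<sigma> R" "\<And>\<tau>. R \<tau> \<Longrightarrow> runs P' T' \<tau> Q"
  shows "runs (Seq P P') (T + T') \<sigma> Q"
proof -
  obtain t \<tau> where 1: "t \<le> T" "exec P \<sigma> t \<tau>" "R \<tau>" using assms(1) unfolding runs_def by auto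
  obtain t' \<rho> where 2: "t' \<le> T'" "exec P' \<tau> t' \<rho>" "Q \<rho>"
    using assms(2)[OF 1(3)] unfolding runs_def by auto
  have "exec (Seq P P') \<sigma> (t + t') \<rho>" using 1 2 by (auto intro: exec.Seq)
  then show ?thesis using 1 2 unfolding runs_def by (meson add_mono)
qed

lemma runs_Cond:
  assumes "holds b \<sigma> \<Longrightarrow> runs P T \<sigma> R" "\<not> holds b \<sigma> \<Longrightarrow> runs Q T \<sigma> R"
  shows "runs (Cond b P Q) (Suc T) \<sigma> R"
  using assms unfolding runs_def
  by (cases "holds b \<sigma>") (meson exec.CondTrue exec.CondFalse Suc_le_mono)+

text \<open>The invariant is indexed by the round, which fixes the number of rounds in advance. Each
  round costs its body and one test, and the last test fails.\<close>

lemma runs_While: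
  assumes inv: "I 0 \<sigma>"
    and body: "\<And>i \<tau>. i < N \<Longrightarrow> I i \<tau> \<Longrightarrow> holds b \<tau> \<and> runs P c \<tau> (I (Suc i))"
    and halt: "\<And>\<tau>. I N \<tau> \<Longrightarrow> \<not> holds b \<tau> \<and> Q \<tau>"
  shows "runs (While b P) (N * (c + 1) + 1) \<sigma> Q"
proof -
  have "runs (While b P) ((N - i) * (c + 1) + 1) \<tau> Q" if "i \<le> N" "I i \<tau>" for i \<tau>
    using that
  proof (induction i arbitrary: \<tau> rule: inc_induct)
    case base
    then have "exec (While b P) \<tau> 1 \<tau>" "Q \<tau>" using halt exec.WhileFalse by blast+
    then show ?case unfolding runs_def by (intro exI[of _ 1]) auto
  next
    case (step i)
    obtain t \<rho> where 1: "t \<le> c" "exec P \<tau> t \<rho>" "I (Suc i) \<rho>" "holds b \<tau>"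
      using body[OF step(2,4)] unfolding runs_def by auto
    obtain t' \<pi> where 2: "t' \<le> (N - Suc i) * (c + 1) + 1" "exec (While b P) \<rho> t' \<pi>" "Q \<pi>"
      using step(3)[OF 1(3)] unfolding runs_def by auto
    have e: "exec (While b P) \<tau> (Suc (t + t')) \<pi>" using 1 2 exec.WhileTrue by blast
    have "Suc (t + t') \<le> (N - i) * (c + 1) + 1"
    proof -
      have "N - i = Suc (N - Suc i)" using step(2) by simp
      then show ?thesis using 1(1) 2(1) by simp
    qed
    then show ?case using e 2(3) unfolding runs_def by blast
  qed
  from this[of 0] inv show ?thesis by simp
qed


section \<open>The Walsh--Hadamard matrix\<close>

text \<open>For \<open>r\<close> and \<open>x\<close> below \<open>2 ^ d\<close> this is -1 to the
  power of the number of binary digits 1 that \<open>r\<close> and \<open>x\<close> have in common.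
  The recursion strips the top digit by comparison and subtraction, because the machine has no
  operations on bits.\<close>

primrec had :: "nat \<Rightarrow> nat \<Rightarrow> nat \<Rightarrow> real" where
  "had 0 r x = 1"
| "had (Suc d) r x = (if 2 ^ d \<le> r \<and> 2 ^ d \<le> x then - 1 else 1) *
     had d (if 2 ^ d \<le> r then r - 2 ^ d else r) (if 2 ^ d \<le> x then x - 2 ^ d else x)"

lemma had_cases: "had d r x = 1 \<or> had d r x = - 1"
  by (induction d arbitrary: r x) auto

text \<open>The state of the fast transform of \<open>A\<close> after \<open>d\<close> levels.\<close>

definition wht :: "nat \<Rightarrow> (nat \<Rightarrow> real) \<Rightarrow> nat \<Rightarrow> real" where
  "wht d A p = (\<Sum>r<2 ^ d. had d r (p mod 2 ^ d) * A (p - p mod 2 ^ d + r))"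

lemma wht_0 [simp]: "wht 0 A = A"
  by (rule ext) (simp add: wht_def)

lemma sum_two_power_Suc:
  "(\<Sum>r<2 ^ Suc d. f r) = (\<Sum>r<2 ^ d. f r) + (\<Sum>r<2 ^ d. f (r + 2 ^ d))" for f :: "nat \<Rightarrow> real"
  using sum.atLeastLessThan_concat[of 0 "2 ^ d" "2 ^ d + 2 ^ d" f]
    sum.shift_bounds_nat_ivl[of f 0 "2 ^ d" "2 ^ d"]
  by (simp add: atLeast0LessThan mult_2)

text \<open>The sum over \<open>r\<close> is split by the top digit of \<open>r\<close> into two
  transforms of half the size. Their signs differ only if the top digit of the position is also 1.
  Both positions involved lie in the same block of length \<open>2 ^ Suc d\<close>.\<close>

lemma wht_Suc:
  "wht (Suc d) A p =
     (if p mod 2 ^ Suc d < 2 ^ d then wht d A p + wht d A (p + 2 ^ d)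
      else wht d A (p - 2 ^ d) - wht d A p)"
proof -
  define h :: nat where "h = 2 ^ d"
  have h: "h > 0" by (simp add: h_def)
  define q x where "q = p div (2 * h)" and "x = p mod (2 * h)"
  have p: "p = q * (2 * h) + x" unfolding q_def x_def by (rule div_mult_mod_eq[symmetric])
  have x: "x < 2 * h" using h by (simp add: x_def)
  have mod_x: "(q * (2 * h) + y) mod h = y mod h" for y
    using mod_mult_self1[of y "q * 2" h] by (simp add: ac_simps)
  have hh: "2 ^ Suc d = 2 * h" by (simp add: h_def)
  have b: "p - x + (r + h) = p - x + h + r" for r by simp
  have S: "wht (Suc d) A p =
      (\<Sum>r<h. had (Suc d) r x * A (p - x + r)) + (\<Sum>r<h. had (Suc d) (r + h) x * A (p - x + h + r))"
    unfolding wht_def hh x_def[symmetric] unfolding hh[symmetric] sum_two_power_Suc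
    unfolding h_def[symmetric] by (simp only: b)
  have W: "wht d A u = (\<Sum>r<h. had d r (u mod h) * A (u - u mod h + r))" for u
    by (simp only: wht_def h_def)
  show ?thesis
  proof (cases "x < h")
    case True
    have 1: "p mod h = x" "(p + h) mod h = x" using True by (simp_all add: p mod_x)
    have a: "p + h - x = p - x + h" using p by simp
    have "had (Suc d) r x = had d r x" "had (Suc d) (r + h) x = had d r x" if "r < h" for r
      using that True by (simp_all add: h_def)
    then have "wht (Suc d) A p = wht d A p + wht d A (p + h)"
      unfolding S W 1 a by simp
    then show ?thesis using True by (simp only: hh h_def[symmetric] x_def[symmetric] if_True)
  next
    case False
    define y where "y = x - h"
    have y: "x = y + h" "y < h" using False x by (auto simp: y_def)
    have ph: "p - h = q * (2 * h) + y" by (simp add: p y)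
    have 1: "p mod h = y" "(p - h) mod h = y"
      using y mod_x[of x] mod_x[of y] by (simp_all add: p ph)
    have a: "p - h - y = p - x" "p - y = p - x + h" using p y by simp_all
    have "had (Suc d) r x = had d r y" "had (Suc d) (r + h) x = - had d r y" if "r < h" for r
      using that y by (simp_all add: h_def)
    then have "wht (Suc d) A p = wht d A (p - h) - wht d A p"
      unfolding S W 1 a by (simp add: sum_negf)
    then show ?thesis using False by (simp only: hh h_def[symmetric] x_def[symmetric] if_False)
  qed
qed

lemma wht_full: "p < 2 ^ d \<Longrightarrow> wht d A p = (\<Sum>r<2 ^ d. had d r p * A r)"
  by (simp add: wht_def)


section \<open>The programs\<close>

definition user_setup :: program where
  "user_setup = seqs [Do (NConst 7 1), Do (NConst 8 0), Do (NConst 5 1), Do (NAdd 6 0 7),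
     Do (NConst 9 0)]"

definition user_powers :: program where
  "user_powers = seqs [Do (NStore 9 5), Do (NAdd 5 5 5), Do (NAdd 9 9 7)]"

text \<open>Real register 3 is the sign collected so far and real register 6 is 0, so that the
  subtraction negates. It is reached only if both the label and the sample contain the current power
  of two.\<close>

definition user_sign :: program where
  "user_sign = seqs [Do (NSub 9 9 7), Do (NLoad 10 9),
     Cond (NLess 3 10) skip (seqs [Do (NSub 3 3 10), Cond (NLess 4 10) skip (Do (RSub 3 6 3))]),
     Cond (NLess 4 10) skip (Do (NSub 4 4 10))]"

definition user_output :: program where
  "user_output = seqs [Do (NConst 10 2), Do (ROfNat 4 10), Do (RAdd 5 4 1), Do (RDiv 5 1 5),
     Do (RMul 5 5 3), Do (ROfNat 7 7), Do (RAdd 5 5 7), Do (RDiv 5 5 4),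
     Cond (RLess 2 5) (Do (NConst 0 1)) (Do (NConst 0 0))]"

definition user_program :: program where
  "user_program =
     Seq user_setup (Seq (While (NLess 5 6) user_powers)
       (Seq (seqs [Do (ROfNat 3 7), Do (ROfNat 6 8)])
         (Seq (While (NLess 8 9) user_sign) user_output)))"

text \<open>The inequality is strict because the symbols run from 1 to \<open>k\<close>, so
  \<open>k\<close> itself must be a column index.\<close>

definition bitlen :: "nat \<Rightarrow> nat" where
  "bitlen k = (LEAST d. k < 2 ^ d)"

lemma bitlen: "k < 2 ^ bitlen k"
  unfolding bitlen_def by (rule LeastI[of _ k]) (rule less_exp)

lemma not_bitlen: "d < bitlen k \<Longrightarrow> 2 ^ d \<le> k"
  unfolding bitlen_def using not_less_Least by fastforce

lemma two_power_bitlen_le: "1 \<le> k \<Longrightarrow> 2 ^ bitlen k \<le> 2 * k"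
  using not_bitlen[of "bitlen k - 1" k] by (cases "bitlen k") auto

text \<open>The solution of \<open>1 + b = (1 + \<epsilon>) * (1 - b)\<close>: the two probabilities
  of a bit then have the ratio \<open>1 + \<epsilon>\<close>, which is at most
  \<open>exp \<epsilon>\<close>.\<close>

definition user_bias :: "real \<Rightarrow> real" where
  "user_bias \<epsilon> = \<epsilon> / (2 + \<epsilon>)"

lemma runs_user_program:
  "runs user_program (20 + 14 * bitlen k) (user_input k s n \<alpha> \<epsilon> l x v)
     (\<lambda>\<tau>. nreg \<tau> 0 = of_bool (v < (1 + user_bias \<epsilon> * had (bitlen k) l x) / 2))"
proof -
  define J where "J = bitlen k"
  define I1 where "I1 i \<sigma> \<longleftrightarrow> nreg \<sigma> 3 = l \<and> nreg \<sigma> 4 = x \<and> nreg \<sigma> 5 = 2 ^ i \<and> nreg \<sigma> 6 = k + 1 \<and>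
    nreg \<sigma> 7 = 1 \<and> nreg \<sigma> 8 = 0 \<and> nreg \<sigma> 9 = i \<and> rreg \<sigma> 1 = \<epsilon> \<and> rreg \<sigma> 2 = v \<and>
    (\<forall>j<i. nmem \<sigma> j = 2 ^ j)" for i and \<sigma> :: state
  \<comment> \<open>The sign collected so far times the entry for the remaining low digits is always
    the entry sought.\<close>
  define I2 where "I2 i \<sigma> \<longleftrightarrow> nreg \<sigma> 9 = J - i \<and> nreg \<sigma> 7 = 1 \<and> nreg \<sigma> 8 = 0 \<and> rreg \<sigma> 1 = \<epsilon> \<and>
    rreg \<sigma> 2 = v \<and> rreg \<sigma> 6 = 0 \<and> (\<forall>j<J. nmem \<sigma> j = 2 ^ j) \<and>
    rreg \<sigma> 3 * had (J - i) (nreg \<sigma> 3) (nreg \<sigma> 4) = had J l x" for i and \<sigma> :: state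
  have 1: "runs user_setup 5 (user_input k s n \<alpha> \<epsilon> l x v) (I1 0)"
    by (rule runs_loop_free) (simp_all add: user_setup_def user_input_def array_def I1_def)
  have 2: "runs (While (NLess 5 6) user_powers) (J * (3 + 1) + 1) \<sigma> (I1 J)" if "I1 0 \<sigma>" for \<sigma>
  proof (rule runs_While[where I = I1, OF that])
    fix i \<tau> assume i: "i < J" and I: "I1 i \<tau>"
    have "2 ^ i \<le> k" using i not_bitlen by (simp add: J_def)
    then show "holds (NLess 5 6) \<tau> \<and> runs user_powers 3 \<tau> (I1 (Suc i))"
      using I by (auto simp: I1_def user_powers_def less_Suc_eq intro!: runs_loop_free)
  next
    fix \<tau> assume "I1 J \<tau>"
    then show "\<not> holds (NLess 5 6) \<tau> \<and> I1 J \<tau>"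
      using bitlen[of k] by (simp add: I1_def J_def)
  qed
  have 3: "runs (seqs [Do (ROfNat 3 7), Do (ROfNat 6 8)]) 2 \<sigma> (I2 0)" if "I1 J \<sigma>" for \<sigma>
    using that by (intro runs_loop_free) (simp_all add: I1_def I2_def)
  have 4: "runs (While (NLess 8 9) user_sign) (J * (9 + 1) + 1) \<sigma> (I2 J)" if "I2 0 \<sigma>" for \<sigma>
  proof (rule runs_While[where I = I2, OF that])
    fix i \<tau> assume i: "i < J" and I: "I2 i \<tau>"
    define d where "d = J - Suc i"
    have d: "J - i = Suc d" "d < J" "J - Suc i = d" using i by (simp_all add: d_def)
    have "I2 (Suc i) (run user_sign \<tau>)"
      using I d(2) unfolding I2_def user_sign_def d(1,3)
      by (simp add: not_less) (intro conjI impI; simp)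
    then have "runs user_sign 9 \<tau> (I2 (Suc i))"
      by (rule runs_loop_free[rotated 2]) (simp_all add: user_sign_def)
    moreover have "holds (NLess 8 9) \<tau>" using I i by (simp add: I2_def)
    ultimately show "holds (NLess 8 9) \<tau> \<and> runs user_sign 9 \<tau> (I2 (Suc i))" by blast
  next
    fix \<tau> assume "I2 J \<tau>"
    then show "\<not> holds (NLess 8 9) \<tau> \<and> I2 J \<tau>" by (simp add: I2_def)
  qed
  have 5: "runs user_output 10 \<sigma> (\<lambda>\<tau>. nreg \<tau> 0 = of_bool (v < (1 + user_bias \<epsilon> * had J l x) / 2))"
    if "I2 J \<sigma>" for \<sigma>
    using that by (intro runs_loop_free) (simp_all add: I2_def user_output_def user_bias_def add.commute)
  show ?thesis unfolding user_program_def J_def[symmetric]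
    by (rule runs_mono[OF runs_Seq[OF 1 runs_Seq[OF 2 runs_Seq[OF 3 runs_Seq[OF 4 5]]]]]) simp_all
qed


section \<open>Performing one level of the fast transform in place\<close>

definition partner :: "nat \<Rightarrow> nat \<Rightarrow> nat" where
  "partner d p = (if p mod 2 ^ Suc d < 2 ^ d then p else p - 2 ^ d)"

text \<open>The array after a scan of the first \<open>i\<close> positions.
  \<open>partner d p\<close> is the smaller index of the butterfly pair that contains
  \<open>p\<close>; both cells of a pair are updated together, at the moment when the scan visits
  this index.\<close>

definition partial_level :: "nat \<Rightarrow> (nat \<Rightarrow> real) \<Rightarrow> nat \<Rightarrow> nat \<Rightarrow> real" where
  "partial_level d A i p = (if partner d p < i then wht (Suc d) A p else wht d A p)"

lemma partial_level_0: "partial_level d A 0 p = wht d A p"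
  by (simp add: partial_level_def)

lemma partial_level_full: "p < i \<Longrightarrow> partial_level d A i p = wht (Suc d) A p"
  by (auto simp: partial_level_def partner_def)

lemma mod_add_half:
  fixes i :: nat
  assumes "i mod 2 ^ Suc d < 2 ^ d"
  shows "(i + 2 ^ d) mod 2 ^ Suc d = i mod 2 ^ Suc d + 2 ^ d"
  using assms by (subst mod_add_left_eq[symmetric]) (simp del: mod_add_left_eq)

lemma partner_eq_iff:
  assumes "i mod 2 ^ Suc d < 2 ^ d"
  shows "partner d p = i \<longleftrightarrow> p = i \<or> p = i + 2 ^ d"
proof
  assume p: "partner d p = i"
  show "p = i \<or> p = i + 2 ^ d"
  proof (cases "p mod 2 ^ Suc d < 2 ^ d")
    case False
    then have "2 ^ d \<le> p" using mod_less_eq_dividend[of p "2 ^ Suc d"] by linarith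
    then show ?thesis using p False by (auto simp: partner_def)
  qed (use p in \<open>simp add: partner_def\<close>)
next
  assume "p = i \<or> p = i + 2 ^ d"
  then show "partner d p = i"
    using assms mod_add_half[OF assms] by (auto simp: partner_def simp del: power_Suc)
qed

lemma partner_mod: "partner d p mod 2 ^ Suc d < 2 ^ d"
proof (cases "p mod 2 ^ Suc d < 2 ^ d")
  case False
  define x where "x = p mod 2 ^ Suc d"
  have "p = p div 2 ^ Suc d * 2 ^ Suc d + x" unfolding x_def by (rule div_mult_mod_eq[symmetric])
  moreover have "2 ^ d \<le> x" "x < 2 * 2 ^ d" using False by (simp_all add: x_def)
  ultimately have "p - 2 ^ d = (x - 2 ^ d) + p div 2 ^ Suc d * 2 ^ Suc d" by linarith
  then have "(p - 2 ^ d) mod 2 ^ Suc d = (x - 2 ^ d) mod 2 ^ Suc d"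
    using mod_mult_self1 by metis
  also have "\<dots> = x - 2 ^ d" using \<open>x < 2 * 2 ^ d\<close> by simp
  finally show ?thesis using False \<open>x < 2 * 2 ^ d\<close> \<open>2 ^ d \<le> x\<close> by (simp add: partner_def del: power_Suc)
qed (simp add: partner_def)

lemma partial_level_Suc:
  assumes "i mod 2 ^ Suc d < 2 ^ d"
  shows "partial_level d A (Suc i) = (partial_level d A i)
    (i := partial_level d A i i + partial_level d A i (i + 2 ^ d),
     i + 2 ^ d := partial_level d A i i - partial_level d A i (i + 2 ^ d))"
proof
  fix p
  have *: "partner d i = i" "partner d (i + 2 ^ d) = i" using partner_eq_iff[OF assms] by auto
  have "\<not> (i + 2 ^ d) mod 2 ^ Suc d < 2 ^ d" by (simp only: mod_add_half[OF assms] not_less le_add2)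
  then show "partial_level d A (Suc i) p = ((partial_level d A i)
    (i := partial_level d A i i + partial_level d A i (i + 2 ^ d),
     i + 2 ^ d := partial_level d A i i - partial_level d A i (i + 2 ^ d))) p"
    using * partner_eq_iff[OF assms, of p] assms
    by (auto simp: partial_level_def wht_Suc less_Suc_eq simp del: power_Suc)
qed

lemma partial_level_Suc':
  assumes "\<not> i mod 2 ^ Suc d < 2 ^ d"
  shows "partial_level d A (Suc i) = partial_level d A i"
proof
  fix p
  have "partner d p \<noteq> i" using assms partner_mod[of d p] by auto
  then show "partial_level d A (Suc i) p = partial_level d A i p"
    by (simp add: partial_level_def less_Suc_eq)
qed

text \<open>\<open>2 ^ Suc d\<close> divides \<open>2 ^ J\<close>, so no butterfly pair is cut off
  by the end of the array.\<close>

lemma add_half_less: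
  fixes i :: nat
  assumes "i mod 2 ^ Suc d < 2 ^ d" "i < 2 ^ J" "d < J"
  shows "i + 2 ^ d < 2 ^ J"
proof -
  define e where "e = J - Suc d"
  have J: "2 ^ J = 2 ^ e * (2 ^ Suc d :: nat)" using assms(3) by (simp only: e_def flip: power_add) simp
  have "i div 2 ^ Suc d < 2 ^ e"
    using assms(2) unfolding J by (simp add: less_mult_imp_div_less)
  then have "(i div 2 ^ Suc d + 1) * 2 ^ Suc d \<le> 2 ^ J" unfolding J by (intro mult_right_mono) auto
  moreover have "i = i div 2 ^ Suc d * 2 ^ Suc d + i mod 2 ^ Suc d" by (rule div_mult_mod_eq[symmetric])
  ultimately show ?thesis using assms(1) by (simp add: algebra_simps)
qed

section \<open>The program of the server\<close>

definition server_setup :: program where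
  "server_setup = seqs [Do (NConst 7 1), Do (NConst 8 0), Do (NConst 3 1), Do (NAdd 9 0 7),
     Do (ROfNat 2 7), Do (NConst 4 0), Do (NConst 10 1)]"

definition server_count :: program where
  "server_count = seqs [Do (NLoad 5 4), Do (RLoad 3 5), Do (NAdd 6 2 4), Do (NLoad 6 6),
     Cond (NLess 8 6) (Do (RAdd 3 3 2)) (Do (RSub 3 3 2)), Do (RStore 5 3), Do (NAdd 4 4 7)]"

text \<open>Register 5 holds the position modulo twice the half-length in register 10; with no
  division of naturals, it is counted up and reset. Only positions in the lower half of a block act,
  the others are passed over.\<close>

definition server_butterfly :: program where
  "server_butterfly = seqs [
     Cond (NLess 5 10)
       (seqs [Do (NAdd 6 4 10), Do (RLoad 3 4), Do (RLoad 4 6), Do (RAdd 5 3 4), Do (RSub 6 3 4),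
          Do (RStore 4 5), Do (RStore 6 6)])
       skip,
     Do (NAdd 4 4 7), Do (NAdd 5 5 7), Cond (NLess 5 11) skip (Do (NConst 5 0))]"

definition server_level :: program where
  "server_level = Seq (seqs [Do (NAdd 11 10 10), Do (NConst 4 0), Do (NConst 5 0)])
     (Seq (While (NLess 4 3) server_butterfly) (Do (NMove 10 11)))"

definition server_scale :: program where
  "server_scale = seqs [Do (NConst 6 2), Do (ROfNat 8 6), Do (RAdd 8 8 1), Do (ROfNat 7 2),
     Do (RMul 7 7 1), Do (RDiv 7 7 8), Do (NConst 6 100), Do (ROfNat 8 6), Do (ROfNat 9 1),
     Do (RMul 8 8 9), Do (RDiv 8 0 8), Do (ROfNat 9 8), Do (ROfNat 10 8), Do (NMove 4 7)]"

definition server_threshold :: program where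
  "server_threshold = seqs [Do (RLoad 3 4), Do (RDiv 3 3 7),
     Cond (RLess 8 3) (Do (RAdd 9 9 3)) (Do (RMove 3 10)), Do (RStore 4 3), Do (NAdd 4 4 7)]"

definition server_divide :: program where
  "server_divide = seqs [Do (RLoad 3 4), Do (RDiv 3 3 9), Do (RStore 4 3), Do (NAdd 4 4 7)]"

text \<open>If no entry passed the threshold, all cells \<open>1..k\<close> are already 0, and
  writing 1 into cell 1 leaves a point mass.\<close>

definition server_normalize :: program where
  "server_normalize = Cond (RLess 10 9)
     (Seq (Do (NMove 4 7)) (While (NLess 4 9) server_divide)) (Do (RStore 7 2))"

definition server_program :: program where
  "server_program =
     Seq (Seq server_setup (While (NLess 3 9) (Do (NAdd 3 3 3))))
       (Seq (While (NLess 4 2) server_count)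
         (Seq (While (NLess 10 3) server_level)
           (Seq server_scale
             (Seq (While (NLess 4 9) server_threshold) server_normalize))))"

text \<open>User \<open>i\<close> holds row \<open>r i\<close> of the Walsh--Hadamard matrix and sends the sign \<open>B i\<close>.\<close>

definition raw :: "nat \<Rightarrow> nat \<Rightarrow> (nat \<Rightarrow> nat) \<Rightarrow> (nat \<Rightarrow> real) \<Rightarrow> nat \<Rightarrow> real" where
  "raw k n r B x = (\<Sum>i<n. B i * had (bitlen k) (r i) x)"

definition counts :: "nat \<Rightarrow> (nat \<Rightarrow> nat) \<Rightarrow> (nat \<Rightarrow> real) \<Rightarrow> nat \<Rightarrow> real" where
  "counts n r B p = (\<Sum>i<n. if r i = p then B i else 0)"

text \<open>Grouping the users by rows turns \<open>k\<close> sums over all users into one transform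
  of the vector of row totals. This makes the running time nearly linear in \<open>n + k\<close>
  instead of proportional to \<open>n * k\<close>.\<close>

lemma wht_counts:
  assumes "\<And>i. i < n \<Longrightarrow> r i < 2 ^ bitlen k" "x < 2 ^ bitlen k"
  shows "wht (bitlen k) (counts n r B) x = raw k n r B x"
proof -
  have "wht (bitlen k) (counts n r B) x
      = (\<Sum>p<2 ^ bitlen k. \<Sum>i<n. if r i = p then B i * had (bitlen k) p x else 0)"
    unfolding wht_full[OF assms(2)] counts_def sum_distrib_left
    by (intro sum.cong refl) (auto simp: mult.commute)
  also have "\<dots> = (\<Sum>i<n. \<Sum>p<2 ^ bitlen k. if r i = p then B i * had (bitlen k) p x else 0)"
    by (rule sum.swap)
  also have "\<dots> = raw k n r B x"
    unfolding raw_def using assms(1) by (intro sum.cong refl) simp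
  finally show ?thesis .
qed

text \<open>The threshold is \<open>2 * t\<close> for the \<open>t = \<alpha> / (200 * s)\<close> of
  the error analysis: one \<open>t\<close> covers the bias, so that an entry outside the support
  survives only if its noise exceeds the other.\<close>

definition thresholded ::
  "nat \<Rightarrow> nat \<Rightarrow> nat \<Rightarrow> real \<Rightarrow> real \<Rightarrow> (nat \<Rightarrow> nat) \<Rightarrow> (nat \<Rightarrow> real) \<Rightarrow> nat \<Rightarrow> real" where
  "thresholded k s n \<alpha> \<epsilon> r B x =
     (let a = raw k n r B x / (real n * user_bias \<epsilon>)
      in if \<alpha> / (100 * real s) < a then a else 0)"

definition estimate ::
  "nat \<Rightarrow> nat \<Rightarrow> nat \<Rightarrow> real \<Rightarrow> real \<Rightarrow> (nat \<Rightarrow> nat) \<Rightarrow> (nat \<Rightarrow> real) \<Rightarrow> nat \<Rightarrow> real" where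
  "estimate k s n \<alpha> \<epsilon> r B x =
     (let Q = (\<Sum>z=1..k. thresholded k s n \<alpha> \<epsilon> r B z)
      in if 0 < Q then thresholded k s n \<alpha> \<epsilon> r B x / Q else of_bool (x = 1))"


lemma thresholded_nonneg: "0 \<le> \<alpha> \<Longrightarrow> 0 \<le> thresholded k s n \<alpha> \<epsilon> r B x"
proof -
  assume "0 \<le> \<alpha>"
  then have "0 \<le> \<alpha> / (100 * real s)" by simp
  then show ?thesis by (auto simp: thresholded_def Let_def)
qed

section \<open>Correctness and running time of the server\<close>

definition server_frame ::
  "nat \<Rightarrow> nat \<Rightarrow> nat \<Rightarrow> real \<Rightarrow> real \<Rightarrow> (nat \<Rightarrow> nat) \<Rightarrow> state \<Rightarrow> bool" where
  "server_frame k s n \<alpha> \<epsilon> M \<sigma> \<longleftrightarrow>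
     nreg \<sigma> 1 = s \<and> nreg \<sigma> 2 = n \<and> nreg \<sigma> 7 = 1 \<and> nreg \<sigma> 8 = 0 \<and> nreg \<sigma> 9 = k + 1 \<and>
     rreg \<sigma> 0 = \<alpha> \<and> rreg \<sigma> 1 = \<epsilon> \<and> rreg \<sigma> 2 = 1 \<and> nmem \<sigma> = M"

definition server_memory :: "nat \<Rightarrow> (nat \<Rightarrow> nat) \<Rightarrow> (nat \<Rightarrow> message) \<Rightarrow> nat \<Rightarrow> nat" where
  "server_memory n lab y = array (map lab [0..<n] @ map (\<lambda>i. of_bool (y i = [True])) [0..<n])"

lemma server_memory:
  assumes "i < n"
  shows "server_memory n lab y i = lab i" "server_memory n lab y (n + i) = of_bool (y i = [True])"
  using assms by (simp_all add: server_memory_def array_def nth_append)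

text \<open>Total on messages: whatever is not \<open>[True]\<close> counts as -1, in agreement with
  the 0 that the server's memory holds for it.\<close>

definition sign_of :: "message \<Rightarrow> real" where
  "sign_of m = (if m = [True] then 1 else - 1)"

lemma runs_server_setup:
  fixes n lab y
  defines "M \<equiv> server_memory n lab y"
  shows "runs (Seq server_setup (While (NLess 3 9) (Do (NAdd 3 3 3)))) (7 + (bitlen k * (1 + 1) + 1))
    (server_input k s n \<alpha> \<epsilon> lab y)
    (\<lambda>\<tau>. server_frame k s n \<alpha> \<epsilon> M \<tau> \<and> nreg \<tau> 3 = 2 ^ bitlen k \<and> nreg \<tau> 4 = 0 \<and>
       nreg \<tau> 10 = 1 \<and> rmem \<tau> = (\<lambda>_. 0))" (is "runs _ _ _ ?Q")
proof -
  define I where "I i \<sigma> \<longleftrightarrow> server_frame k s n \<alpha> \<epsilon> M \<sigma> \<and> nreg \<sigma> 3 = 2 ^ i \<and> nreg \<sigma> 4 = 0 \<and>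
       nreg \<sigma> 10 = 1 \<and> rmem \<sigma> = (\<lambda>_. 0)" for i and \<sigma> :: state
  have 1: "runs server_setup 7 (server_input k s n \<alpha> \<epsilon> lab y) (I 0)"
    by (rule runs_loop_free)
      (simp_all add: server_setup_def server_input_def array_def I_def server_frame_def M_def
        server_memory_def)
  have 2: "runs (While (NLess 3 9) (Do (NAdd 3 3 3))) (bitlen k * (1 + 1) + 1) \<sigma> ?Q" if "I 0 \<sigma>" for \<sigma>
  proof (rule runs_While[where I = I, OF that])
    fix i \<tau> assume i: "i < bitlen k" and I: "I i \<tau>"
    have "I (Suc i) (run (Do (NAdd 3 3 3)) \<tau>)" using I by (simp add: I_def server_frame_def)
    then have "runs (Do (NAdd 3 3 3)) 1 \<tau> (I (Suc i))" by (rule runs_loop_free[rotated 2]) simp_all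
    then show "holds (NLess 3 9) \<tau> \<and> runs (Do (NAdd 3 3 3)) 1 \<tau> (I (Suc i))"
      using I not_bitlen[OF i] by (simp add: I_def server_frame_def)
  next
    fix \<tau> assume "I (bitlen k) \<tau>"
    then show "\<not> holds (NLess 3 9) \<tau> \<and> ?Q \<tau>"
      using bitlen[of k] by (simp add: I_def server_frame_def)
  qed
  show ?thesis by (rule runs_Seq[OF 1 2])
qed

lemma runs_server_count:
  fixes n lab y
  defines "M \<equiv> server_memory n lab y"
  assumes "server_frame k s n \<alpha> \<epsilon> M \<sigma>" "nreg \<sigma> 3 = K" "nreg \<sigma> 4 = 0" "nreg \<sigma> 10 = 1"
    "rmem \<sigma> = (\<lambda>_. 0)"
  shows "runs (While (NLess 4 2) server_count) (n * (8 + 1) + 1) \<sigma>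
    (\<lambda>\<tau>. server_frame k s n \<alpha> \<epsilon> M \<tau> \<and> nreg \<tau> 3 = K \<and> nreg \<tau> 10 = 1 \<and>
       rmem \<tau> = counts n lab (\<lambda>i. sign_of (y i)))" (is "runs _ _ _ ?Q")
proof -
  define I where "I i \<sigma> \<longleftrightarrow> server_frame k s n \<alpha> \<epsilon> M \<sigma> \<and> nreg \<sigma> 3 = K \<and> nreg \<sigma> 4 = i \<and>
       nreg \<sigma> 10 = 1 \<and> rmem \<sigma> = counts i lab (\<lambda>i. sign_of (y i))" for i and \<sigma> :: state
  have I0: "I 0 \<sigma>" using assms by (simp add: I_def counts_def fun_eq_iff)
  show ?thesis
  proof (rule runs_While[where I = I, OF I0])
    fix i \<tau> assume i: "i < n" and I: "I i \<tau>"
    have c: "counts (Suc i) lab B = (counts i lab B)(lab i := counts i lab B (lab i) + B i)" for B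
      by (rule ext) (simp add: counts_def)
    have "I (Suc i) (run server_count \<tau>)"
    proof (cases "y i = [True]")
      case True
      then show ?thesis using I server_memory[OF i, of lab y]
        by (simp add: I_def server_frame_def server_count_def c M_def sign_of_def)
    next
      case False
      then show ?thesis using I server_memory[OF i, of lab y]
        by (simp add: I_def server_frame_def server_count_def c M_def sign_of_def)
    qed
    then have "runs server_count 8 \<tau> (I (Suc i))"
      by (rule runs_loop_free[rotated 2]) (simp_all add: server_count_def)
    then show "holds (NLess 4 2) \<tau> \<and> runs server_count 8 \<tau> (I (Suc i))"
      using I i by (simp add: I_def server_frame_def)
  next
    fix \<tau> assume "I n \<tau>"
    then show "\<not> holds (NLess 4 2) \<tau> \<and> ?Q \<tau>" by (simp add: I_def server_frame_def)
  qed
qed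

lemma runs_server_level:
  assumes "server_frame k s n \<alpha> \<epsilon> M \<sigma>" "nreg \<sigma> 3 = 2 ^ J" "nreg \<sigma> 10 = 2 ^ d" "d < J"
    "\<And>p. p < 2 ^ J \<Longrightarrow> rmem \<sigma> p = wht d A p"
  shows "runs server_level (3 + ((2 ^ J * (12 + 1) + 1) + 1)) \<sigma>
    (\<lambda>\<tau>. server_frame k s n \<alpha> \<epsilon> M \<tau> \<and> nreg \<tau> 3 = 2 ^ J \<and> nreg \<tau> 10 = 2 ^ Suc d \<and>
       (\<forall>p<2 ^ J. rmem \<tau> p = wht (Suc d) A p))" (is "runs _ _ _ ?Q")
proof -
  define h :: nat where "h = 2 ^ d"
  have h: "0 < h" by (simp add: h_def)
  have hh: "2 ^ Suc d = 2 * h" by (simp add: h_def)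
  define I where "I i \<sigma> \<longleftrightarrow> server_frame k s n \<alpha> \<epsilon> M \<sigma> \<and> nreg \<sigma> 3 = 2 ^ J \<and> nreg \<sigma> 4 = i \<and>
       nreg \<sigma> 5 = i mod (2 * h) \<and> nreg \<sigma> 10 = h \<and> nreg \<sigma> 11 = 2 * h \<and>
       (\<forall>p<2 ^ J. rmem \<sigma> p = partial_level d A i p)" for i and \<sigma> :: state
  have 1: "runs (seqs [Do (NAdd 11 10 10), Do (NConst 4 0), Do (NConst 5 0)]) 3 \<sigma> (I 0)"
    using assms by (intro runs_loop_free)
      (simp_all add: I_def server_frame_def partial_level_0 h_def)
  have 2: "runs (While (NLess 4 3) server_butterfly) (2 ^ J * (12 + 1) + 1) \<sigma> (I (2 ^ J))"
    if "I 0 \<sigma>" for \<sigma>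
  proof (rule runs_While[where I = I, OF that])
    fix i \<tau> assume i: "i < 2 ^ J" and I: "I i \<tau>"
    have m: "Suc i mod (2 * h) = (if Suc (i mod (2 * h)) < 2 * h then Suc (i mod (2 * h)) else 0)"
    proof -
      have "i mod (2 * h) < 2 * h" using h by simp
      then show ?thesis by (simp add: mod_Suc)
    qed
    have "I (Suc i) (run server_butterfly \<tau>)"
    proof (cases "i mod (2 * h) < h")
      case True
      then have T: "i mod 2 ^ Suc d < 2 ^ d" by (simp only: hh h_def[symmetric])
      have ih: "i + h < 2 ^ J" using add_half_less[OF T i assms(4)] by (simp add: h_def)
      note P = partial_level_Suc[OF T, folded h_def, of A]
      show ?thesis using I True i ih h unfolding I_def P m
        by (simp add: server_frame_def server_butterfly_def)
    next
      case False
      then have T: "\<not> i mod 2 ^ Suc d < 2 ^ d" unfolding hh h_def[symmetric] .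
      note P = partial_level_Suc'[OF T, of A]
      show ?thesis using I False unfolding I_def P m
        by (simp add: server_frame_def server_butterfly_def)
    qed
    then have "runs server_butterfly 12 \<tau> (I (Suc i))"
      by (rule runs_loop_free[rotated 2]) (simp_all add: server_butterfly_def)
    then show "holds (NLess 4 3) \<tau> \<and> runs server_butterfly 12 \<tau> (I (Suc i))"
      using I i by (simp add: I_def server_frame_def)
  next
    fix \<tau> assume "I (2 ^ J) \<tau>"
    then show "\<not> holds (NLess 4 3) \<tau> \<and> I (2 ^ J) \<tau>" by (simp add: I_def)
  qed
  have 3: "runs (Do (NMove 10 11)) 1 \<sigma> ?Q" if "I (2 ^ J) \<sigma>" for \<sigma>
    using that by (intro runs_loop_free)
      (simp_all add: I_def server_frame_def partial_level_full h_def)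
  show ?thesis unfolding server_level_def by (rule runs_Seq[OF 1 runs_Seq[OF 2 3]])
qed

lemma runs_server_transform:
  assumes "server_frame k s n \<alpha> \<epsilon> M \<sigma>" "nreg \<sigma> 3 = 2 ^ J" "nreg \<sigma> 10 = 1" "rmem \<sigma> = A"
  shows "runs (While (NLess 10 3) server_level) (J * ((3 + ((2 ^ J * (12 + 1) + 1) + 1)) + 1) + 1) \<sigma>
    (\<lambda>\<tau>. server_frame k s n \<alpha> \<epsilon> M \<tau> \<and> (\<forall>p<2 ^ J. rmem \<tau> p = wht J A p))" (is "runs _ _ _ ?Q")
proof -
  define I where "I d \<sigma> \<longleftrightarrow> server_frame k s n \<alpha> \<epsilon> M \<sigma> \<and> nreg \<sigma> 3 = 2 ^ J \<and> nreg \<sigma> 10 = 2 ^ d \<and>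
       (\<forall>p<2 ^ J. rmem \<sigma> p = wht d A p)" for d and \<sigma> :: state
  have I0: "I 0 \<sigma>" using assms by (simp add: I_def)
  show ?thesis
  proof (rule runs_While[where I = I, OF I0])
    fix d \<tau> assume d: "d < J" and I: "I d \<tau>"
    have "runs server_level (3 + ((2 ^ J * (12 + 1) + 1) + 1)) \<tau> (I (Suc d))"
      using runs_server_level[of k s n \<alpha> \<epsilon> M \<tau> J d A] d I unfolding I_def by blast
    moreover have "holds (NLess 10 3) \<tau>" using I d by (simp add: I_def)
    ultimately show "holds (NLess 10 3) \<tau> \<and>
        runs server_level (3 + ((2 ^ J * (12 + 1) + 1) + 1)) \<tau> (I (Suc d))" by blast
  next
    fix \<tau> assume "I J \<tau>"
    then show "\<not> holds (NLess 10 3) \<tau> \<and> ?Q \<tau>" by (simp add: I_def)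
  qed
qed

lemma runs_server_output:
  assumes "server_frame k s n \<alpha> \<epsilon> M \<sigma>" "1 \<le> k"
    and raw: "\<And>x. x \<in> {1..k} \<Longrightarrow> rmem \<sigma> x = raw k n r B x"
    and "0 \<le> \<alpha>"
  shows "runs (Seq server_scale (Seq (While (NLess 4 9) server_threshold) server_normalize))
    (14 + ((k * (6 + 1) + 1) + Suc (1 + (k * (4 + 1) + 1)))) \<sigma>
    (\<lambda>\<tau>. \<forall>x\<in>{1..k}. rmem \<tau> x = estimate k s n \<alpha> \<epsilon> r B x)" (is "runs _ _ _ ?Q")
proof -
  let ?q = "thresholded k s n \<alpha> \<epsilon> r B"
  let ?S = "\<Sum>z=1..k. ?q z"
  define I where "I i \<sigma> \<longleftrightarrow> nreg \<sigma> 4 = Suc i \<and> nreg \<sigma> 7 = 1 \<and> nreg \<sigma> 8 = 0 \<and> nreg \<sigma> 9 = k + 1 \<and>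
      rreg \<sigma> 2 = 1 \<and> rreg \<sigma> 7 = real n * user_bias \<epsilon> \<and> rreg \<sigma> 8 = \<alpha> / (100 * real s) \<and>
      rreg \<sigma> 9 = (\<Sum>z=1..i. ?q z) \<and> rreg \<sigma> 10 = 0 \<and>
      (\<forall>x\<in>{1..k}. rmem \<sigma> x = (if x \<le> i then ?q x else raw k n r B x))" for i and \<sigma> :: state
  define I' where "I' i \<sigma> \<longleftrightarrow> nreg \<sigma> 4 = Suc i \<and> nreg \<sigma> 7 = 1 \<and> nreg \<sigma> 9 = k + 1 \<and>
      rreg \<sigma> 9 = ?S \<and>
      (\<forall>x\<in>{1..k}. rmem \<sigma> x = (if x \<le> i then ?q x / ?S else ?q x))" for i and \<sigma> :: state
  have 1: "runs server_scale 14 \<sigma> (I 0)"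
    using assms by (intro runs_loop_free)
      (simp_all add: server_scale_def I_def server_frame_def user_bias_def)
  have 2: "runs (While (NLess 4 9) server_threshold) (k * (6 + 1) + 1) \<sigma> (I k)" if "I 0 \<sigma>" for \<sigma>
  proof (rule runs_While[where I = I, OF that])
    fix i \<tau> assume i: "i < k" and I: "I i \<tau>"
    have r: "rmem \<tau> (Suc i) = raw k n r B (Suc i)" using I i by (simp add: I_def)
    have q: "?q (Suc i) = (if \<alpha> / (100 * real s) < rmem \<tau> (Suc i) / (real n * user_bias \<epsilon>)
        then rmem \<tau> (Suc i) / (real n * user_bias \<epsilon>) else 0)"
      by (simp add: thresholded_def r)
    have "I (Suc i) (run server_threshold \<tau>)"
    proof (cases "\<alpha> / (100 * real s) < rmem \<tau> (Suc i) / (real n * user_bias \<epsilon>)")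
      case True
      then show ?thesis using I q by (auto simp: I_def server_threshold_def)
    next
      case False
      then show ?thesis using I q by (auto simp: I_def server_threshold_def)
    qed
    then have "runs server_threshold 6 \<tau> (I (Suc i))"
      by (rule runs_loop_free[rotated 2]) (simp_all add: server_threshold_def)
    then show "holds (NLess 4 9) \<tau> \<and> runs server_threshold 6 \<tau> (I (Suc i))"
      using I i by (simp add: I_def)
  next
    fix \<tau> assume "I k \<tau>"
    then show "\<not> holds (NLess 4 9) \<tau> \<and> I k \<tau>" by (simp add: I_def)
  qed
  have 3: "runs (While (NLess 4 9) server_divide) (k * (4 + 1) + 1) \<sigma> ?Q"
    if "I' 0 \<sigma>" and S: "0 < ?S" for \<sigma>
  proof (rule runs_While[where I = I', OF that(1)])
    fix i \<tau> assume i: "i < k" and I: "I' i \<tau>"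
    have "rmem \<tau> (Suc i) = ?q (Suc i)" using I i by (simp add: I'_def)
    then have "I' (Suc i) (run server_divide \<tau>)"
      using I by (auto simp: I'_def server_divide_def)
    then have "runs server_divide 4 \<tau> (I' (Suc i))"
      by (rule runs_loop_free[rotated 2]) (simp_all add: server_divide_def)
    then show "holds (NLess 4 9) \<tau> \<and> runs server_divide 4 \<tau> (I' (Suc i))"
      using I i by (simp add: I'_def)
  next
    fix \<tau> assume "I' k \<tau>"
    then show "\<not> holds (NLess 4 9) \<tau> \<and> ?Q \<tau>"
      using S by (simp add: I'_def estimate_def)
  qed
  have 4: "runs server_normalize (Suc (1 + (k * (4 + 1) + 1))) \<tau> ?Q" if I: "I k \<tau>" for \<tau>
    unfolding server_normalize_def
  proof (rule runs_Cond)
    assume "holds (RLess 10 9) \<tau>"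
    then have S: "0 < ?S" using I by (simp add: I_def)
    have 5: "runs (Do (NMove 4 7)) 1 \<tau> (I' 0)"
      using I by (intro runs_loop_free) (simp_all add: I_def I'_def)
    show "runs (Seq (Do (NMove 4 7)) (While (NLess 4 9) server_divide)) (1 + (k * (4 + 1) + 1)) \<tau> ?Q"
      by (rule runs_Seq[OF 5 3[OF _ S]])
  next
    assume "\<not> holds (RLess 10 9) \<tau>"
    then have S: "?S \<le> 0" using I by (simp add: I_def)
    have nn: "0 \<le> ?q z" for z using assms(4) by (rule thresholded_nonneg)
    then have "?S = 0" using S sum_nonneg[of "{1..k}" ?q] by force
    then have "\<forall>z\<in>{1..k}. ?q z = 0" using nn by (simp add: sum_nonneg_eq_0_iff)
    then show "runs (Do (RStore 7 2)) (1 + (k * (4 + 1) + 1)) \<tau> ?Q"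
      using I S by (intro runs_loop_free) (auto simp: I_def estimate_def)
  qed
  show ?thesis by (rule runs_Seq[OF 1 runs_Seq[OF 2 4]])
qed


lemma runs_server_program:
  assumes "1 \<le> k" "0 \<le> \<alpha>" and lab: "\<And>i. i < n \<Longrightarrow> lab i < 2 ^ bitlen k"
  shows "runs server_program (50 + 9 * n + 12 * k + 30 * 2 ^ bitlen k * bitlen k)
    (server_input k s n \<alpha> \<epsilon> lab y)
    (\<lambda>\<tau>. \<forall>x\<in>{1..k}. rmem \<tau> x = estimate k s n \<alpha> \<epsilon> lab (\<lambda>i. sign_of (y i)) x)"
proof -
  let ?M = "server_memory n lab y" and ?J = "bitlen k" and ?B = "\<lambda>i. sign_of (y i)"
  have k: "x < 2 ^ ?J" if "x \<in> {1..k}" for x using that bitlen[of k] by simp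
  have "runs server_program
     ((7 + (?J * (1 + 1) + 1)) + ((n * (8 + 1) + 1) +
       ((?J * ((3 + ((2 ^ ?J * (12 + 1) + 1) + 1)) + 1) + 1) +
         (14 + ((k * (6 + 1) + 1) + Suc (1 + (k * (4 + 1) + 1)))))))
     (server_input k s n \<alpha> \<epsilon> lab y)
     (\<lambda>\<tau>. \<forall>x\<in>{1..k}. rmem \<tau> x = estimate k s n \<alpha> \<epsilon> lab ?B x)"
    unfolding server_program_def
    apply (rule runs_Seq[OF runs_server_setup])
    apply (elim conjE)
    apply (rule runs_Seq[OF runs_server_count], assumption+)
    apply (elim conjE)
    apply (rule runs_Seq[OF runs_server_transform], assumption+)
    apply (elim conjE)
    apply (rule runs_server_output, assumption, rule assms)
     apply (use k lab in \<open>simp add: wht_counts\<close>)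
    apply (rule assms)
    done
  moreover have "((7 + (?J * (1 + 1) + 1)) + ((n * (8 + 1) + 1) +
       ((?J * ((3 + ((2 ^ ?J * (12 + 1) + 1) + 1)) + 1) + 1) +
         (14 + ((k * (6 + 1) + 1) + Suc (1 + (k * (4 + 1) + 1)))))))
       \<le> 50 + 9 * n + 12 * k + 30 * 2 ^ ?J * ?J"
  proof -
    \<comment> \<open>Writing the power as a successor lets the product with \<open>?J\<close>
      absorb the terms that are linear in \<open>?J\<close>.\<close>
    obtain c :: nat where "2 ^ ?J = Suc c" using gr0_implies_Suc[of "2 ^ ?J"] by auto
    then show ?thesis by (simp only:) (simp add: algebra_simps)
  qed
  ultimately show ?thesis by (rule runs_mono)
qed


section \<open>The private channels\<close>

definition user_channel :: "nat \<Rightarrow> real \<Rightarrow> nat \<Rightarrow> channel" where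
  "user_channel k \<epsilon> r x =
     map_pmf (\<lambda>b. [b]) (bernoulli_pmf ((1 + user_bias \<epsilon> * had (bitlen k) r x) / 2))"

lemma user_bias_bounds:
  assumes "0 < \<epsilon>"
  shows "0 < user_bias \<epsilon>" "user_bias \<epsilon> < 1" "1 + user_bias \<epsilon> = (1 + \<epsilon>) * (1 - user_bias \<epsilon>)"
  using assms by (simp_all add: user_bias_def field_simps)

lemma user_prob_bounds:
  assumes "0 < \<epsilon>"
  shows "(1 + user_bias \<epsilon> * had d r x) / 2 \<in> {0..1}"
  using user_bias_bounds[OF assms] had_cases[of d r x] by auto

lemma pmf_user_channel:
  assumes "0 < \<epsilon>"
  shows "pmf (user_channel k \<epsilon> r x) [b] =
    (1 + (if b then 1 else - 1) * user_bias \<epsilon> * had (bitlen k) r x) / 2"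
proof -
  have "pmf (user_channel k \<epsilon> r x) [b] =
      pmf (bernoulli_pmf ((1 + user_bias \<epsilon> * had (bitlen k) r x) / 2)) b"
    unfolding user_channel_def by (rule pmf_map_inj') (simp add: inj_on_def)
  then show ?thesis using user_prob_bounds[OF assms, of "bitlen k" r x]
    by (cases b) (simp_all add: field_simps)
qed

lemma set_user_channel: "set_pmf (user_channel k \<epsilon> r x) \<subseteq> {[False], [True]}"
proof -
  have "[b] \<in> {[False], [True]}" for b by (cases b) simp_all
  then show ?thesis unfolding user_channel_def by auto
qed

lemma one_bit_user_channel: "one_bit k (user_channel k \<epsilon> r)"
  using set_user_channel by (simp add: one_bit_def)

lemma user_channel_ldp:
  assumes "0 < \<epsilon>"
  shows "user_channel k \<epsilon> r \<in> ldp_channels k \<epsilon>"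
  unfolding ldp_channels_def
proof (intro CollectI allI ballI)
  fix y x x'
  let ?d = "user_bias \<epsilon>"
  note d = user_bias_bounds[OF assms]
  show "pmf (user_channel k \<epsilon> r x) y \<le> exp \<epsilon> * pmf (user_channel k \<epsilon> r x') y"
  proof (cases "y \<in> {[False], [True]}")
    case True
    then obtain b where y: "y = [b]" by auto
    have e: "1 + \<epsilon> \<le> exp \<epsilon>" by (rule exp_ge_add_one_self)
    have "1 + ?d \<le> exp \<epsilon> * (1 - ?d)"
      unfolding d(3) using d e by (intro mult_right_mono) auto
    define a where "a z = 1 + (if b then 1 else - 1) * ?d * had (bitlen k) r z" for z
    have a: "a z \<le> 1 + ?d" "1 - ?d \<le> a z" for z
      using had_cases[of "bitlen k" r z] d(1,2) by (auto simp: a_def)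
    have "a x \<le> 1 + ?d" by (rule a)
    also have "\<dots> \<le> exp \<epsilon> * (1 - ?d)" by fact
    also have "\<dots> \<le> exp \<epsilon> * a x'" using a by (intro mult_left_mono) auto
    finally show ?thesis unfolding y pmf_user_channel[OF assms] a_def by simp
  next
    case False
    then have "pmf (user_channel k \<epsilon> r z) y = 0" for z
      using set_user_channel by (metis pmf_eq_0_set_pmf subsetD)
    then show ?thesis by simp
  qed
qed

lemma implements_user_channel:
  assumes "0 < \<epsilon>"
  shows "implements_channel user_program k s n \<alpha> \<epsilon> l (user_channel k \<epsilon> l) (20 + 14 * bitlen k)"
  unfolding implements_channel_def
proof
  fix x assume "x \<in> {1..k}"
  let ?c = "(1 + user_bias \<epsilon> * had (bitlen k) l x) / 2"
  let ?out = "\<lambda>v. v < ?c"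
  have c: "0 \<le> ?c" "?c \<le> 1" using user_prob_bounds[OF assms, of "bitlen k" l x] by simp_all
  have T: "{v \<in> {0..1}. ?out v} = {0..<?c}" using c by auto
  have F: "{v \<in> {0..1}. \<not> ?out v} = {?c..1}" using c by auto
  show "\<exists>out. (\<forall>v\<in>{0..1}. \<exists>t'\<le>20 + 14 * bitlen k. \<exists>\<tau>.
              exec user_program (user_input k s n \<alpha> \<epsilon> l x v) t' \<tau> \<and> nreg \<tau> 0 = of_bool (out v)) \<and>
           {v \<in> {0..1}. out v} \<in> sets lborel \<and>
           (\<forall>b. pmf (user_channel k \<epsilon> l x) [b] = measure lborel {v \<in> {0..1}. out v = b})"
  proof (intro exI[of _ ?out] conjI ballI allI)
    fix v :: real
    show "\<exists>t'\<le>20 + 14 * bitlen k. \<exists>\<tau>.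
              exec user_program (user_input k s n \<alpha> \<epsilon> l x v) t' \<tau> \<and> nreg \<tau> 0 = of_bool (?out v)"
      using runs_user_program[of k s n \<alpha> \<epsilon> l x v] unfolding runs_def .
  next
    show "{v \<in> {0..1}. ?out v} \<in> sets lborel" unfolding T by simp
  next
    fix b
    show "pmf (user_channel k \<epsilon> l x) [b] = measure lborel {v \<in> {0..1}. ?out v = b}"
    proof (cases b)
      case True
      then have "{v \<in> {0..1}. ?out v = b} = {0..<?c}" using T by simp
      then show ?thesis using c True unfolding pmf_user_channel[OF assms] by simp
    next
      case False
      then have "{v \<in> {0..1}. ?out v = b} = {?c..1}" using F by simp
      then show ?thesis using c False unfolding pmf_user_channel[OF assms] by (simp add: field_simps)
    qed
  qed
qed


section \<open>Moments of the noise\<close>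

text \<open>Hoeffding's lemma for an interval of length 2, where
  \<open>2\<^sup>2 / 8 = 1 / 2\<close>. Negative \<open>l\<close> is reduced to positive by passing
  to \<open>- f\<close>.\<close>

lemma hoeffding_mgf:
  fixes f :: "'a \<Rightarrow> real"
  assumes "finite (set_pmf D)" "\<And>y. \<bar>f y\<bar> \<le> 1"
  shows "measure_pmf.expectation D (\<lambda>y. exp (l * (f y - measure_pmf.expectation D f))) \<le> exp (l\<^sup>2 / 2)"
proof -
  have pos: "measure_pmf.expectation D (\<lambda>y. exp (l * (g y - measure_pmf.expectation D g))) \<le> exp (l\<^sup>2 / 2)"
    if l: "l > 0" and g: "\<And>y. \<bar>g y\<bar> \<le> 1" for l and g :: "'a \<Rightarrow> real"
  proof -
    interpret g: interval_bounded_random_variable "measure_pmf D" g "- 1" 1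
      using g by unfold_locales (auto simp: abs_le_iff minus_le_iff intro!: AE_pmfI)
    have "ennreal (measure_pmf.expectation D (\<lambda>y. exp (l * (g y - measure_pmf.expectation D g))))
        = (\<integral>\<^sup>+ y. exp (l * (g y - measure_pmf.expectation D g)) \<partial>measure_pmf D)"
      by (rule nn_integral_eq_integral[symmetric])
        (auto intro: integrable_measure_pmf_finite assms)
    also have "\<dots> \<le> ennreal (exp (l\<^sup>2 * (1 - - 1)\<^sup>2 / 8))"
      by (rule g.Hoeffdings_lemma_nn_integral[OF l])
    finally show ?thesis by (simp add: ennreal_le_iff)
  qed
  consider "l > 0" | "l = 0" | "- l > 0" by linarith
  then show ?thesis
  proof cases
    case 3
    from pos[OF 3, of "\<lambda>y. - f y"] assms show ?thesis by (simp add: algebra_simps)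
  qed (use pos[of l f] assms in auto)
qed

lemma expectation_user_message:
  fixes f :: "message \<Rightarrow> real"
  assumes "set_pmf p \<subseteq> {1..k}"
  shows "measure_pmf.expectation (bind_pmf p (user_channel k \<epsilon> r)) f =
    (\<Sum>x=1..k. pmf p x * measure_pmf.expectation (user_channel k \<epsilon> r x) f)"
proof -
  have "finite (set_pmf (user_channel k \<epsilon> r x))" for x
    using finite_subset[OF set_user_channel] by blast
  from pmf_expectation_bind[where f = "user_channel k \<epsilon> r" and h = f, OF _ this assms] show ?thesis by simp
qed

lemma mean_user_message:
  assumes "set_pmf p \<subseteq> {1..k}" "0 < \<epsilon>"
  shows "measure_pmf.expectation (bind_pmf p (user_channel k \<epsilon> r)) sign_of =
    user_bias \<epsilon> * (\<Sum>x=1..k. pmf p x * had (bitlen k) r x)"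
proof -
  have "measure_pmf.expectation (user_channel k \<epsilon> r x) sign_of = user_bias \<epsilon> * had (bitlen k) r x" for x
    unfolding user_channel_def using user_prob_bounds[OF assms(2), of "bitlen k" r x]
    by (simp add: sign_of_def field_simps)
  then show ?thesis unfolding expectation_user_message[OF assms(1)]
    by (simp add: sum_distrib_left algebra_simps)
qed

lemma finite_user_message: "finite (set_pmf (bind_pmf p (user_channel k \<epsilon> r)))"
proof (rule finite_subset)
  show "set_pmf (bind_pmf p (user_channel k \<epsilon> r)) \<subseteq> {[False], [True]}"
    using set_user_channel by (simp add: UN_subset_iff)
qed simp

lemma finite_transcript:
  "finite (set_pmf (transcript n (\<lambda>i. user_channel k \<epsilon> (r i)) p))"
proof -
  have "finite (set_pmf (bind_pmf p (user_channel k \<epsilon> (r i))))" for i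
    by (rule finite_user_message)
  then show ?thesis unfolding transcript_def by (subst set_Pi_pmf) auto
qed

text \<open>The deviation of the raw estimate from its own mean, not from \<open>p x\<close>. The
  gap between those two is the bias caused by the coherence of the rows.\<close>

definition noise :: "nat \<Rightarrow> real \<Rightarrow> nat \<Rightarrow> (nat \<Rightarrow> nat) \<Rightarrow> nat pmf \<Rightarrow> (nat \<Rightarrow> message) \<Rightarrow> nat \<Rightarrow> real" where
  "noise k \<epsilon> n r p y x = (\<Sum>i<n. (sign_of (y i) -
      measure_pmf.expectation (bind_pmf p (user_channel k \<epsilon> (r i))) sign_of) * had (bitlen k) (r i) x) /
      (real n * user_bias \<epsilon>)"

text \<open>The matrix entries are 1 or -1, so every user has the same weight up to sign, and the
  variance proxy does not depend on the rows or on \<open>x\<close>.\<close>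

lemma noise_mgf:
  fixes l :: real
  assumes "0 < \<epsilon>" "0 < n"
  shows "measure_pmf.expectation (transcript n (\<lambda>i. user_channel k \<epsilon> (r i)) p)
      (\<lambda>y. exp (l * noise k \<epsilon> n r p y x)) \<le> exp (l\<^sup>2 / (2 * (real n * (user_bias \<epsilon>)\<^sup>2)))"
proof -
  let ?D = "\<lambda>i. bind_pmf p (user_channel k \<epsilon> (r i))"
  let ?mu = "\<lambda>i. measure_pmf.expectation (?D i) sign_of"
  define b where "b = user_bias \<epsilon>"
  have b: "b > 0" using user_bias_bounds[OF assms(1)] by (simp add: b_def)
  define c where "c i = l * had (bitlen k) (r i) x / (real n * b)" for i
  have fin: "finite (set_pmf (?D i))" for i
    by (rule finite_user_message)
  have c2: "(c i)\<^sup>2 = l\<^sup>2 / (real n * b)\<^sup>2" for i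
    using had_cases[of "bitlen k" "r i" x] by (auto simp: c_def power_divide)
  have "measure_pmf.expectation (transcript n (\<lambda>i. user_channel k \<epsilon> (r i)) p)
      (\<lambda>y. exp (l * noise k \<epsilon> n r p y x)) =
    measure_pmf.expectation (transcript n (\<lambda>i. user_channel k \<epsilon> (r i)) p)
      (\<lambda>y. \<Prod>i<n. exp (c i * (sign_of (y i) - ?mu i)))"
    by (simp add: noise_def exp_sum[symmetric] c_def b_def sum_distrib_left sum_divide_distrib
        mult_ac)
  also have "\<dots> = (\<Prod>i<n. measure_pmf.expectation (?D i) (\<lambda>m. exp (c i * (sign_of m - ?mu i))))"
    unfolding transcript_def using fin
    by (intro expectation_prod_Pi_pmf) (auto intro: integrable_measure_pmf_finite)
  also have "\<dots> \<le> (\<Prod>i<n. exp ((c i)\<^sup>2 / 2))"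
    by (intro prod_mono conjI hoeffding_mgf fin Bochner_Integration.integral_nonneg)
      (auto simp: sign_of_def)
  also have "\<dots> = exp (real n * (l\<^sup>2 / (real n * b)\<^sup>2 / 2))"
    by (simp add: c2 exp_of_nat_mult[symmetric])
  also have "real n * (l\<^sup>2 / (real n * b)\<^sup>2 / 2) = l\<^sup>2 / (2 * (real n * b\<^sup>2))"
    using assms(2) b by (simp add: field_simps power2_eq_square)
  finally show ?thesis by (simp add: b_def)
qed

text \<open>It replaces the integration of a tail: beyond \<open>t\<close>, the size of the noise is
  dominated by an exponential whose mean is known.\<close>

lemma mult_exp_tail_bound:
  fixes t u l :: real
  assumes "0 < t" "1 \<le> l * t" "t < u"
  shows "u \<le> t * exp (l * (u - t))"
proof -
  have "u / t = 1 + (u - t) / t" using assms by (simp add: field_simps)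
  also have "\<dots> \<le> exp ((u - t) / t)" by (rule exp_ge_add_one_self)
  also have "(u - t) / t \<le> l * (u - t)"
  proof -
    have "1 * (u - t) \<le> l * t * (u - t)" using assms by (intro mult_right_mono) auto
    then show ?thesis using assms by (simp add: field_simps)
  qed
  finally show ?thesis using assms by (simp add: field_simps)
qed

lemma abs_le_exp_sum:
  fixes t u :: real
  assumes "0 < t"
  shows "\<bar>u\<bar> \<le> t * (exp (1 / t * u) + exp (- 1 / t * u))"
proof -
  have 1: "\<bar>v\<bar> \<le> exp v + exp (- v)" for v :: real
    using exp_ge_add_one_self[of v] exp_ge_add_one_self[of "- v"] exp_gt_zero[of v]
      exp_gt_zero[of "- v"] by linarith
  have "\<bar>u\<bar> = t * \<bar>u / t\<bar>" using assms by simp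
  also have "\<dots> \<le> t * (exp (u / t) + exp (- (u / t)))"
    using 1[of "u / t"] assms by (intro mult_left_mono) auto
  finally show ?thesis by simp
qed


section \<open>Accuracy of the estimator\<close>

text \<open>The mean of the raw estimate at \<open>x\<close> is the sum of \<open>p z\<close> times
  the normalized inner product of the columns \<open>x\<close> and \<open>z\<close>. The term
  \<open>z = x\<close> is exactly \<open>p x\<close>; the others are damped by the coherence
  \<open>t\<close>, and their weights sum to at most 1.\<close>

lemma raw_decomposition:
  assumes p: "set_pmf p \<subseteq> {1..k}" and "0 < \<epsilon>" "0 < n" and x: "x \<in> {1..k}"
    and coh: "\<And>x'. x' \<in> {1..k} \<Longrightarrow> x' \<noteq> x \<Longrightarrow>
      \<bar>\<Sum>i<n. had (bitlen k) (r i) x * had (bitlen k) (r i) x'\<bar> \<le> real n * t" and "0 \<le> t"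
  shows "\<bar>raw k n r (\<lambda>i. sign_of (y i)) x / (real n * user_bias \<epsilon>) - noise k \<epsilon> n r p y x - pmf p x\<bar> \<le> t"
proof -
  let ?h = "\<lambda>i z. had (bitlen k) (r i) z"
  have b: "user_bias \<epsilon> > 0" using user_bias_bounds assms(2) by blast
  have "raw k n r (\<lambda>i. sign_of (y i)) x / (real n * user_bias \<epsilon>) - noise k \<epsilon> n r p y x
      = (\<Sum>i<n. user_bias \<epsilon> * (\<Sum>z=1..k. pmf p z * ?h i z) * ?h i x) / (real n * user_bias \<epsilon>)"
    unfolding noise_def raw_def mean_user_message[OF p assms(2)] diff_divide_distrib[symmetric]
      sum_subtractf[symmetric] by (simp add: algebra_simps)
  also have "\<dots> = (\<Sum>i<n. (\<Sum>z=1..k. pmf p z * ?h i z) * ?h i x) / real n"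
    using b by (simp add: mult.assoc sum_distrib_left[symmetric])
  also have "\<dots> = (\<Sum>z=1..k. pmf p z * ((\<Sum>i<n. ?h i x * ?h i z) / real n))"
    by (simp add: sum_distrib_left sum_distrib_right sum_divide_distrib mult_ac) (rule sum.swap)
  also have "\<dots> = pmf p x * ((\<Sum>i<n. ?h i x * ?h i x) / real n) +
      (\<Sum>z\<in>{1..k} - {x}. pmf p z * ((\<Sum>i<n. ?h i x * ?h i z) / real n))"
    using x by (simp add: sum.remove)
  also have "(\<Sum>i<n. ?h i x * ?h i x) = real n"
  proof -
    have "?h i x * ?h i x = 1" for i using had_cases[of "bitlen k" "r i" x] by auto
    then show ?thesis by simp
  qed
  finally have "\<bar>raw k n r (\<lambda>i. sign_of (y i)) x / (real n * user_bias \<epsilon>) - noise k \<epsilon> n r p y x - pmf p x\<bar>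
     = \<bar>\<Sum>z\<in>{1..k} - {x}. pmf p z * ((\<Sum>i<n. ?h i x * ?h i z) / real n)\<bar>"
    using assms(3) by simp
  also have "\<dots> \<le> (\<Sum>z\<in>{1..k} - {x}. \<bar>pmf p z * ((\<Sum>i<n. ?h i x * ?h i z) / real n)\<bar>)"
    by (rule sum_abs)
  also have "\<dots> \<le> (\<Sum>z\<in>{1..k} - {x}. pmf p z * t)"
  proof (intro sum_mono)
    fix z assume z: "z \<in> {1..k} - {x}"
    have "\<bar>(\<Sum>i<n. ?h i x * ?h i z) / real n\<bar> \<le> t"
      using coh[of z] z assms(3) by (simp add: field_simps)
    then show "\<bar>pmf p z * ((\<Sum>i<n. ?h i x * ?h i z) / real n)\<bar> \<le> pmf p z * t"
      unfolding abs_mult by (intro mult_mono) auto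
  qed
  also have "\<dots> = t * (\<Sum>z\<in>{1..k} - {x}. pmf p z)" by (simp add: sum_distrib_left mult.commute)
  also have "\<dots> \<le> t * 1"
  proof (rule mult_left_mono[OF _ assms(6)])
    have "(\<Sum>z\<in>{1..k} - {x}. pmf p z) = measure_pmf.prob p ({1..k} - {x})"
      by (simp add: measure_measure_pmf_finite)
    then show "(\<Sum>z\<in>{1..k} - {x}. pmf p z) \<le> 1" by simp
  qed
  finally show ?thesis by simp
qed

text \<open>Where \<open>p = 0\<close>, an entry above \<open>2 * t\<close> forces
  \<open>u > t\<close>, and then \<open>a \<le> u + t \<le> 2 * u\<close>. So the error there is a
  tail of the noise, whereas on the support a constant multiple of \<open>t\<close> is
  affordable.\<close>

lemma threshold_error:
  fixes a u p t l :: real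
  assumes "\<bar>a - u - p\<bar> \<le> t" "0 \<le> p" "0 < t" "1 \<le> l * t"
  defines "q \<equiv> (if 2 * t < a then a else 0)"
  shows "\<bar>q - p\<bar> \<le> 3 * t + \<bar>u\<bar>"
    and "p = 0 \<Longrightarrow> \<bar>q - p\<bar> \<le> 2 * (t * exp (l * (u - t)))"
proof -
  show "\<bar>q - p\<bar> \<le> 3 * t + \<bar>u\<bar>" using assms by (auto simp: q_def abs_if split: if_splits)
  assume p: "p = 0"
  show "\<bar>q - p\<bar> \<le> 2 * (t * exp (l * (u - t)))"
  proof (cases "2 * t < a")
    case True
    then have u: "t < u" using assms p by (auto simp: abs_if split: if_splits)
    then have "a \<le> 2 * u" using assms p by (auto simp: abs_if split: if_splits)
    also have "\<dots> \<le> 2 * (t * exp (l * (u - t)))"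
      using mult_exp_tail_bound[OF assms(3,4) u] by simp
    finally show ?thesis using True p assms(3) by (simp add: q_def)
  next
    case False
    then show ?thesis using p assms(3) by (simp add: q_def)
  qed
qed

definition estimator ::
  "nat \<Rightarrow> nat \<Rightarrow> nat \<Rightarrow> real \<Rightarrow> real \<Rightarrow> (nat \<Rightarrow> nat) \<Rightarrow> (nat \<Rightarrow> message) \<Rightarrow> nat pmf" where
  "estimator k s n \<alpha> \<epsilon> r y = embed_pmf (\<lambda>x. if x \<in> {1..k} then
     estimate k s n \<alpha> \<epsilon> r (\<lambda>i. sign_of (y i)) x else 0)"

lemma estimate_nonneg: "0 \<le> \<alpha> \<Longrightarrow> 0 \<le> estimate k s n \<alpha> \<epsilon> r B x"
  by (auto simp: estimate_def Let_def thresholded_nonneg)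

lemma sum_estimate: "1 \<le> k \<Longrightarrow> (\<Sum>x=1..k. estimate k s n \<alpha> \<epsilon> r B x) = 1"
proof (cases "0 < (\<Sum>z=1..k. thresholded k s n \<alpha> \<epsilon> r B z)")
  case True
  then show ?thesis by (simp add: estimate_def Let_def sum_divide_distrib[symmetric])
next
  case False
  assume "1 \<le> k"
  then show ?thesis using False by (simp add: estimate_def Let_def sum.delta)
qed

lemma pmf_estimator:
  assumes "1 \<le> k" "0 \<le> \<alpha>"
  shows "pmf (estimator k s n \<alpha> \<epsilon> r y) x =
    (if x \<in> {1..k} then estimate k s n \<alpha> \<epsilon> r (\<lambda>i. sign_of (y i)) x else 0)"
  unfolding estimator_def
proof (rule pmf_embed_pmf)
  let ?e = "estimate k s n \<alpha> \<epsilon> r (\<lambda>i. sign_of (y i))"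
  show "0 \<le> (if x \<in> {1..k} then ?e x else 0)" for x using estimate_nonneg[OF assms(2)] by simp
  have "(\<integral>\<^sup>+ x. ennreal (if x \<in> {1..k} then ?e x else 0) \<partial>count_space UNIV) =
      (\<Sum>x\<in>{1..k}. ennreal (if x \<in> {1..k} then ?e x else 0))"
    by (rule nn_integral_count_space') auto
  also have "\<dots> = ennreal (\<Sum>x=1..k. ?e x)"
    using estimate_nonneg[OF assms(2)] by (simp add: sum_ennreal)
  finally show "(\<integral>\<^sup>+ x. ennreal (if x \<in> {1..k} then ?e x else 0) \<partial>count_space UNIV) = 1"
    using sum_estimate[OF assms(1)] by simp
qed

lemma estimator_in_prob_simplex:
  assumes "1 \<le> k" "0 \<le> \<alpha>"
  shows "estimator k s n \<alpha> \<epsilon> r y \<in> prob_simplex k"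
  using assms by (auto simp: prob_simplex_def set_pmf_iff pmf_estimator split: if_splits)

text \<open>Normalizing moves the vector by at most its distance from the simplex.\<close>

lemma tv_dist_estimator:
  assumes "1 \<le> k" "0 \<le> \<alpha>" and p: "set_pmf p \<subseteq> {1..k}"
    and err: "(\<Sum>x=1..k. \<bar>thresholded k s n \<alpha> \<epsilon> r (\<lambda>i. sign_of (y i)) x - pmf p x\<bar>) \<le> \<beta>" and "\<beta> < 1"
  shows "tv_dist k p (estimator k s n \<alpha> \<epsilon> r y) \<le> \<beta>"
proof -
  let ?q = "thresholded k s n \<alpha> \<epsilon> r (\<lambda>i. sign_of (y i))"
  define Q where "Q = (\<Sum>x=1..k. ?q x)"
  have "Q - 1 = (\<Sum>x=1..k. ?q x - pmf p x)"
    using sum_pmf_eq_1[OF _ p] by (simp add: Q_def sum_subtractf)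
  then have "\<bar>Q - 1\<bar> \<le> (\<Sum>x=1..k. \<bar>?q x - pmf p x\<bar>)" by (simp add: sum_abs)
  then have Q1: "\<bar>Q - 1\<bar> \<le> \<beta>" using err by simp
  then have Q: "Q > 0" using assms(5) by linarith
  have "(\<Sum>x=1..k. \<bar>?q x - ?q x / Q\<bar>) = (\<Sum>x=1..k. ?q x * (\<bar>Q - 1\<bar> / Q))"
  proof (intro sum.cong refl)
    fix x
    have "?q x - ?q x / Q = ?q x * ((Q - 1) / Q)" using Q by (simp add: field_simps)
    then show "\<bar>?q x - ?q x / Q\<bar> = ?q x * (\<bar>Q - 1\<bar> / Q)"
      using thresholded_nonneg[OF assms(2)] Q by (simp add: abs_mult)
  qed
  also have "\<dots> = \<bar>Q - 1\<bar>"
    unfolding sum_distrib_right[symmetric] Q_def[symmetric] using Q by simp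
  finally have N: "(\<Sum>x=1..k. \<bar>?q x - ?q x / Q\<bar>) \<le> \<beta>" using Q1 by simp
  have "(\<Sum>x=1..k. \<bar>pmf p x - pmf (estimator k s n \<alpha> \<epsilon> r y) x\<bar>) = (\<Sum>x=1..k. \<bar>pmf p x - ?q x / Q\<bar>)"
    using Q by (intro sum.cong refl) (simp add: pmf_estimator[OF assms(1,2)] estimate_def Q_def)
  also have "\<dots> \<le> (\<Sum>x=1..k. \<bar>?q x - pmf p x\<bar> + \<bar>?q x - ?q x / Q\<bar>)" by (intro sum_mono) linarith
  also have "\<dots> \<le> 2 * \<beta>" using N err by (simp add: sum.distrib)
  finally show ?thesis by (simp add: tv_dist_def)
qed

text \<open>At most \<open>s\<close> coordinates of the support contribute \<open>7 * t\<close> each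
  to the mean l1 error, and each of up to \<open>k\<close> other coordinates
  \<open>2 * t * s / k\<close>. So the tail of the noise need only be of order \<open>s / k\<close>,
  which costs the logarithm of \<open>k / s\<close>. Markov's inequality ends the proof.\<close>

lemma success_prob_estimator:
  fixes k s n :: nat and \<alpha> \<epsilon> :: real
  assumes k: "1 \<le> k" "1 \<le> s" "real s \<le> real k / 100" and \<alpha>: "0 < \<alpha>" "\<alpha> < 1" and \<epsilon>: "0 < \<epsilon>" and n: "0 < n"
    and t: "t = \<alpha> / (200 * real s)"
    and var: "2 * ln (real k / real s) \<le> real n * (user_bias \<epsilon>)\<^sup>2 * t\<^sup>2"
    and coh: "\<And>x x'. x \<in> {1..k} \<Longrightarrow> x' \<in> {1..k} \<Longrightarrow> x' \<noteq> x \<Longrightarrow>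
      \<bar>\<Sum>i<n. had (bitlen k) (r i) x * had (bitlen k) (r i) x'\<bar> \<le> real n * t"
    and p: "p \<in> sparse_simplex k s"
  shows "success_prob (tv_dist k) \<alpha> n (\<lambda>i. user_channel k \<epsilon> (r i)) (estimator k s n \<alpha> \<epsilon> r) p \<ge> 9 / 10"
proof -
  define T where "T = transcript n (\<lambda>i. user_channel k \<epsilon> (r i)) p"
  define V where "V = real n * (user_bias \<epsilon>)\<^sup>2"
  define L where "L = ln (real k / real s)"
  \<comment> \<open>With this parameter the threshold contributes \<open>exp (- l * t)\<close>,
    which is the square of \<open>s / k\<close>, and the exponential moment at most
    \<open>exp L\<close>, which is \<open>k / s\<close>; the product is
    \<open>s / k\<close>.\<close>
  define l where "l = 2 * L / t"
  define q where "q y x = thresholded k s n \<alpha> \<epsilon> r (\<lambda>i. sign_of (y i)) x" for y :: "nat \<Rightarrow> message" and x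
  define u where "u y x = noise k \<epsilon> n r p y x" for y x
  let ?E = "measure_pmf.expectation T"
  have supp: "set_pmf p \<subseteq> {1..k}" and sparse: "card (set_pmf p) \<le> s"
    using p by (simp_all add: sparse_simplex_def prob_simplex_def)
  have t0: "t > 0" using \<alpha> k unfolding t by simp
  have V: "V > 0" using n user_bias_bounds[OF \<epsilon>] by (simp add: V_def)
  have ks: "100 \<le> real k / real s" using k by (simp add: field_simps)
  have "exp 1 \<le> real k / real s" using exp_le ks by linarith
  then have L: "1 \<le> L" using ks unfolding L_def by (subst ln_ge_iff) auto
  have Vt: "2 * L \<le> V * t\<^sup>2" using var by (simp add: L_def V_def)
  have lt: "l * t = 2 * L" using t0 by (simp add: l_def)
  have fin: "finite (set_pmf T)" unfolding T_def by (rule finite_transcript)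
  note [simp] = integrable_measure_pmf_finite[OF fin]
  have mgf: "?E (\<lambda>y. exp (c * u y x)) \<le> exp (c\<^sup>2 / (2 * V))" for c x
    using noise_mgf[OF \<epsilon> n] unfolding T_def u_def V_def .
  have dec: "\<bar>raw k n r (\<lambda>i. sign_of (y i)) x / (real n * user_bias \<epsilon>) - u y x - pmf p x\<bar> \<le> t"
    if "x \<in> {1..k}" for x y
    unfolding u_def using coh that t0 by (intro raw_decomposition[OF supp \<epsilon> n that]) auto
  have q: "q y x = (if 2 * t < raw k n r (\<lambda>i. sign_of (y i)) x / (real n * user_bias \<epsilon>)
      then raw k n r (\<lambda>i. sign_of (y i)) x / (real n * user_bias \<epsilon>) else 0)" for y x
    unfolding q_def thresholded_def Let_def t by simp
  have on: "?E (\<lambda>y. \<bar>q y x - pmf p x\<bar>) \<le> 7 * t" if x: "x \<in> {1..k}" for x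
  proof -
    have "?E (\<lambda>y. \<bar>q y x - pmf p x\<bar>) \<le> ?E (\<lambda>y. 3 * t + t * (exp (1 / t * u y x) + exp (- 1 / t * u y x)))"
    proof (intro integral_mono)
      fix y
      have "\<bar>q y x - pmf p x\<bar> \<le> 3 * t + \<bar>u y x\<bar>"
        unfolding q using L lt by (intro threshold_error(1)[OF dec[OF x] _ t0, of l]) auto
      also have "\<dots> \<le> 3 * t + t * (exp (1 / t * u y x) + exp (- 1 / t * u y x))"
        using abs_le_exp_sum[OF t0] by simp
      finally show "\<bar>q y x - pmf p x\<bar> \<le> 3 * t + t * (exp (1 / t * u y x) + exp (- 1 / t * u y x))" .
    qed simp_all
    also have "\<dots> = 3 * t + t * (?E (\<lambda>y. exp (1 / t * u y x)) + ?E (\<lambda>y. exp (- 1 / t * u y x)))"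
      by simp
    also have "\<dots> \<le> 3 * t + t * (2 + 2)"
    proof -
      have "1 / (2 * (V * t\<^sup>2)) \<le> 1 / 4" using Vt L by (intro divide_left_mono) auto
      then have "exp (1 / (2 * (V * t\<^sup>2))) \<le> exp (1 / 4)" by simp
      also have "exp (1 / 4 :: real) \<le> 2" using exp_bound_half[of "1 / 4 :: real"] by simp
      finally have e: "exp (1 / (2 * (V * t\<^sup>2))) \<le> 2" .
      have "?E (\<lambda>y. exp (1 / t * u y x)) \<le> 2"
        using order.trans[OF mgf[of "1 / t" x]] e by (simp add: power_divide mult_ac)
      moreover have "?E (\<lambda>y. exp (- 1 / t * u y x)) \<le> 2"
        using order.trans[OF mgf[of "- 1 / t" x]] e by (simp add: power_divide mult_ac)
      ultimately show ?thesis using t0 by (intro add_left_mono mult_left_mono) auto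
    qed
    finally show ?thesis by simp
  qed
  have off: "?E (\<lambda>y. \<bar>q y x - pmf p x\<bar>) \<le> 2 * t * (real s / real k)"
    if x: "x \<in> {1..k}" and x0: "pmf p x = 0" for x
  proof -
    have "?E (\<lambda>y. \<bar>q y x - pmf p x\<bar>) \<le> ?E (\<lambda>y. 2 * t * exp (- 2 * L) * exp (l * u y x))"
    proof (intro integral_mono)
      fix y
      have "\<bar>q y x - pmf p x\<bar> \<le> 2 * (t * exp (l * (u y x - t)))"
        unfolding q using L lt x0 by (intro threshold_error(2)[OF dec[OF x] _ t0, of l]) auto
      also have "l * (u y x - t) = - 2 * L + l * u y x" using lt by (simp add: algebra_simps)
      finally show "\<bar>q y x - pmf p x\<bar> \<le> 2 * t * exp (- 2 * L) * exp (l * u y x)"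
        by (simp only: exp_add mult.assoc)
    qed simp_all
    also have "\<dots> = 2 * t * exp (- 2 * L) * ?E (\<lambda>y. exp (l * u y x))" by simp
    also have "\<dots> \<le> 2 * t * exp (- 2 * L) * exp L"
    proof (intro mult_left_mono order.trans[OF mgf])
      have "l\<^sup>2 / (2 * V) = (2 * L) * (2 * L) / (2 * (V * t\<^sup>2))"
        using t0 V by (simp add: l_def power2_eq_square field_simps)
      also have "\<dots> \<le> (2 * L) * (V * t\<^sup>2) / (2 * (V * t\<^sup>2))"
        using Vt L V t0 by (intro divide_right_mono mult_left_mono) auto
      also have "\<dots> = L" using V t0 by simp
      finally show "exp (l\<^sup>2 / (2 * V)) \<le> exp L" by simp
    qed (use t0 in auto)
    also have "exp (- 2 * L) = exp (- L) * exp (- L)" by (simp add: exp_add[symmetric])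
    also have "exp (- L) = real s / real k" using k by (simp add: L_def exp_minus)
    also have "2 * t * (real s / real k * (real s / real k)) * exp L = 2 * t * (real s / real k)"
      using k by (simp add: L_def)
    finally show ?thesis .
  qed
  have "?E (\<lambda>y. \<Sum>x=1..k. \<bar>q y x - pmf p x\<bar>) = (\<Sum>x=1..k. ?E (\<lambda>y. \<bar>q y x - pmf p x\<bar>))" by simp
  also have "\<dots> \<le> (\<Sum>x=1..k. (if x \<in> set_pmf p then 7 * t else 0) + 2 * t * (real s / real k))"
  proof (intro sum_mono)
    fix x assume x: "x \<in> {1..k}"
    have "0 \<le> 2 * t * (real s / real k)" using t0 by simp
    then show "?E (\<lambda>y. \<bar>q y x - pmf p x\<bar>) \<le> (if x \<in> set_pmf p then 7 * t else 0) + 2 * t * (real s / real k)"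
      using on[OF x] off[OF x] by (auto simp: set_pmf_iff)
  qed
  also have "\<dots> = real (card (set_pmf p)) * (7 * t) + real k * (2 * t * (real s / real k))"
  proof -
    have "{1..k} \<inter> set_pmf p = set_pmf p" using supp by auto
    then show ?thesis by (simp add: sum.distrib sum.If_cases)
  qed
  \<comment> \<open>In total \<open>9 * s * t\<close>, that is \<open>9 / 200 * \<alpha>\<close>.
    The 200 in \<open>t\<close> is chosen to bring this below \<open>\<alpha> / 10\<close>.\<close>
  also have "\<dots> \<le> real s * (7 * t) + real s * (2 * t)"
    using sparse t0 k by (intro add_mono mult_right_mono) auto
  also have "\<dots> \<le> \<alpha> / 10" using k \<alpha> by (simp add: t)
  finally have E: "?E (\<lambda>y. \<Sum>x=1..k. \<bar>q y x - pmf p x\<bar>) \<le> \<alpha> / 10" .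
  have "measure_pmf.prob T {y \<in> space T. \<alpha> \<le> (\<Sum>x=1..k. \<bar>q y x - pmf p x\<bar>)}
      \<le> ?E (\<lambda>y. \<Sum>x=1..k. \<bar>q y x - pmf p x\<bar>) / \<alpha>"
    using \<alpha> by (intro integral_Markov_inequality_measure[where A = "{}"]) (auto intro: sum_nonneg)
  also have "\<dots> \<le> 1 / 10" using E \<alpha> by (simp add: field_simps)
  finally have bad: "measure_pmf.prob T {y. \<alpha> \<le> (\<Sum>x=1..k. \<bar>q y x - pmf p x\<bar>)} \<le> 1 / 10" by simp
  have "1 - 1 / 10 \<le> 1 - measure_pmf.prob T {y. \<alpha> \<le> (\<Sum>x=1..k. \<bar>q y x - pmf p x\<bar>)}" using bad by simp
  also have "\<dots> = measure_pmf.prob T (- {y. \<alpha> \<le> (\<Sum>x=1..k. \<bar>q y x - pmf p x\<bar>)})"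
    using measure_pmf.prob_compl[of "{y. \<alpha> \<le> (\<Sum>x=1..k. \<bar>q y x - pmf p x\<bar>)}" T]
    by (simp add: Compl_eq_Diff_UNIV)
  also have "\<dots> \<le> measure_pmf.prob T {y. tv_dist k p (estimator k s n \<alpha> \<epsilon> r y) \<le> \<alpha>}"
  proof (rule measure_pmf.finite_measure_mono)
    show "- {y. \<alpha> \<le> (\<Sum>x=1..k. \<bar>q y x - pmf p x\<bar>)} \<subseteq> {y. tv_dist k p (estimator k s n \<alpha> \<epsilon> r y) \<le> \<alpha>}"
      using tv_dist_estimator[OF k(1) _ supp, of \<alpha> s n \<epsilon> r] \<alpha> by (auto simp: q_def)
  qed simp
  finally show ?thesis by (simp add: success_prob_def T_def)
qed


section \<open>Incoherent rows\<close>

text \<open>Split the rows by their top digit. Either the columns still differ after losing their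
  own top digits, and induction applies to both halves, or they differ only there, and the halves
  cancel: \<open>1 + c x * c x' = 0\<close>.\<close>

lemma had_orthogonal:
  assumes "x < 2 ^ d" "x' < 2 ^ d" "x \<noteq> x'"
  shows "(\<Sum>r<2 ^ d. had d r x * had d r x') = 0"
  using assms
proof (induction d arbitrary: x x')
  case (Suc d)
  define y where "y z = (if 2 ^ d \<le> z then z - 2 ^ d else z)" for z :: nat
  define c :: "nat \<Rightarrow> real" where "c z = (if 2 ^ d \<le> z then - 1 else 1)" for z
  have lo: "had (Suc d) r z = had d r (y z)" if "r < 2 ^ d" for r z
    using that by (simp add: y_def)
  have hi: "had (Suc d) (r + 2 ^ d) z = c z * had d r (y z)" for r z
    by (simp add: y_def c_def)
  have eq: "(\<Sum>r<2 ^ Suc d. had (Suc d) r x * had (Suc d) r x') =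
      (1 + c x * c x') * (\<Sum>r<2 ^ d. had d r (y x) * had d r (y x'))"
    unfolding sum_two_power_Suc hi
    by (simp add: lo sum_distrib_left sum.distrib algebra_simps del: had.simps)
  show ?case
  proof (cases "y x = y x'")
    case True
    then have "c x * c x' = - 1" using Suc.prems(3) by (auto simp: y_def c_def split: if_splits)
    then show ?thesis unfolding eq by simp
  next
    case False
    then show ?thesis unfolding eq using Suc.IH[of "y x" "y x'"] Suc.prems(1,2)
      by (auto simp: y_def split: if_splits)
  qed
qed simp

lemma cyclic_rows_orthogonal:
  assumes "x < 2 ^ d" "x' < 2 ^ d" "x \<noteq> x'"
  shows "(\<Sum>i<m * 2 ^ d. had d (i mod 2 ^ d) x * had d (i mod 2 ^ d) x') = 0"
proof -
  have "(\<Sum>i<m * 2 ^ d. had d (i mod 2 ^ d) x * had d (i mod 2 ^ d) x') =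
      (\<Sum>j<m. \<Sum>i = j * 2 ^ d..<j * 2 ^ d + 2 ^ d. had d (i mod 2 ^ d) x * had d (i mod 2 ^ d) x')"
    by (rule sum.nat_group[symmetric])
  also have "\<dots> = (\<Sum>j<m. \<Sum>r<2 ^ d. had d r x * had d r x')"
  proof (rule sum.cong[OF refl])
    fix j
    have "(\<Sum>i = j * 2 ^ d..<j * 2 ^ d + 2 ^ d. had d (i mod 2 ^ d) x * had d (i mod 2 ^ d) x') =
      (\<Sum>i = 0..<2 ^ d. had d ((i + j * 2 ^ d) mod 2 ^ d) x * had d ((i + j * 2 ^ d) mod 2 ^ d) x')"
      using sum.shift_bounds_nat_ivl[of "\<lambda>i. had d (i mod 2 ^ d) x * had d (i mod 2 ^ d) x'"
          0 "j * 2 ^ d" "2 ^ d"] by (simp add: add.commute)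
    then show "(\<Sum>i = j * 2 ^ d..<j * 2 ^ d + 2 ^ d. had d (i mod 2 ^ d) x * had d (i mod 2 ^ d) x') =
      (\<Sum>r<2 ^ d. had d r x * had d r x')" by (simp add: atLeast0LessThan)
  qed
  finally show ?thesis using had_orthogonal[OF assms] by simp
qed

text \<open>The probabilistic method with independent uniform rows. By orthogonality the product of
  two different columns has mean zero in a random row, so Hoeffding's lemma controls the inner
  product of each pair, and the hypothesis pays for all pairs and both signs.\<close>

lemma incoherent_rows_exist:
  assumes n: "2 * ln (2 * (2 ^ d)\<^sup>2) < real n * t\<^sup>2" and "0 < t"
  shows "\<exists>r. (\<forall>i. r i < 2 ^ d) \<and> (\<forall>x<2 ^ d. \<forall>x'<2 ^ d. x' \<noteq> x \<longrightarrow>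
    \<bar>\<Sum>i<n. had d (r i) x * had d (r i) x'\<bar> \<le> real n * t)"
proof (rule ccontr)
  assume none: "\<not> ?thesis"
  let ?K = "2 ^ d :: nat"
  define U where "U = pmf_of_set {..<?K}"
  define D where "D = Pi_pmf {..<n} 0 (\<lambda>_. U)"
  define f where "f z r = had d r (fst z) * had d r (snd z)" for z r
  define S where "S r z = (\<Sum>i<n. f z (r i))" for r :: "nat \<Rightarrow> nat" and z
  define Z where "Z = {z \<in> {..<?K} \<times> {..<?K}. fst z \<noteq> snd z}"
  let ?E = "measure_pmf.expectation D"
  have ne: "{..<?K} \<noteq> {}" by (simp add: lessThan_empty_iff)
  have setU: "set_pmf U = {..<?K}" unfolding U_def by (rule set_pmf_of_set[OF ne]) simp
  have setD: "set_pmf D = PiE_dflt {..<n} 0 (\<lambda>_. {..<?K})"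
    unfolding D_def by (subst set_Pi_pmf) (auto simp: o_def setU)
  have fin: "finite (set_pmf D)" unfolding setD by auto
  note [simp] = integrable_measure_pmf_finite[OF fin]
  have finZ: "finite Z" by (simp add: Z_def)
  have mean: "measure_pmf.expectation U (f z) = 0" if "z \<in> Z" for z
    using that had_orthogonal[of "fst z" d "snd z"]
    unfolding U_def f_def Z_def by (subst integral_pmf_of_set[OF ne]) auto
  have f1: "\<bar>f z r\<bar> \<le> 1" for z r
    using had_cases[of d r "fst z"] had_cases[of d r "snd z"] by (auto simp: f_def)
  have mgf: "?E (\<lambda>r. exp (l * S r z)) \<le> exp (real n * (l\<^sup>2 / 2))" if "z \<in> Z" for l z
  proof -
    have "?E (\<lambda>r. exp (l * S r z)) = ?E (\<lambda>r. \<Prod>i<n. exp (l * f z (r i)))"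
      by (simp add: S_def exp_sum[symmetric] sum_distrib_left)
    also have "\<dots> = (\<Prod>i<n. measure_pmf.expectation U (\<lambda>v. exp (l * f z v)))"
      unfolding D_def by (intro expectation_prod_Pi_pmf) (auto intro: integrable_measure_pmf_finite simp: setU)
    also have "\<dots> \<le> (\<Prod>i<n. exp (l\<^sup>2 / 2))"
    proof (intro prod_mono conjI Bochner_Integration.integral_nonneg)
      show "measure_pmf.expectation U (\<lambda>v. exp (l * f z v)) \<le> exp (l\<^sup>2 / 2)"
        using hoeffding_mgf[of U "f z" l] f1 mean[OF that] by (simp add: setU)
    qed simp
    also have "\<dots> = exp (real n * (l\<^sup>2 / 2))" by (simp add: exp_of_nat_mult[symmetric])
    finally show ?thesis .
  qed
  \<comment> \<open>If every choice of rows fails on some pair, the sum of exponentials is large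
    everywhere, which contradicts its mean.\<close>
  have "exp (real n * t\<^sup>2) \<le> (\<Sum>z\<in>Z. exp (t * S r z) + exp (- t * S r z))" if r: "r \<in> set_pmf D" for r
  proof -
    have "r i < ?K" for i using r unfolding setD PiE_dflt_def by (cases "i < n") auto
    then obtain x x' where x: "x < ?K" "x' < ?K" "x' \<noteq> x"
        "real n * t < \<bar>\<Sum>i<n. had d (r i) x * had d (r i) x'\<bar>"
      using none by (meson not_le)
    have z: "(x, x') \<in> Z" using x by (auto simp: Z_def)
    have S: "real n * t < \<bar>S r (x, x')\<bar>" using x(4) by (simp add: S_def f_def)
    have "real n * t\<^sup>2 = t * (real n * t)" by (simp add: power2_eq_square)
    also have "\<dots> \<le> t * \<bar>S r (x, x')\<bar>" using S assms(2) by (intro mult_left_mono) auto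
    finally have "exp (real n * t\<^sup>2) \<le> exp (t * \<bar>S r (x, x')\<bar>)" by simp
    also have "\<dots> \<le> exp (t * S r (x, x')) + exp (- t * S r (x, x'))"
      by (cases "0 \<le> S r (x, x')") (simp_all add: abs_if)
    also have "\<dots> \<le> (\<Sum>z\<in>Z. exp (t * S r z) + exp (- t * S r z))"
      by (rule member_le_sum[OF z _ finZ]) (simp add: add_nonneg_nonneg)
    finally show ?thesis .
  qed
  then have "?E (\<lambda>r. exp (real n * t\<^sup>2)) \<le> ?E (\<lambda>r. \<Sum>z\<in>Z. exp (t * S r z) + exp (- t * S r z))"
    by (intro integral_mono_AE) (auto simp: AE_measure_pmf_iff)
  also have "\<dots> = (\<Sum>z\<in>Z. ?E (\<lambda>r. exp (t * S r z)) + ?E (\<lambda>r. exp (- t * S r z)))" by simp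
  also have "\<dots> \<le> (\<Sum>z\<in>Z. exp (real n * (t\<^sup>2 / 2)) + exp (real n * (t\<^sup>2 / 2)))"
    using mgf[of _ t] mgf[of _ "- t"] by (intro sum_mono add_mono) simp_all
  also have "\<dots> = real (card Z) * (2 * exp (real n * (t\<^sup>2 / 2)))" by simp
  also have "\<dots> \<le> (2 ^ d)\<^sup>2 * (2 * exp (real n * (t\<^sup>2 / 2)))"
  proof (rule mult_right_mono)
    have "card Z \<le> card ({..<?K} \<times> {..<?K})" by (rule card_mono) (auto simp: Z_def)
    then have "real (card Z) \<le> real (?K * ?K)" by (simp only: of_nat_le_iff) simp
    then show "real (card Z) \<le> (2 ^ d)\<^sup>2" by (simp add: power2_eq_square)
  qed simp
  finally have "exp (real n * t\<^sup>2) \<le> 2 * (2 ^ d)\<^sup>2 * exp (real n * (t\<^sup>2 / 2))" by simp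
  then have "exp (real n * (t\<^sup>2 / 2)) * exp (real n * (t\<^sup>2 / 2)) \<le> 2 * (2 ^ d)\<^sup>2 * exp (real n * (t\<^sup>2 / 2))"
    by (simp add: exp_add[symmetric])
  then have "exp (real n * (t\<^sup>2 / 2)) \<le> 2 * (2 ^ d)\<^sup>2" by simp
  then have "real n * (t\<^sup>2 / 2) \<le> ln (2 * (2 ^ d)\<^sup>2)" by (subst ln_ge_iff) auto
  then show False using n by simp
qed

section \<open>The upper bound\<close>

lemma log_ratio_ge_1:
  fixes k s :: nat
  assumes "1 \<le> s" "real s \<le> real k / 100"
  shows "1 \<le> ln (real k / real s)"
proof -
  have ks: "100 \<le> real k / real s" using assms by (simp add: field_simps)
  have "exp 1 \<le> real k / real s" using exp_le ks by linarith
  then show ?thesis using ks by (subst ln_ge_iff) auto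
qed

lemma rows_exist:
  fixes k s :: nat and \<alpha> \<epsilon> \<epsilon>\<^sub>0 :: real
  assumes k: "1 \<le> k" "1 \<le> s" "real s \<le> real k / 100" and \<alpha>: "0 < \<alpha>" "\<alpha> < 1" and \<epsilon>: "0 < \<epsilon>" "\<epsilon> \<le> \<epsilon>\<^sub>0"
    and t: "t = \<alpha> / (200 * real s)"
  shows "\<exists>n r. 0 < n \<and> real n \<le> (480000 * (2 + \<epsilon>\<^sub>0)\<^sup>2 + 3 * \<epsilon>\<^sub>0\<^sup>2) * sparse_rate k s \<alpha> \<epsilon> \<and>
    (\<forall>i. r i < 2 ^ bitlen k) \<and>
    2 * ln (real k / real s) \<le> real n * (user_bias \<epsilon>)\<^sup>2 * t\<^sup>2 \<and>
    (\<forall>x\<in>{1..k}. \<forall>x'\<in>{1..k}. x' \<noteq> x \<longrightarrow>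
      \<bar>\<Sum>i<n. had (bitlen k) (r i) x * had (bitlen k) (r i) x'\<bar> \<le> real n * t)"
proof -
  define R where "R = sparse_rate k s \<alpha> \<epsilon>"
  define L where "L = ln (real k / real s)"
  \<comment> \<open>\<open>40000\<close> is the square of the 200 in \<open>t\<close>, and 12 comes
    from \<open>ln (2 * K\<^sup>2) \<le> 3 * ln k \<le> 6 * L\<close> for
    \<open>K = 2 ^ bitlen k\<close>, in the case of random rows. The extra
    \<open>3 * \<epsilon>\<^sub>0\<^sup>2\<close> in the claim pays for rounding
    \<open>n\<^sub>0\<close> and for filling up to a multiple of \<open>K \<le> 2 * k\<close>, which
    is below \<open>2 * s\<^sup>2\<close> in the cyclic case.\<close>
  define A where "A = 480000 * (2 + \<epsilon>\<^sub>0)\<^sup>2"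
  define n\<^sub>0 where "n\<^sub>0 = nat \<lceil>A * R\<rceil>"
  let ?K = "2 ^ bitlen k :: nat"
  have L: "1 \<le> L" unfolding L_def using k by (intro log_ratio_ge_1) auto
  have R: "R = (real s)\<^sup>2 * L / (\<alpha>\<^sup>2 * \<epsilon>\<^sup>2)" using L by (simp add: R_def sparse_rate_def L_def)
  have t0: "t > 0" using \<alpha> k by (simp add: t)
  have Rt: "R * \<epsilon>\<^sup>2 * (40000 * t\<^sup>2) = L" using \<alpha> \<epsilon> k by (simp add: R t power2_eq_square)
  have R0: "R > 0" using L \<alpha> \<epsilon> k by (simp add: R)
  have ss: "(real s)\<^sup>2 \<le> \<epsilon>\<^sub>0\<^sup>2 * R"
  proof -
    have "(real s)\<^sup>2 * (\<alpha>\<^sup>2 * \<epsilon>\<^sup>2) \<le> (real s)\<^sup>2 * (1 * \<epsilon>\<^sub>0\<^sup>2)"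
      using \<alpha> \<epsilon> by (intro mult_left_mono mult_mono power_mono power_le_one) auto
    also have "\<dots> \<le> (real s)\<^sup>2 * (1 * \<epsilon>\<^sub>0\<^sup>2) * L"
      using mult_left_mono[OF L, of "(real s)\<^sup>2 * (1 * \<epsilon>\<^sub>0\<^sup>2)"] by simp
    finally show ?thesis using \<alpha> \<epsilon> unfolding R by (simp add: field_simps)
  qed
  have s1: "1 \<le> (real s)\<^sup>2" using k by simp
  have A0: "A > 0" using \<epsilon> by (simp add: A_def)
  have AR: "0 < A * R" using A0 R0 by simp
  have n\<^sub>0: "A * R \<le> real n\<^sub>0" "real n\<^sub>0 \<le> A * R + 1" using AR unfolding n\<^sub>0_def by linarith+
  have "real ?K \<le> real (2 * k)" using two_power_bitlen_le[OF k(1)] by (simp only: of_nat_le_iff)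
  then have K: "real ?K \<le> 2 * real k" by simp
  have xK: "x < ?K" if "x \<in> {1..k}" for x using that bitlen[of k] by simp
  have var: "2 * L \<le> real n * (user_bias \<epsilon>)\<^sup>2 * t\<^sup>2" if "A * R \<le> real n" for n
  proof -
    have "\<epsilon> / (2 + \<epsilon>\<^sub>0) \<le> user_bias \<epsilon>" using \<epsilon> by (simp add: user_bias_def frac_le)
    then have "(\<epsilon> / (2 + \<epsilon>\<^sub>0))\<^sup>2 \<le> (user_bias \<epsilon>)\<^sup>2" using \<epsilon> by (intro power_mono) auto
    moreover have "A * R * (\<epsilon> / (2 + \<epsilon>\<^sub>0))\<^sup>2 * t\<^sup>2 = 12 * L"
    proof -
      have "A * R * (\<epsilon> / (2 + \<epsilon>\<^sub>0))\<^sup>2 * t\<^sup>2 = 12 * (R * \<epsilon>\<^sup>2 * (40000 * t\<^sup>2))"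
        using \<epsilon> by (simp add: A_def power_divide)
      then show ?thesis by (simp only: Rt)
    qed
    moreover from that AR calculation(1)
    have "A * R * (\<epsilon> / (2 + \<epsilon>\<^sub>0))\<^sup>2 * t\<^sup>2 \<le> real n * (user_bias \<epsilon>)\<^sup>2 * t\<^sup>2"
      by (intro mult_right_mono mult_mono) auto
    ultimately have "12 * L \<le> real n * (user_bias \<epsilon>)\<^sup>2 * t\<^sup>2" by simp
    then show ?thesis using L by linarith
  qed
  show ?thesis
  proof (cases "(real s)\<^sup>2 \<le> real k")
    case True
    have lnk: "ln (real k) \<le> 2 * L"
    proof -
      have "real k * (real s)\<^sup>2 \<le> real k * real k" using True by (intro mult_left_mono) auto
      then have "real k \<le> (real k / real s)\<^sup>2" using k by (simp add: field_simps power2_eq_square)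
      then have "ln (real k) \<le> ln ((real k / real s)\<^sup>2)" using k by simp
      also have "\<dots> = 2 * L" using k by (simp add: L_def ln_realpow)
      finally show ?thesis .
    qed
    have k8: "8 \<le> real k" using k by simp
    have "2 * (2 ^ bitlen k)\<^sup>2 \<le> real k ^ 3"
    proof -
      have "(2 ^ bitlen k)\<^sup>2 \<le> (2 * real k)\<^sup>2" using K by (intro power_mono) auto
      then have "2 * (2 ^ bitlen k)\<^sup>2 \<le> 8 * (real k)\<^sup>2" by (simp add: power2_eq_square)
      also have "\<dots> \<le> real k * (real k)\<^sup>2" using k8 by (intro mult_right_mono) auto
      finally show ?thesis by (simp add: power3_eq_cube power2_eq_square)
    qed
    then have "ln (2 * (2 ^ bitlen k)\<^sup>2) \<le> ln (real k ^ 3)" using k8 by simp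
    also have "\<dots> = 3 * ln (real k)" using k8 by (simp add: ln_realpow)
    finally have "2 * ln (2 * (2 ^ bitlen k)\<^sup>2) \<le> 12 * L" using lnk by simp
    also have "12 * L < A * R * t\<^sup>2"
    proof -
      have "12 * L = 480000 * \<epsilon>\<^sup>2 * (R * t\<^sup>2)" unfolding Rt[symmetric] by simp
      also have "\<dots> < A * (R * t\<^sup>2)"
      proof (rule mult_strict_right_mono)
        have "\<epsilon>\<^sup>2 < (2 + \<epsilon>\<^sub>0)\<^sup>2" using \<epsilon> by (intro power_strict_mono) auto
        then show "480000 * \<epsilon>\<^sup>2 < A" by (simp add: A_def)
      qed (use R0 t0 in simp)
      finally show ?thesis by (simp add: mult.assoc)
    qed
    also have "\<dots> \<le> real n\<^sub>0 * t\<^sup>2" using n\<^sub>0(1) by (intro mult_right_mono) auto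
    finally have "2 * ln (2 * (2 ^ bitlen k)\<^sup>2) < real n\<^sub>0 * t\<^sup>2" .
    from incoherent_rows_exist[OF this t0] obtain r where r: "\<forall>i. r i < ?K"
      "\<forall>x<?K. \<forall>x'<?K. x' \<noteq> x \<longrightarrow>
         \<bar>\<Sum>i<n\<^sub>0. had (bitlen k) (r i) x * had (bitlen k) (r i) x'\<bar> \<le> real n\<^sub>0 * t" by blast
    have "0 < real n\<^sub>0" using n\<^sub>0(1) AR by linarith
    moreover have "real n\<^sub>0 \<le> (A + 3 * \<epsilon>\<^sub>0\<^sup>2) * R"
      using n\<^sub>0(2) ss s1 by (simp add: distrib_right)
    ultimately show ?thesis using r var[OF n\<^sub>0(1)] xK
      unfolding R_def A_def L_def by (intro exI[of _ n\<^sub>0] exI[of _ r]) simp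
  next
    case False
    define m where "m = n\<^sub>0 div ?K + 1"
    define n where "n = m * ?K"
    have "n\<^sub>0 = n\<^sub>0 div ?K * ?K + n\<^sub>0 mod ?K" by (rule div_mult_mod_eq[symmetric])
    moreover have "n\<^sub>0 mod ?K < ?K" by simp
    ultimately have n: "n\<^sub>0 \<le> n" "n \<le> n\<^sub>0 + ?K"
      unfolding n_def m_def add_mult_distrib mult_1 by linarith+
    have nA: "A * R \<le> real n" using n\<^sub>0(1) n(1) by linarith
    have coh: "(\<Sum>i<n. had (bitlen k) (i mod ?K) x * had (bitlen k) (i mod ?K) x') = 0"
      if "x \<in> {1..k}" "x' \<in> {1..k}" "x' \<noteq> x" for x x'
      unfolding n_def using that xK by (intro cyclic_rows_orthogonal) auto
    have "real n \<le> real n\<^sub>0 + real ?K" using n(2) by linarith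
    also have "\<dots> \<le> A * R + 1 + 2 * (real s)\<^sup>2" using n\<^sub>0(2) K False by linarith
    also have "\<dots> \<le> (A + 3 * \<epsilon>\<^sub>0\<^sup>2) * R" using ss s1 by (simp add: distrib_right)
    finally have "real n \<le> (A + 3 * \<epsilon>\<^sub>0\<^sup>2) * R" .
    moreover have "0 < real n" using nA AR by linarith
    ultimately show ?thesis using var[OF nA] coh t0
      unfolding R_def A_def L_def by (intro exI[of _ n] exI[of _ "\<lambda>i. i mod ?K"]) simp
  qed
qed

lemma sample_complexity_le:
  assumes "private_coin_protocol k \<W> n W est"
    and "\<And>p. p \<in> \<P> \<Longrightarrow> 9 / 10 \<le> success_prob d \<alpha> n W est p"
  shows "sample_complexity k \<alpha> \<P> \<W> d \<le> enat n"
  unfolding sample_complexity_def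
proof (rule Inf_lower, intro CollectI exI conjI)
  let ?U = "measure_pmf (return_pmf (0 :: real))"
  show "public_coin_protocol k \<W> n ?U (\<lambda>_. W) (\<lambda>_. est)"
    using assms(1) by (simp add: public_coin_protocol_def measure_pmf.prob_space_axioms)
  show "\<forall>p\<in>\<P>. 9 / 10 \<le> (\<integral>u. success_prob d \<alpha> n W est p \<partial>?U)"
    using assms(2) by simp
qed simp

lemma running_time_bound:
  assumes "100 \<le> k"
  shows "real (n * (20 + 14 * bitlen k) + (50 + 9 * n + 12 * k + 30 * 2 ^ bitlen k * bitlen k)) \<le>
    313 * real (n + k) * ln (real (n + k)) ^ 2"
proof -
  define N where "N = real (n + k)"
  define l where "l = ln N"
  define J where "J = bitlen k"
  have N: "100 \<le> N" "real k \<le> N" "real n \<le> N" using assms by (simp_all add: N_def)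
  have "exp 1 \<le> N" using exp_le N by linarith
  then have l: "1 \<le> l" using N unfolding l_def by (subst ln_ge_iff) auto
  have "2 ^ J \<le> 2 * k" using two_power_bitlen_le[of k] assms by (simp add: J_def)
  then have "real (2 ^ J) \<le> real (2 * k)" by (simp only: of_nat_le_iff)
  then have K: "2 ^ J \<le> 2 * real k" by simp
  have "2 * real k \<le> N ^ 2"
    unfolding power2_eq_square using N by (intro mult_mono) auto
  then have "ln (2 ^ J) \<le> ln (N ^ 2)" using K N by (subst ln_le_cancel_iff) auto
  then have "real J * ln 2 \<le> 2 * l" using N by (simp add: ln_realpow l_def)
  moreover have "real J * (2 / 3) \<le> real J * ln 2" using ln2_ge_two_thirds by (intro mult_left_mono) auto
  ultimately have J: "real J \<le> 3 * l" by simp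
  have a: "N \<le> N * l" "0 \<le> N * l" using l N by (simp_all add: mult_le_cancel_left1)
  have b: "real n * real J \<le> N * (3 * l)" using J N l by (intro mult_mono) auto
  have c: "2 ^ J * real J \<le> (2 * N) * (3 * l)" using J N l K by (intro mult_mono) auto
  have "real (n * (20 + 14 * J) + (50 + 9 * n + 12 * k + 30 * 2 ^ J * J)) =
      20 * real n + 14 * (real n * real J) + 50 + 9 * real n + 12 * real k + 30 * (2 ^ J * real J)"
    by (simp add: algebra_simps)
  \<comment> \<open>The bit length is at most \<open>3 * l\<close>, so the six terms add up to 20 +
    42 + 50 + 9 + 12 + 180.\<close>
  also have "\<dots> \<le> 313 * (N * l)" using a b c N by linarith
  also have "\<dots> \<le> 313 * (N * l ^ 2)"
    using l N by (simp add: power2_eq_square mult_le_cancel_left1)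
  finally show ?thesis unfolding N_def l_def J_def mult.assoc .
qed

lemma upper_bound:
  fixes \<epsilon>\<^sub>0 :: real
  assumes "0 < \<epsilon>\<^sub>0"
  shows "\<exists>C>0. \<exists>e :: nat. \<exists>user server :: program.
        \<forall>(k :: nat) (s :: nat) (\<alpha> :: real) (\<epsilon> :: real).
        1 \<le> k \<and> 1 \<le> s \<and> real s \<le> real k / 100 \<and> 0 < \<alpha> \<and> \<alpha> < 1 \<and> 0 < \<epsilon> \<and> \<epsilon> \<le> \<epsilon>\<^sub>0 \<longrightarrow>
          ereal_of_enat (sample_complexity k \<alpha> (sparse_simplex k s) (ldp_channels k \<epsilon>) (tv_dist k))
            \<le> ereal (C * sparse_rate k s \<alpha> \<epsilon>) \<and>
          (\<exists>n W est lab t\<^sub>u t\<^sub>s.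
             real n \<le> C * sparse_rate k s \<alpha> \<epsilon> \<and>
             private_coin_protocol k (ldp_channels k \<epsilon>) n W est \<and>
             (\<forall>i<n. one_bit k (W i)) \<and>
             (\<forall>p\<in>sparse_simplex k s. success_prob (tv_dist k) \<alpha> n W est p \<ge> 9 / 10) \<and>
             (\<forall>i<n. lab i \<le> (n + k) ^ e) \<and>
             (\<forall>i<n. implements_channel user k s n \<alpha> \<epsilon> (lab i) (W i) t\<^sub>u) \<and>
             implements_estimator server k s n \<alpha> \<epsilon> lab est t\<^sub>s \<and>
             real (n * t\<^sub>u + t\<^sub>s) \<le> C * real (n + k) * ln (real (n + k)) ^ e)"
proof -
  define C where "C = 480000 * (2 + \<epsilon>\<^sub>0)\<^sup>2 + 3 * \<epsilon>\<^sub>0\<^sup>2 + 313"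
  have C0: "C > 0" unfolding C_def using assms by (intro add_nonneg_pos) auto
  show ?thesis
  \<comment> \<open>The exponent 2 serves both bounds: labels are at most
    \<open>2 * k \<le> (n + k)\<^sup>2\<close>, and the single logarithm in the running time is at
    least 1. Likewise \<open>C\<close> bounds the number of users as well as the time, to which it
    adds 313.\<close>
  proof (rule exI[of _ C], rule conjI[OF C0], rule exI[of _ "2 :: nat"], rule exI[of _ user_program],
      rule exI[of _ server_program], intro allI impI conjI)
    fix k s :: nat and \<alpha> \<epsilon> :: real
    assume "1 \<le> k \<and> 1 \<le> s \<and> real s \<le> real k / 100 \<and> 0 < \<alpha> \<and> \<alpha> < 1 \<and> 0 < \<epsilon> \<and> \<epsilon> \<le> \<epsilon>\<^sub>0"
    then have k: "1 \<le> k" "1 \<le> s" "real s \<le> real k / 100" and \<alpha>: "0 < \<alpha>" "\<alpha> < 1"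
      and \<epsilon>: "0 < \<epsilon>" "\<epsilon> \<le> \<epsilon>\<^sub>0" by simp_all
    obtain n r where n: "0 < n"
      and nR: "real n \<le> (480000 * (2 + \<epsilon>\<^sub>0)\<^sup>2 + 3 * \<epsilon>\<^sub>0\<^sup>2) * sparse_rate k s \<alpha> \<epsilon>"
      and r: "\<And>i. r i < 2 ^ bitlen k"
      and var: "2 * ln (real k / real s) \<le> real n * (user_bias \<epsilon>)\<^sup>2 * (\<alpha> / (200 * real s))\<^sup>2"
      and coh: "\<And>x x'. x \<in> {1..k} \<Longrightarrow> x' \<in> {1..k} \<Longrightarrow> x' \<noteq> x \<Longrightarrow>
         \<bar>\<Sum>i<n. had (bitlen k) (r i) x * had (bitlen k) (r i) x'\<bar> \<le> real n * (\<alpha> / (200 * real s))"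
      using rows_exist[OF k \<alpha> \<epsilon> refl] by blast
    let ?W = "\<lambda>i. user_channel k \<epsilon> (r i)" and ?est = "estimator k s n \<alpha> \<epsilon> r"
    have rate0: "0 \<le> sparse_rate k s \<alpha> \<epsilon>" by (simp add: sparse_rate_def)
    have nC: "real n \<le> C * sparse_rate k s \<alpha> \<epsilon>"
      using nR rate0 unfolding C_def by (simp add: distrib_right)
    have prot: "private_coin_protocol k (ldp_channels k \<epsilon>) n ?W ?est"
      using user_channel_ldp[OF \<epsilon>(1)] estimator_in_prob_simplex[OF k(1)] \<alpha>
      by (simp add: private_coin_protocol_def)
    have succ: "9 / 10 \<le> success_prob (tv_dist k) \<alpha> n ?W ?est p" if "p \<in> sparse_simplex k s" for p
      by (rule success_prob_estimator[OF k \<alpha> \<epsilon>(1) n refl var coh that])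
    have k100: "100 \<le> k" using k by linarith
    have "ereal_of_enat (sample_complexity k \<alpha> (sparse_simplex k s) (ldp_channels k \<epsilon>) (tv_dist k))
        \<le> ereal_of_enat (enat n)"
      using sample_complexity_le[OF prot succ] by (simp only: ereal_of_enat_le_iff)
    then show "ereal_of_enat (sample_complexity k \<alpha> (sparse_simplex k s) (ldp_channels k \<epsilon>) (tv_dist k))
        \<le> ereal (C * sparse_rate k s \<alpha> \<epsilon>)"
      using nC by (simp add: order.trans)
    have lab: "r i \<le> (n + k) ^ 2" for i
    proof -
      have "r i \<le> 2 * k" using r[of i] two_power_bitlen_le[OF k(1)] by linarith
      also have "2 * k \<le> (n + k) * (n + k)" using k100 by (intro mult_mono) auto
      finally show ?thesis by (simp add: power2_eq_square)
    qed
    have est: "implements_estimator server_program k s n \<alpha> \<epsilon> r ?est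
        (50 + 9 * n + 12 * k + 30 * 2 ^ bitlen k * bitlen k)"
      unfolding implements_estimator_def
    proof (intro allI impI)
      fix y
      have "0 \<le> \<alpha>" using \<alpha> by simp
      from runs_server_program[where lab = r and n = n and s = s and \<epsilon> = \<epsilon> and y = y, OF k(1) this r]
      show "\<exists>t'\<le>50 + 9 * n + 12 * k + 30 * 2 ^ bitlen k * bitlen k. \<exists>\<tau>.
          exec server_program (server_input k s n \<alpha> \<epsilon> r y) t' \<tau> \<and>
          (\<forall>x\<in>{1..k}. rmem \<tau> x = pmf (?est y) x)"
        unfolding runs_def using pmf_estimator[OF k(1) \<open>0 \<le> \<alpha>\<close>] by auto
    qed
    have time: "real (n * (20 + 14 * bitlen k) + (50 + 9 * n + 12 * k + 30 * 2 ^ bitlen k * bitlen k))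
        \<le> C * real (n + k) * ln (real (n + k)) ^ 2"
    proof (rule order.trans[OF running_time_bound[OF k100]])
      have "313 \<le> C" unfolding C_def by simp
      then show "313 * real (n + k) * ln (real (n + k)) ^ 2 \<le> C * real (n + k) * ln (real (n + k)) ^ 2"
        by (intro mult_right_mono) auto
    qed
    show "\<exists>n W est lab t\<^sub>u t\<^sub>s.
             real n \<le> C * sparse_rate k s \<alpha> \<epsilon> \<and>
             private_coin_protocol k (ldp_channels k \<epsilon>) n W est \<and>
             (\<forall>i<n. one_bit k (W i)) \<and>
             (\<forall>p\<in>sparse_simplex k s. success_prob (tv_dist k) \<alpha> n W est p \<ge> 9 / 10) \<and>
             (\<forall>i<n. lab i \<le> (n + k) ^ 2) \<and>
             (\<forall>i<n. implements_channel user_program k s n \<alpha> \<epsilon> (lab i) (W i) t\<^sub>u) \<and>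
             implements_estimator server_program k s n \<alpha> \<epsilon> lab est t\<^sub>s \<and>
             real (n * t\<^sub>u + t\<^sub>s) \<le> C * real (n + k) * ln (real (n + k)) ^ 2"
      using nC prot one_bit_user_channel succ lab implements_user_channel[OF \<epsilon>(1)] est time
      by blast
  qed
qed

theorem theorem1:
  fixes \<epsilon>\<^sub>0 :: real
  assumes "0 < \<epsilon>\<^sub>0"
  shows
    "(\<forall>\<alpha>\<^sub>1<1. \<exists>c>0. \<forall>(k :: nat) (s :: nat) (\<alpha> :: real) (\<epsilon> :: real).
        1 \<le> k \<and> 1 \<le> s \<and> real s \<le> real k / 100 \<and> 0 < \<alpha> \<and> \<alpha> < 1 \<and> 0 < \<epsilon> \<and> \<epsilon> \<le> \<epsilon>\<^sub>0 \<and>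
        \<alpha> \<le> \<alpha>\<^sub>1 \<and> \<alpha> \<le> 1 - 2 * real s / real k \<longrightarrow>
          ereal (c * sparse_rate k s (if s = 1 then 1 else \<alpha>) \<epsilon>)
            \<le> ereal_of_enat (sample_complexity k \<alpha> (sparse_simplex k s) (ldp_channels k \<epsilon>) (tv_dist k))) \<and>
     (\<exists>C>0. \<exists>e :: nat. \<exists>user server :: program.
        \<forall>(k :: nat) (s :: nat) (\<alpha> :: real) (\<epsilon> :: real).
        1 \<le> k \<and> 1 \<le> s \<and> real s \<le> real k / 100 \<and> 0 < \<alpha> \<and> \<alpha> < 1 \<and> 0 < \<epsilon> \<and> \<epsilon> \<le> \<epsilon>\<^sub>0 \<longrightarrow>
          ereal_of_enat (sample_complexity k \<alpha> (sparse_simplex k s) (ldp_channels k \<epsilon>) (tv_dist k))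
            \<le> ereal (C * sparse_rate k s \<alpha> \<epsilon>) \<and>
          (\<exists>n W est lab t\<^sub>u t\<^sub>s.
             real n \<le> C * sparse_rate k s \<alpha> \<epsilon> \<and>
             private_coin_protocol k (ldp_channels k \<epsilon>) n W est \<and>
             (\<forall>i<n. one_bit k (W i)) \<and>
             (\<forall>p\<in>sparse_simplex k s. success_prob (tv_dist k) \<alpha> n W est p \<ge> 9 / 10) \<and>
             (\<forall>i<n. lab i \<le> (n + k) ^ e) \<and>
             (\<forall>i<n. implements_channel user k s n \<alpha> \<epsilon> (lab i) (W i) t\<^sub>u) \<and>
             implements_estimator server k s n \<alpha> \<epsilon> lab est t\<^sub>s \<and>
             real (n * t\<^sub>u + t\<^sub>s) \<le> C * real (n + k) * ln (real (n + k)) ^ e))"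
  using lower_bound[of _ \<epsilon>\<^sub>0] upper_bound[OF assms] by (intro conjI allI impI)

end
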